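(* Let $S_x,S_y\subset\mathbb{R}^3$ be non-degenerate flat triangles lying in distinct parallel planes. Let $\delta=\mathbf{n}_x\cdot(\mathbf{y}-\mathbf{x})\ne0$ be the signed distance between the planes ($\mathbf{x}\in S_x$, $\mathbf{y}\in S_y$ arbitrary), $G(\mathbf{x},\mathbf{y})=1/|\mathbf{x}-\mathbf{y}|$, and $$M=\int_{S_y}\int_{S_x}\mathbf{n}_x\cdot\nabla_{\mathbf{x}}G\,dS(\mathbf{x})dS(\mathbf{y}),\qquad \mathbf{L}'=\int_{S_y}\nabla_{\mathbf{y}}\int_{S_x}G\,dS(\mathbf{x})dS(\mathbf{y}).$$ With the notation of the context, $$M=4A_xA_y\,\delta\; I_4'(\mathbf{a}_1,\mathbf{a}_2,\mathbf{a}_3,\mathbf{a}_4;\mathbf{x}_1-\mathbf{y}_1),\qquad \mathbf{L}'=-\sum_{i=1}^3\mathbf{n}_{cxi}\,2l_{xi}A_y\,\widetilde I_{3,i}-\mathbf{n}_xM,$$ where $I_4'$ denotes the recursion of the context evaluated with terminal functions $F_1'$, and $$\widetilde I_{3,1}=\widetilde I_3(\mathbf{a}_3,\mathbf{a}_4,\mathbf{a}_1;\mathbf{e}_\Vert),\quad \widetilde I_{3,2}=\widetilde I_3(\mathbf{a}_3,\mathbf{a}_4,\mathbf{a}_2-\mathbf{a}_1;\mathbf{e}_\Vert+\mathbf{a}_1),\quad \widetilde I_{3,3}=\widetilde I_3(\mathbf{a}_3,\mathbf{a}_4,\mathbf{a}_2;\mathbf{e}_\Vert),$$ where $\mathbf{e}_\Vert$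 is the orthogonal projection of $\mathbf{x}_1-\mathbf{y}_1$ onto $\mathrm{span}(\mathbf{a}_1,\mathbf{a}_2,\mathbf{a}_3,\mathbf{a}_4)$ and $\widetilde I_3$ denotes the recursion for $I_3$ in the context, with inherited value $h_4=|\delta|$, evaluated with terminal functions $\widetilde F_1$.
   Context: $S_x$ has vertices $\mathbf{x}_1,\mathbf{x}_2,\mathbf{x}_3$ and area $A_x$; $\mathbf{l}_{x1}=\mathbf{x}_2-\mathbf{x}_1$, $\mathbf{l}_{x2}=\mathbf{x}_3-\mathbf{x}_2$, $\mathbf{l}_{x3}=\mathbf{x}_1-\mathbf{x}_3$, $l_{xi}=|\mathbf{l}_{xi}|$, $\mathbf{n}_x=-(\mathbf{l}_{x1}\times\mathbf{l}_{x3})/(2A_x)$, $\mathbf{n}_{cxi}=(\mathbf{l}_{xi}\times\mathbf{n}_x)/l_{xi}$. $S_y$ has vertices $\mathbf{y}_1,\mathbf{y}_2,\mathbf{y}_3$ and area $A_y$. Put $\mathbf{a}_1=\mathbf{x}_2-\mathbf{x}_1$, $\mathbf{a}_2=\mathbf{x}_3-\mathbf{x}_1$, $\mathbf{a}_3=-(\mathbf{y}_2-\mathbf{y}_1)$, $\mathbf{a}_4=-(\mathbf{y}_3-\mathbf{y}_1)$. Projections. For vectors $\mathbf{a}_1,\dots,\mathbf{a}_d,\mathbf{e}\in\mathbb{R}^3$ write $\mathbf{e}=\mathbf{e}_{\Vert}+\mathbf{e}_{\perp}$ with $\mathbf{e}_{\Vert}\in\mathrm{span}(\mathbf{a}_1,\dots,\mathbf{a}_d)$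 and $\mathbf{e}_\perp$ orthogonal to that span; put $h_d=|\mathbf{e}_\perp|$, and let $s_{10},\dots,s_{d0}$ be real coefficients with $\mathbf{e}_\Vert=s_{10}\mathbf{a}_1+\dots+s_{d0}\mathbf{a}_d$ (if not unique, any fixed choice). Recursion. In each line below, $s_{i0}$, $\mathbf{e}_\Vert$ and $h_d$ are those of the arguments on the left-hand side ($d=4$ for $I_4$, $d=3$ for $I_3$, $d=2$ for $Q,T$, $d=1$ for $I_1$). Each expression passes its own $h_d$ and the inherited $h_{d+1},\dots,h_4$ to its children. A term whose scalar coefficient is zero is omitted (counted as $0$). $\mathcal F$ denotes the chosen terminal function ($F_1'$ or $\widetilde F_1$). $$\begin{aligned} I_4(\mathbf{a}_1,\mathbf{a}_2,\mathbf{a}_3,\mathbf{a}_4;\mathbf{e})=&-s_{40}I_3(\mathbf{a}_1,\mathbf{a}_2,\mathbf{a}_3;\mathbf{e}_\Vert)+(1+s_{30}+s_{40})I_3(\mathbf{a}_1,\mathbf{a}_2,\mathbf{a}_4-\mathbf{a}_3;\mathbf{e}_\Vert+\mathbf{a}_3)\\&-s_{30}I_3(\mathbf{a}_1,\mathbf{a}_2,\mathbf{a}_4;\mathbf{e}_\Vert)-s_{20}I_3(\mathbf{a}_3,\mathbf{a}_4,\mathbf{a}_1;\mathbf{e}_\Vert)\\&+(1+s_{10}+s_{20})I_3(\mathbf{a}_3,\mathbf{a}_4,\mathbf{a}_2-\mathbf{a}_1;\mathbf{e}_\Vert+\mathbf{a}_1)-s_{10}I_3(\mathbf{a}_3,\mathbf{a}_4,\mathbf{a}_2;\mathbf{e}_\Vert),\\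 I_3(\mathbf{a}_1,\mathbf{a}_2,\mathbf{a}_3;\mathbf{e})=&(1+s_{10}+s_{20})Q(\mathbf{a}_1-\mathbf{a}_2,\mathbf{a}_3;\mathbf{e}_\Vert+\mathbf{a}_2)-s_{10}Q(\mathbf{a}_2,\mathbf{a}_3;\mathbf{e}_\Vert)-s_{20}Q(\mathbf{a}_1,\mathbf{a}_3;\mathbf{e}_\Vert)\\&+(1+s_{30})T(\mathbf{a}_1,\mathbf{a}_2;\mathbf{e}_\Vert+\mathbf{a}_3)-s_{30}T(\mathbf{a}_1,\mathbf{a}_2;\mathbf{e}_\Vert),\\ Q(\mathbf{a}_1,\mathbf{a}_2;\mathbf{e})=&(1+s_{10})I_1(\mathbf{a}_2;\mathbf{e}_\Vert+\mathbf{a}_1)-s_{10}I_1(\mathbf{a}_2;\mathbf{e}_\Vert)+(1+s_{20})I_1(\mathbf{a}_1;\mathbf{e}_\Vert+\mathbf{a}_2)-s_{20}I_1(\mathbf{a}_1;\mathbf{e}_\Vert),\\ T(\mathbf{a}_1,\mathbf{a}_2;\mathbf{e})=&-s_{10}I_1(\mathbf{a}_2;\mathbf{e}_\Vert)-s_{20}I_1(\mathbf{a}_1;\mathbf{e}_\Vert)+(1+s_{10}+s_{20})I_1(\mathbf{a}_1-\mathbf{a}_2;\mathbf{e}_\Vert+\mathbf{a}_2),\\ I_1(\mathbf{a}_1;\mathbf{e})=&(1+s_{10})\mathcal F(|1+s_{10}||\mathbf{a}_1|)-s_{10}\mathcal F(|s_{10}||\mathbf{a}_1|). \end{aligned}$$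 Terminal functions. In the present situation $h_4=|\delta|\ne0$ and $h_3=0$, and along every chain of nonzero coefficients exactly one of $h_1,h_2$ is nonzero. For $P_1>0$ put $h^2=h_1^2+h_2^2+h_4^2$, $R_4=\sqrt{P_1^2+h^2}$, $R_1=\sqrt{P_1^2+h_1^2}$, $R_2=\sqrt{P_1^2+h_2^2}$, $$\Phi_1=\frac1{P_1}\ln\frac{P_1+R_4}{h},\quad \Phi_2(\eta)=\frac1{P_1}\arctan\frac{\eta P_1}{h^2+R_4\sqrt{h^2-\eta^2}},\quad \Phi_3=\frac1{R_1}\ln\frac{R_1+R_4}{h_4},$$ $$\Phi_4=\frac{h_4^2}{P_1^2h_2}\Big(\frac{R_2}{h_2}\ln\frac{R_2+R_4}{h_4}-\ln\frac{h_2+h}{h_4}\Big).$$ If $h_1\neq0$, $h_2=0$: $$F_1'=\frac1{h_1^2}\Big[\Phi_1+\frac{h_1^2-h_4^2}{2h_1h_4}\Phi_2(h_1)-\Phi_3+\frac1{2(R_4+h_4)}\Big],\quad \widetilde F_1=\frac12\Big[\Big(1-\frac{h_4^2}{h_1^2}\Big)\Phi_1-\frac{2h_4}{h_1}\Phi_2(h_1)+\frac{h_4^2}{h_1^2}\Phi_3\Big].$$ If $h_2\ne0$, $h_1=0$: $$F_1'=-\frac1{h_2^2}\Big[\Phi_1-\frac{h_4}{h_2}\Phi_2(h_2)-\frac{h_2^2}{h_4^2}\Phi_4+\frac1{P_1^2}\Big(\frac{R_2^2}{R_4+h_4}-\frac{h_2^2}{h+h_4}\Big)\Big],\quad \widetilde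 F_1=\frac12\Big[\frac{h^2}{h_2^2}\Phi_1-\frac1{R_4+h}-\Phi_4\Big].$$ *)

theory Defs
  imports "HOL-Analysis.Analysis"
begin

section \<open>Surface integrals over flat pieces of surface\<close>

text \<open>
  For a set \<open>S\<close> contained in a plane, the surface measure \<open>dS\<close> is Lebesgue measure of the
  Euclidean plane, transported by an isometric parametrization of a plane containing \<open>S\<close>.
  Surface integrals over \<open>S\<close> are the usual set integrals \<open>LINT x:S|surface_measure S. f x\<close>.
\<close>

definition planar_chart :: "(real^2 \<Rightarrow> real^3) \<Rightarrow> (real^3) set \<Rightarrow> bool" where
  "planar_chart \<phi> S \<longleftrightarrow>
     (\<exists>q L. linear L \<and> (\<forall>p. norm (L p) = norm p) \<and> \<phi> = (\<lambda>p. q + L p)) \<and> S \<subseteq> range \<phi>"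

definition surface_measure :: "(real^3) set \<Rightarrow> (real^3) measure" where
  "surface_measure S = distr lborel borel (SOME \<phi>. planar_chart \<phi> S)"

definition surface_area :: "(real^3) set \<Rightarrow> real" where
  "surface_area S = measure (surface_measure S) S"

lemma planar_chart_triangle:
  assumes "\<not> collinear {a, b, c :: real^3}"
  shows "\<exists>\<phi>. planar_chart \<phi> (convex hull {a, b, c})"
proof -
  let ?T = "span {b - a, c - a}"
  have "\<not> affine_dependent {a, b, c}" and card3: "card {a, b, c} = 3"
    using assms collinear_3_eq_affine_dependent[of a b c]
    by (auto simp: insert_commute)
  then have ad: "aff_dim (affine hull {a, b, c}) = 2"
    using aff_dim_unique[of "{a,b,c}" "{a,b,c}"] by (simp add: aff_dim_affine_independent)
  have hull: "affine hull {a, b, c} = (+) a ` ?T"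
    using affine_hull_insert_span_gen[of a "{b, c}"] by (simp add: image_image)
  then have "dim ?T = 2"
    using ad by (simp add: aff_dim_translation_eq aff_dim_subspace)
  then have "dim (UNIV :: (real^2) set) = dim ?T" by simp
  then obtain L :: "real^2 \<Rightarrow> real^3"
    where L: "linear L" "L ` UNIV = ?T" "\<And>p. norm (L p) = norm p"
    using isometries_subspaces[of "UNIV :: (real^2) set" ?T] by (metis UNIV_I subspace_UNIV subspace_span)
  have "convex hull {a, b, c} \<subseteq> range (\<lambda>p. a + L p)"
    using convex_hull_subset_affine_hull[of "{a, b, c}"]
    unfolding hull L(2)[symmetric] image_image .
  with L show ?thesis
    unfolding planar_chart_def by blast
qed

definition gradient :: "('a::euclidean_space \<Rightarrow> real) \<Rightarrow> 'a \<Rightarrow> 'a" where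
  "gradient f x = (THE D. GDERIV f x :> D)"


section \<open>Orthogonal projections and coefficients\<close>

definition e_par :: "(real^3) list \<Rightarrow> real^3 \<Rightarrow> real^3" where
  "e_par as e = (THE p. p \<in> span (set as) \<and> (\<forall>w \<in> span (set as). orthogonal (e - p) w))"

definition h_perp :: "(real^3) list \<Rightarrow> real^3 \<Rightarrow> real" where
  "h_perp as e = norm (e - e_par as e)"

lemma e_par_unique:
  assumes "p \<in> span (set as)" "\<forall>w \<in> span (set as). orthogonal (e - p) w"
  shows "e_par as e = p"
  unfolding e_par_def
proof (rule the_equality)
  fix q assume q: "q \<in> span (set as) \<and> (\<forall>w \<in> span (set as). orthogonal (e - q) w)"
  have "p - q \<in> span (set as)" using assms(1) q by (simp add: span_diff)
  then have "(e - q) \<bullet> (p - q) = 0" "(e - p) \<bullet> (p - q) = 0"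
    using q assms(2) by (auto simp: orthogonal_def)
  then have "(p - q) \<bullet> (p - q) = 0" by (simp add: inner_diff_left)
  then show "q = p" by simp
qed (use assms in blast)

lemma e_par:
  shows "e_par as e \<in> span (set as)" "\<forall>w \<in> span (set as). orthogonal (e - e_par as e) w"
proof -
  obtain p z where "p \<in> span (set as)" "\<And>w. w \<in> span (set as) \<Longrightarrow> orthogonal z w" "e = p + z"
    using orthogonal_subspace_decomp_exists[of "set as" e] by metis
  then have *: "p \<in> span (set as)" "\<forall>w \<in> span (set as). orthogonal (e - p) w" by auto
  show "e_par as e \<in> span (set as)" "\<forall>w \<in> span (set as). orthogonal (e - e_par as e) w"
    using * e_par_unique[OF *] by auto
qed

text \<open>
  The number \<open>s as e i\<close> is the coefficient \<open>s\<^bsub>i0\<^esub>\<close> (with \<open>1 \<le> i \<le> d\<close>) for the vectors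
  \<open>as = [a\<^sub>1, \<dots>, a\<^sub>d]\<close> and \<open>e\<close>.  It is unique only for linearly independent \<open>as\<close>;
  the main theorem is stated for an arbitrary choice function.
\<close>

definition coefficient_choice :: "((real^3) list \<Rightarrow> real^3 \<Rightarrow> nat \<Rightarrow> real) \<Rightarrow> bool" where
  "coefficient_choice s \<longleftrightarrow>
     (\<forall>as e. e_par as e = (\<Sum>i = 1..length as. s as e i *\<^sub>R (as ! (i - 1))))"

lemma coefficient_choice_exists: "\<exists>s. coefficient_choice s"
proof -
  have *: "\<exists>t. p = (\<Sum>i = 1..length as. t i *\<^sub>R (as ! (i - 1)))"
    if "p \<in> span (set as)" for as :: "(real^3) list" and p
    using that
  proof (induction as arbitrary: p rule: rev_induct)
    case (snoc a as)
    then obtain k where "p - k *\<^sub>R a \<in> span (set as)"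
      by (auto simp: span_breakdown_eq)
    then obtain t where t: "p - k *\<^sub>R a = (\<Sum>i = 1..length as. t i *\<^sub>R (as ! (i - 1)))"
      using snoc.IH by blast
    have "(\<Sum>i = 1..length as. (t(Suc (length as) := k)) i *\<^sub>R ((as @ [a]) ! (i - 1)))
        = (\<Sum>i = 1..length as. t i *\<^sub>R (as ! (i - 1)))"
      by (rule sum.cong) (auto simp: nth_append)
    then have "p = (\<Sum>i = 1..length (as @ [a]). (t(Suc (length as) := k)) i *\<^sub>R ((as @ [a]) ! (i - 1)))"
      using t by (simp add: algebra_simps)
    then show ?case by blast
  qed simp
  have "\<forall>as e. \<exists>t. e_par as e = (\<Sum>i = 1..length as. t i *\<^sub>R (as ! (i - 1)))"
    using * e_par(1) by blast
  then have "\<exists>s. \<forall>as e. e_par as e = (\<Sum>i = 1..length as. s as e i *\<^sub>R (as ! (i - 1)))"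
    by metis
  then show ?thesis unfolding coefficient_choice_def .
qed


section \<open>The recursion\<close>

text \<open>
  A terminal function is applied as \<open>F h\<^sub>1 h\<^sub>2 h\<^sub>3 h\<^sub>4 P\<^sub>1\<close>.  Omission of terms with vanishing
  coefficient needs no case distinction, since \<open>0 * x = 0\<close> for every real \<open>x\<close>.
\<close>

type_synonym terminal = "real \<Rightarrow> real \<Rightarrow> real \<Rightarrow> real \<Rightarrow> real \<Rightarrow> real"
type_synonym choice = "(real^3) list \<Rightarrow> real^3 \<Rightarrow> nat \<Rightarrow> real"

definition rec_I1 :: "terminal \<Rightarrow> choice \<Rightarrow> real \<Rightarrow> real \<Rightarrow> real \<Rightarrow> real^3 \<Rightarrow> real^3 \<Rightarrow> real" where
  "rec_I1 F s h2 h3 h4 a1 e =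
    (let s1 = s [a1] e 1; h1 = h_perp [a1] e
     in (1 + s1) * F h1 h2 h3 h4 (\<bar>1 + s1\<bar> * norm a1)
        - s1 * F h1 h2 h3 h4 (\<bar>s1\<bar> * norm a1))"

definition rec_Q :: "terminal \<Rightarrow> choice \<Rightarrow> real \<Rightarrow> real \<Rightarrow> real^3 \<Rightarrow> real^3 \<Rightarrow> real^3 \<Rightarrow> real" where
  "rec_Q F s h3 h4 a1 a2 e =
    (let s1 = s [a1, a2] e 1; s2 = s [a1, a2] e 2;
         p = e_par [a1, a2] e; h2 = h_perp [a1, a2] e
     in (1 + s1) * rec_I1 F s h2 h3 h4 a2 (p + a1)
        - s1 * rec_I1 F s h2 h3 h4 a2 p
        + (1 + s2) * rec_I1 F s h2 h3 h4 a1 (p + a2)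
        - s2 * rec_I1 F s h2 h3 h4 a1 p)"

definition rec_T :: "terminal \<Rightarrow> choice \<Rightarrow> real \<Rightarrow> real \<Rightarrow> real^3 \<Rightarrow> real^3 \<Rightarrow> real^3 \<Rightarrow> real" where
  "rec_T F s h3 h4 a1 a2 e =
    (let s1 = s [a1, a2] e 1; s2 = s [a1, a2] e 2;
         p = e_par [a1, a2] e; h2 = h_perp [a1, a2] e
     in - s1 * rec_I1 F s h2 h3 h4 a2 p
        - s2 * rec_I1 F s h2 h3 h4 a1 p
        + (1 + s1 + s2) * rec_I1 F s h2 h3 h4 (a1 - a2) (p + a2))"

definition rec_I3 ::
  "terminal \<Rightarrow> choice \<Rightarrow> real \<Rightarrow> real^3 \<Rightarrow> real^3 \<Rightarrow> real^3 \<Rightarrow> real^3 \<Rightarrow> real" where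
  "rec_I3 F s h4 a1 a2 a3 e =
    (let s1 = s [a1, a2, a3] e 1; s2 = s [a1, a2, a3] e 2; s3 = s [a1, a2, a3] e 3;
         p = e_par [a1, a2, a3] e; h3 = h_perp [a1, a2, a3] e
     in (1 + s1 + s2) * rec_Q F s h3 h4 (a1 - a2) a3 (p + a2)
        - s1 * rec_Q F s h3 h4 a2 a3 p
        - s2 * rec_Q F s h3 h4 a1 a3 p
        + (1 + s3) * rec_T F s h3 h4 a1 a2 (p + a3)
        - s3 * rec_T F s h3 h4 a1 a2 p)"

definition rec_I4 ::
  "terminal \<Rightarrow> choice \<Rightarrow> real^3 \<Rightarrow> real^3 \<Rightarrow> real^3 \<Rightarrow> real^3 \<Rightarrow> real^3 \<Rightarrow> real" where
  "rec_I4 F s a1 a2 a3 a4 e =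
    (let s1 = s [a1, a2, a3, a4] e 1; s2 = s [a1, a2, a3, a4] e 2;
         s3 = s [a1, a2, a3, a4] e 3; s4 = s [a1, a2, a3, a4] e 4;
         p = e_par [a1, a2, a3, a4] e; h4 = h_perp [a1, a2, a3, a4] e
     in - s4 * rec_I3 F s h4 a1 a2 a3 p
        + (1 + s3 + s4) * rec_I3 F s h4 a1 a2 (a4 - a3) (p + a3)
        - s3 * rec_I3 F s h4 a1 a2 a4 p
        - s2 * rec_I3 F s h4 a3 a4 a1 p
        + (1 + s1 + s2) * rec_I3 F s h4 a3 a4 (a2 - a1) (p + a1)
        - s1 * rec_I3 F s h4 a3 a4 a2 p)"


section \<open>Terminal functions\<close>

definition hh :: "real \<Rightarrow> real \<Rightarrow> real \<Rightarrow> real" where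
  "hh h1 h2 h4 = sqrt (h1^2 + h2^2 + h4^2)"

definition R4 :: "real \<Rightarrow> real \<Rightarrow> real \<Rightarrow> real \<Rightarrow> real" where
  "R4 h1 h2 h4 P = sqrt (P^2 + (hh h1 h2 h4)^2)"

definition \<Phi>1 :: "real \<Rightarrow> real \<Rightarrow> real \<Rightarrow> real \<Rightarrow> real" where
  "\<Phi>1 h1 h2 h4 P = 1 / P * ln ((P + R4 h1 h2 h4 P) / hh h1 h2 h4)"

definition \<Phi>2 :: "real \<Rightarrow> real \<Rightarrow> real \<Rightarrow> real \<Rightarrow> real \<Rightarrow> real" where
  "\<Phi>2 h1 h2 h4 P \<eta> =
    1 / P * arctan (\<eta> * P /
      ((hh h1 h2 h4)^2 + R4 h1 h2 h4 P * sqrt ((hh h1 h2 h4)^2 - \<eta>^2)))"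

definition \<Phi>3 :: "real \<Rightarrow> real \<Rightarrow> real \<Rightarrow> real \<Rightarrow> real" where
  "\<Phi>3 h1 h2 h4 P =
    (let R1 = sqrt (P^2 + h1^2) in 1 / R1 * ln ((R1 + R4 h1 h2 h4 P) / h4))"

definition \<Phi>4 :: "real \<Rightarrow> real \<Rightarrow> real \<Rightarrow> real \<Rightarrow> real" where
  "\<Phi>4 h1 h2 h4 P =
    (let R2 = sqrt (P^2 + h2^2)
     in h4^2 / (P^2 * h2) *
        (R2 / h2 * ln ((R2 + R4 h1 h2 h4 P) / h4) - ln ((h2 + hh h1 h2 h4) / h4)))"

text \<open>
  The terminal functions are specified only if exactly one of \<open>h\<^sub>1, h\<^sub>2\<close> is nonzero (and \<open>h\<^sub>3 = 0\<close>).
\<close>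

definition F1' :: terminal where
  "F1' h1 h2 h3 h4 P =
    (let h = hh h1 h2 h4; R4 = R4 h1 h2 h4 P; R2 = sqrt (P^2 + h2^2);
         \<Phi>1 = \<Phi>1 h1 h2 h4 P; \<Phi>2 = \<Phi>2 h1 h2 h4 P; \<Phi>3 = \<Phi>3 h1 h2 h4 P; \<Phi>4 = \<Phi>4 h1 h2 h4 P
     in if h1 \<noteq> 0 \<and> h2 = 0 then
          1 / h1^2 * (\<Phi>1 + (h1^2 - h4^2) / (2 * h1 * h4) * \<Phi>2 h1 - \<Phi>3 + 1 / (2 * (R4 + h4)))
        else if h2 \<noteq> 0 \<and> h1 = 0 then
          - (1 / h2^2) * (\<Phi>1 - h4 / h2 * \<Phi>2 h2 - h2^2 / h4^2 * \<Phi>4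
                          + 1 / P^2 * (R2^2 / (R4 + h4) - h2^2 / (h + h4)))
        else undefined)"

definition F1_tilde :: terminal where
  "F1_tilde h1 h2 h3 h4 P =
    (let h = hh h1 h2 h4; R4 = R4 h1 h2 h4 P;
         \<Phi>1 = \<Phi>1 h1 h2 h4 P; \<Phi>2 = \<Phi>2 h1 h2 h4 P; \<Phi>3 = \<Phi>3 h1 h2 h4 P; \<Phi>4 = \<Phi>4 h1 h2 h4 P
     in if h1 \<noteq> 0 \<and> h2 = 0 then
          1 / 2 * ((1 - h4^2 / h1^2) * \<Phi>1 - 2 * h4 / h1 * \<Phi>2 h1 + h4^2 / h1^2 * \<Phi>3)
        else if h2 \<noteq> 0 \<and> h1 = 0 then
          1 / 2 * (h^2 / h2^2 * \<Phi>1 - 1 / (R4 + h) - \<Phi>4)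
        else undefined)"


section \<open>Geometry of a triangle\<close>

definition unit_normal :: "real^3 \<Rightarrow> real^3 \<Rightarrow> real^3 \<Rightarrow> real^3" where
  "unit_normal x1 x2 x3 =
     - (cross3 (x2 - x1) (x1 - x3) /\<^sub>R (2 * surface_area (convex hull {x1, x2, x3})))"

definition conormal :: "real^3 \<Rightarrow> real^3 \<Rightarrow> real^3" where
  "conormal l n = cross3 l n /\<^sub>R norm l"

definition G :: "real^3 \<Rightarrow> real^3 \<Rightarrow> real" where
  "G x y = 1 / norm (x - y)"

end

theory Submission
  imports Defs
begin

text \<open>
  Let \<open>X\<close> be affine in \<open>d\<close> parameters, \<open>X = \<Sum>i. (u\<^sub>i + s\<^sub>i) a\<^sub>i\<close>, and \<open>\<Psi> x = \<integral>\<^sub>0\<^sup>1 t\<^sup>d\<^sup>-\<^sup>1 \<psi> (t\<^sup>2 x) dt\<close>.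
  Then \<open>d \<Psi> + 2 x \<Psi>' = \<psi>\<close>, which says that \<open>\<psi> (\<bar>X\<bar>\<^sup>2)\<close> is the divergence of the field with components
  \<open>(u\<^sub>i + s\<^sub>i) \<Psi> (\<bar>X\<bar>\<^sup>2)\<close>, for whatever choice of the coefficients \<open>s\<^sub>i\<close>.  Its flux through a face of a product
  of simplices is a constant multiple of the integral of \<open>\<Psi> (\<bar>X\<bar>\<^sup>2)\<close> over that face, and Pythagoras replaces
  \<open>\<Psi>\<close> by \<open>x \<mapsto> \<Psi> (x + h\<^sup>2)\<close> there.  Descending from \<open>d = 4\<close> to \<open>d = 1\<close> this is the recursion, with an
  iterated radial mean as terminal value, which explicit primitives evaluate in closed form.

  The kernel of \<open>M\<close> is \<open>\<delta> / \<bar>x - y\<bar>\<^sup>3\<close>.  The vector \<open>L'\<close> is determined by its inner products with \<open>a\<^sub>1\<close>, \<open>a\<^sub>2\<close>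
  and \<open>n\<close>: the normal one is \<open>- M\<close>, and by the fundamental theorem of calculus the tangential ones are
  integrals of \<open>1 / \<bar>x - y\<bar>\<close> over an edge of \<open>S\<^sub>x\<close> times \<open>S\<^sub>y\<close>.
\<close>

section \<open>Integration over triangles\<close>

text \<open>The four direction vectors lie in a plane, so the divergence is taken in parameter
  space, where linear dependence does no harm. The delicate point is that the terminal functions
  have a meaning only if exactly one of \<open>h1\<close>, \<open>h2\<close> is nonzero. All vectors
  from \<open>I3\<close> downwards lie in the common plane, hence \<open>h3 = 0\<close>. A triangle
  \<open>T\<close> has independent sides, hence \<open>h2 = 0\<close>, and a nonzero coefficient of
  an edge keeps the point off the line of that edge, hence \<open>h1 \<noteq> 0\<close>. A
  parallelogram \<open>Q\<close> either spans the plane, with the same conclusion, or has parallel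
  sides; in that case the nonzero coefficient of \<open>Q\<close> keeps the point off their line
  through 0, so \<open>h2 \<noteq> 0\<close>, and projecting onto this line makes
  \<open>h1 = 0\<close>. Radial functions are written in the squared length and considered also
  slightly below 0: after the shift by the square of \<open>\<delta>\<close> both kernels are smooth
  there, so a point \<open>X = 0\<close> is not exceptional.\<close>

text \<open>Integration over the triangle \<open>0 \<le> u, 0 \<le> v, u + v \<le> 1\<close>, pulled back to the unit square by
  \<open>(u, v) \<mapsto> (u (1 - v), v)\<close>, so that continuity, Fubini and the Leibniz rule for boxes apply.\<close>

definition tri_int :: "(real \<Rightarrow> real \<Rightarrow> 'b::euclidean_space) \<Rightarrow> 'b" where
  "tri_int f = integral {0..1} (\<lambda>v. integral {0..1} (\<lambda>u. (1 - v) *\<^sub>R f (u * (1 - v)) v))"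

section \<open>Lebesgue measure in the plane and surface integrals over triangles\<close>

lemma lborel_real2_eq_distr:
  "distr lborel borel (\<lambda>p::real \<times> real. vector [snd p, fst p] :: real^2) = lborel" (is "distr _ _ ?g = _")
proof (rule lborel_eqI[symmetric])
  have cont: "continuous_on UNIV ?g"
    by (subst continuous_on_componentwise)
       (auto simp: Basis_vec_def inner_axis forall_2 vector_2 intro!: continuous_intros)
  then have m: "?g \<in> lborel \<rightarrow>\<^sub>M borel" by (simp add: borel_measurable_continuous_onI)
  fix l u :: "real^2" assume lu: "\<And>b. b \<in> Basis \<Longrightarrow> l \<bullet> b \<le> u \<bullet> b"
  have b2: "(Basis :: (real^2) set) = {axis 1 1, axis 2 1}"
    by (auto simp: Basis_vec_def UNIV_2)
  have le: "l$1 \<le> u$1" "l$2 \<le> u$2" using lu[of "axis 1 1"] lu[of "axis 2 1"] b2 by (auto simp: inner_axis)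
  have "?g -` box l u = box (l$2, l$1) (u$2, u$1)"
    by (auto simp: mem_box_cart forall_2 vector_2 mem_box Basis_prod_def)
  then have "emeasure (distr lborel borel ?g) (box l u) = emeasure lborel (box (l$2, l$1) (u$2, u$1))"
    using m by (simp add: emeasure_distr)
  also have "\<dots> = (\<Prod>b\<in>Basis. ((u$2, u$1) - (l$2, l$1)) \<bullet> b)"
    using le by (intro emeasure_lborel_box) (auto simp: Basis_prod_def)
  also have "(\<Prod>b\<in>Basis. ((u$2, u$1) - (l$2, l$1)) \<bullet> b) = (\<Prod>b\<in>Basis. (u - l) \<bullet> b)"
    unfolding b2 Basis_prod_def by (auto simp: prod.union_disjoint inner_axis axis_eq_axis)
  finally show "emeasure (distr lborel borel ?g) (box l u) = ennreal (\<Prod>b\<in>Basis. (u - l) \<bullet> b)" by simp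
qed simp

text \<open>The identification with pairs swaps the coordinates because Fubini makes the first entry
  of a pair the outer variable, while \<open>tri_int\<close> has \<open>v\<close> outside.\<close>

lemma integral_unit_square_vec:
  fixes g :: "real^2 \<Rightarrow> 'b::euclidean_space"
  assumes c: "continuous_on (cbox 0 1) g"
  shows "integral (cbox 0 1) g = integral {0..1} (\<lambda>t. integral {0..1} (\<lambda>s. g (vector [s, t])))"
proof -
  let ?g = "\<lambda>p::real \<times> real. vector [snd p, fst p] :: real^2"
  have cont: "continuous_on S ?g" for S
    by (subst continuous_on_componentwise)
       (auto simp: Basis_vec_def inner_axis forall_2 vector_2 intro!: continuous_intros)
  then have m: "?g \<in> lborel \<rightarrow>\<^sub>M borel" by (simp add: borel_measurable_continuous_onI)
  have ind: "indicator (cbox 0 1) (?g p) = (indicator (cbox (0,0) (1,1)) p :: real)" for p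
    by (cases p) (auto simp: mem_box_cart forall_2 vector_2 mem_box Basis_prod_def indicator_def)
  have c2: "continuous_on (cbox (0,0) (1,1)) (\<lambda>p. g (?g p))"
    by (rule continuous_on_compose2[OF c cont])
      (auto simp: mem_box_cart forall_2 vector_2)
  have "integral (cbox 0 1) g = (LINT w:cbox 0 1|lborel. g w)"
    by (rule set_borel_integral_eq_integral(2)[symmetric])
      (simp add: borel_integrable_compact c set_integrable_def)
  also have "\<dots> = (LINT w|distr lborel borel ?g. indicator (cbox 0 1) w *\<^sub>R g w)"
    unfolding lborel_real2_eq_distr set_lebesgue_integral_def ..
  also have "\<dots> = (LINT p|lborel. indicator (cbox 0 1) (?g p) *\<^sub>R g (?g p))"
    by (rule integral_distr[OF m]) (use c in \<open>simp add: borel_measurable_continuous_on_indicator\<close>)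
  also have "\<dots> = (LINT p:cbox (0,0) (1,1)|lborel. g (?g p))"
    unfolding ind set_lebesgue_integral_def ..
  also have "\<dots> = integral (cbox (0,0) (1,1)) (\<lambda>p. g (?g p))"
    by (rule set_borel_integral_eq_integral(2))
      (use c2 in \<open>simp add: borel_integrable_compact set_integrable_def\<close>)
  also have "\<dots> = integral (cbox 0 1) (\<lambda>t. integral (cbox 0 1) (\<lambda>s. g (?g (t, s))))"
    using c2 by (rule integral_prod_continuous)
  finally show ?thesis by (simp add: cbox_interval)
qed

text \<open>Lagrange's identity in the plane. The right-hand side is invariant under isometries,
  which is how the Jacobian in a chart is recognised as the norm of a cross product in
  space.\<close>

lemma gram_vec2:
  fixes b c :: "real^2"
  shows "(det (vector [b, c] :: real^2^2))^2 = (b \<bullet> b) * (c \<bullet> c) - (b \<bullet> c)^2"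
  by (simp add: det_2 vector_2 inner_vec_def sum_2 power2_eq_square algebra_simps)

lemma tri_int_cong:
  assumes "\<And>u v. 0 \<le> u \<Longrightarrow> 0 \<le> v \<Longrightarrow> u + v \<le> 1 \<Longrightarrow> f u v = g u v"
  shows "tri_int f = tri_int g"
  unfolding tri_int_def
proof (intro integral_cong)
  fix v u :: real assume "v \<in> {0..1}" "u \<in> {0..1}"
  then show "(1 - v) *\<^sub>R f (u * (1 - v)) v = (1 - v) *\<^sub>R g (u * (1 - v)) v"
    using mult_right_mono[of u 1 "1 - v"] by (subst assms) auto
qed

text \<open>The change of variables collapses the square onto the triangle with Jacobian
  \<open>(1 - w$2) * d\<close>; its first factor is the weight in \<open>tri_int\<close>. The edge
  \<open>w$2 = 1\<close> is sent to the single vertex \<open>p + c\<close>, so both are removed to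
  obtain injectivity; they are null sets.\<close>

lemma integral_triangle_vec2:
  fixes f :: "real^2 \<Rightarrow> real^'n" and p b c :: "real^2"
  defines "T \<equiv> convex hull {p, p + b, p + c}" and "d \<equiv> det (vector [b, c] :: real^2^2)"
  assumes cont: "continuous_on T f" and d: "d \<noteq> 0"
  shows "integral T f = \<bar>d\<bar> *\<^sub>R tri_int (\<lambda>u v. f (p + u *\<^sub>R b + v *\<^sub>R c))"
proof -
  define g where "g w = p + (w$1 * (1 - w$2)) *\<^sub>R b + (w$2) *\<^sub>R c" for w :: "real^2"
  define g' where "g' w h = (h$1 * (1 - w$2) - w$1 * h$2) *\<^sub>R b + (h$2) *\<^sub>R c" for w h :: "real^2"
  define S where "S = (cbox 0 1 :: (real^2) set) - {w. w$2 = 1}"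
  define Fn where "Fn = (\<lambda>w. \<bar>1 - w$2\<bar> *\<^sub>R f (g w))"
  have der: "(g has_derivative g' w) (at w within S)" for w
    unfolding g_def g'_def
    by (auto intro!: derivative_eq_intros bounded_linear_imp_has_derivative
          bounded_linear_vec_nth simp: algebra_simps)
  have detg: "det (matrix (g' w)) = (1 - w$2) * d" for w
    by (simp add: det_2 matrix_def g'_def d_def axis_def vector_2 algebra_simps)
  have T_eq: "T = {p + u *\<^sub>R b + v *\<^sub>R c | u v. 0 \<le> u \<and> 0 \<le> v \<and> u + v \<le> 1}"
    unfolding T_def convex_hull_3_alt by simp
  have ker: "u = 0 \<and> v = 0" if "u *\<^sub>R b + v *\<^sub>R c = 0" for u v
  proof -
    have e1: "u * b$1 + v * c$1 = 0" "u * b$2 + v * c$2 = 0"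
      using that by (auto simp: vec_eq_iff forall_2)
    \<comment> \<open>Cramer's rule: each combination eliminates one of the two unknowns.\<close>
    have "u * d = (u * b$1 + v * c$1) * c$2 - (u * b$2 + v * c$2) * c$1" "v * d = (u * b$2 + v * c$2) * b$1 - (u * b$1 + v * c$1) * b$2"
      by (auto simp: d_def det_2 vector_2 algebra_simps)
    then have "u * d = 0" "v * d = 0" unfolding e1 by simp_all
    then show ?thesis using d by simp
  qed
  have uniq: "u = u' \<and> v = v'" if "p + u *\<^sub>R b + v *\<^sub>R c = p + u' *\<^sub>R b + v' *\<^sub>R c" for u v u' v'
    using ker[of "u - u'" "v - v'"] that by (simp add: algebra_simps)
  have gT: "g w \<in> T" if "w \<in> cbox 0 1" for w
    using that mult_right_mono[of "w$1" 1 "1 - w$2"] unfolding T_eq g_def mem_Collect_eq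
    by (intro exI[of _ "w$1 * (1 - w$2)"] exI[of _ "w$2"]) (auto simp: mem_box_cart forall_2)
  have inj: "inj_on g S"
  proof (rule inj_onI)
    fix w z assume "w \<in> S" "z \<in> S" "g w = g z"
    then have "w$1 * (1 - w$2) = z$1 * (1 - z$2) \<and> w$2 = z$2" "w$2 \<noteq> 1" "z$2 \<noteq> 1"
      using uniq unfolding g_def S_def by blast+
    then show "w = z" by (auto simp: vec_eq_iff forall_2)
  qed
  have img: "g ` S = T - {p + c}"
  proof (intro equalityI subsetI)
    fix x assume "x \<in> g ` S"
    then obtain w where w: "w \<in> S" "x = g w" by blast
    have "g w \<noteq> p + c"
      using w uniq[where u = "w$1 * (1 - w$2)" and v = "w$2" and u' = 0 and v' = 1] by (auto simp: g_def S_def)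
    then show "x \<in> T - {p + c}" using w gT by (auto simp: S_def)
  next
    fix x assume "x \<in> T - {p + c}"
    then have "x \<in> T" "x \<noteq> p + c" by auto
    then obtain u v where x: "x = p + u *\<^sub>R b + v *\<^sub>R c" and uv: "0 \<le> u" "0 \<le> v" "u + v \<le> 1"
      unfolding T_eq by auto
    have "v \<noteq> 1" using \<open>x \<noteq> p + c\<close> x uv by auto
    then have v: "v < 1" using uv by simp
    let ?w = "vector [u / (1 - v), v] :: real^2"
    have "g ?w = x" using v by (simp add: g_def x vector_2)
    moreover have "?w \<in> S" using uv v by (auto simp: S_def mem_box_cart forall_2 vector_2)
    ultimately show "x \<in> g ` S" by blast
  qed
  have neg1: "negligible {w::real^2. w$2 = 1}"
    using negligible_standard_hyperplane[of "axis 2 1 :: real^2" 1] by (simp add: inner_axis axis_in_Basis_iff)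
  have Sl: "S \<in> sets lebesgue"
    unfolding S_def using neg1 by (auto intro!: sets.Diff negligible_imp_sets)
  have contg: "continuous_on (cbox 0 1) (\<lambda>w. f (g w))"
    by (rule continuous_on_compose2[OF cont])
      (use gT in \<open>auto simp: g_def intro!: continuous_intros\<close>)
  have contFn: "continuous_on (cbox 0 1) Fn"
    unfolding Fn_def by (intro continuous_intros contg)
  then have ai: "Fn absolutely_integrable_on cbox 0 1"
    by (intro absolutely_integrable_continuous)
  have sp: "Fn absolutely_integrable_on S"
    by (rule set_integrable_subset[OF ai Sl]) (auto simp: S_def)
  then have ai2: "(\<lambda>w. \<bar>det (matrix (g' w))\<bar> *\<^sub>R f (g w)) absolutely_integrable_on S"
    using absolutely_integrable_on_scaleR_iff[where c = "\<bar>d\<bar>" and f = Fn and S = S] sp unfolding detg Fn_def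
    by (simp add: abs_mult mult.commute)
  have "integral T f = integral (g ` S) f"
    unfolding img by (rule integral_spike_set) (auto intro: negligible_subset[of "{p + c}"])
  also have "\<dots> = integral S (\<lambda>w. \<bar>det (matrix (g' w))\<bar> *\<^sub>R f (g w))"
    using has_absolute_integral_change_of_variables[OF Sl der inj] ai2 by blast
  also have "\<dots> = \<bar>d\<bar> *\<^sub>R integral S Fn"
    unfolding detg Fn_def by (simp add: abs_mult mult.commute flip: integral_cmul)
  also have "integral S Fn = integral (cbox 0 1) Fn"
    unfolding S_def by (rule integral_spike_set) (auto intro: negligible_subset[OF neg1])
  also have "\<dots> = tri_int (\<lambda>u v. f (p + u *\<^sub>R b + v *\<^sub>R c))"
    unfolding integral_unit_square_vec[OF contFn] unfolding tri_int_def Fn_def g_def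
    by (intro integral_cong) (auto simp: vector_2)
  finally show ?thesis .
qed

text \<open>Whatever isometric chart is selected, it preserves inner products, so the Jacobian is
  determined by the Gram matrix of the two sides and equals the norm of their cross product.\<close>

lemma surface_integral_triangle_vec:
  fixes f :: "real^3 \<Rightarrow> real^'n" and x1 x2 x3 :: "real^3"
  defines "S \<equiv> convex hull {x1, x2, x3}"
  assumes nc: "\<not> collinear {x1, x2, x3}" and cont: "continuous_on S f"
  shows "(LINT x:S|surface_measure S. f x)
    = norm (cross3 (x2 - x1) (x3 - x1)) *\<^sub>R tri_int (\<lambda>u v. f (x1 + u *\<^sub>R (x2 - x1) + v *\<^sub>R (x3 - x1)))"
    and "set_integrable (surface_measure S) S f"
proof -
  define \<phi> where "\<phi> = (SOME \<phi>. planar_chart \<phi> S)"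
  have pc: "planar_chart \<phi> S"
    unfolding \<phi>_def S_def using planar_chart_triangle[OF nc] by (rule someI_ex)
  then obtain q L where L: "linear L" "\<And>p. norm (L p) = norm p" and \<phi>: "\<phi> = (\<lambda>p. q + L p)"
    unfolding planar_chart_def by blast
  have Sr: "S \<subseteq> range \<phi>" using pc by (simp add: planar_chart_def)
  have "x1 \<in> S" "x2 \<in> S" "x3 \<in> S" unfolding S_def by (auto intro: hull_inc)
  then obtain p1 p2 p3 where p: "\<phi> p1 = x1" "\<phi> p2 = x2" "\<phi> p3 = x3" using Sr by blast
  define b c where "b = p2 - p1" and "c = p3 - p1"
  have Lb: "L b = x2 - x1" and Lc: "L c = x3 - x1"
    using p L(1) by (auto simp: b_def c_def \<phi> linear_diff)
  have inn: "L a \<bullet> L a' = a \<bullet> a'" for a a'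
    using L by (metis orthogonal_transformation orthogonal_transformation_def)
  define d where "d = det (vector [b, c] :: real^2^2)"
  have "d^2 = (norm (cross3 (x2 - x1) (x3 - x1)))^2"
    unfolding d_def gram_vec2 Lb[symmetric] Lc[symmetric]
    using norm_cross_dot[of "L b" "L c"] by (simp add: inn L(2) dot_square_norm power_mult_distrib)
  then have d: "\<bar>d\<bar> = norm (cross3 (x2 - x1) (x3 - x1))"
    by (metis abs_norm_cancel power2_eq_iff abs_minus_cancel)
  have "norm (cross3 (x2 - x1) (x3 - x1)) \<noteq> 0"
    using nc collinear_3[of x2 x1 x3] by (simp add: cross_eq_0 insert_commute)
  then have d0: "d \<noteq> 0" using d by auto
  define T where "T = convex hull {p1, p1 + b, p1 + c}"
  have "inj L" using L by (metis linear_injective_0 norm_eq_zero)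
  have "S = \<phi> ` T"
  proof -
    have "S = (+) q ` (L ` T)"
      unfolding S_def T_def p[symmetric] \<phi> b_def c_def convex_hull_linear_image[OF L(1)] convex_hull_translation[symmetric]
      by simp
    then show ?thesis by (simp add: \<phi> image_image)
  qed
  then have pre: "\<phi> p \<in> S \<longleftrightarrow> p \<in> T" for p
    using inj_image_mem_iff[of \<phi> p T] \<open>inj L\<close> by (simp add: \<phi> inj_def)
  have cphi: "continuous_on A \<phi>" for A
    unfolding \<phi> using L(1) by (intro continuous_intros linear_continuous_on linear_conv_bounded_linear[THEN iffD1])
  then have m: "\<phi> \<in> lborel \<rightarrow>\<^sub>M borel" by (simp add: borel_measurable_continuous_onI)
  have compS: "compact S" "compact T" unfolding S_def T_def by (auto intro!: finite_imp_compact_convex_hull)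
  have contT: "continuous_on T (\<lambda>p. f (\<phi> p))"
    by (rule continuous_on_compose2[OF cont cphi]) (use pre in auto)
  have sm: "surface_measure S = distr lborel borel \<phi>" by (simp add: surface_measure_def \<phi>_def)
  have fm: "(\<lambda>x. indicat_real S x *\<^sub>R f x) \<in> borel_measurable borel"
    using cont compS by (intro borel_measurable_continuous_on_indicator) (auto simp: compact_imp_closed borel_closed)
  have ind: "indicat_real S (\<phi> p) = indicat_real T p" for p
    using pre by (simp add: indicator_def)
  have intT: "integrable lborel (\<lambda>p. indicat_real T p *\<^sub>R f (\<phi> p))"
    using borel_integrable_compact[OF compS(2) contT] by simp
  show "set_integrable (surface_measure S) S f"
    unfolding set_integrable_def sm integrable_distr_eq[OF m fm] ind by (rule intT)
  have "(LINT x:S|surface_measure S. f x) = (LINT p|lborel. indicator S (\<phi> p) *\<^sub>R f (\<phi> p))"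
    unfolding sm set_lebesgue_integral_def by (rule integral_distr[OF m fm])
  also have "\<dots> = (LINT p:T|lborel. f (\<phi> p))"
    unfolding ind set_lebesgue_integral_def ..
  also have "\<dots> = integral T (\<lambda>p. f (\<phi> p))"
    by (rule set_borel_integral_eq_integral(2)) (simp add: set_integrable_def intT)
  also have "\<dots> = \<bar>d\<bar> *\<^sub>R tri_int (\<lambda>u v. f (\<phi> (p1 + u *\<^sub>R b + v *\<^sub>R c)))"
    unfolding T_def d_def
    by (rule integral_triangle_vec2) (use contT d0 T_def d_def in auto)
  also have "(\<lambda>u v. f (\<phi> (p1 + u *\<^sub>R b + v *\<^sub>R c))) = (\<lambda>u v. f (x1 + u *\<^sub>R (x2 - x1) + v *\<^sub>R (x3 - x1)))"
    using p(1) unfolding \<phi> linear_add[OF L(1)] linear_cmul[OF L(1)] Lb Lc by (auto simp: algebra_simps)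
  finally show "(LINT x:S|surface_measure S. f x)
    = norm (cross3 (x2 - x1) (x3 - x1)) *\<^sub>R tri_int (\<lambda>u v. f (x1 + u *\<^sub>R (x2 - x1) + v *\<^sub>R (x3 - x1)))"
    unfolding d .
qed

lemma tri_int_const: "tri_int (\<lambda>u v. c :: real) = c / 2"
proof -
  have "((\<lambda>v. (1 - v) * c) has_integral ((1 - 1^2 / 2) * c) - ((0 - 0^2/2) * c)) {0..1::real}"
    by (rule fundamental_theorem_of_calculus)
      (auto intro!: derivative_eq_intros simp: has_real_derivative_iff_has_vector_derivative[symmetric] power2_eq_square)
  moreover have "tri_int (\<lambda>u v. c) = integral {0..1} (\<lambda>v. (1 - v) * c)"
    by (simp add: tri_int_def del: integral_mult_left integral_mult_right)
  ultimately show ?thesis by (simp only: integral_unique) (simp add: field_simps)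
qed

lemma tri_int_linear:
  fixes f :: "real \<Rightarrow> real \<Rightarrow> 'b::euclidean_space"
  assumes L: "linear L" and cont: "continuous_on UNIV (\<lambda>p. f (fst p) (snd p))"
  shows "L (tri_int f) = tri_int (\<lambda>u v. L (f u v))"
proof -
  have bl: "bounded_linear L" using L by (simp add: linear_conv_bounded_linear)
  have c: "continuous_on UNIV (\<lambda>p::real\<times>real. (1 - fst p) *\<^sub>R f (snd p * (1 - fst p)) (fst p))"
    by (intro continuous_intros continuous_on_compose2[OF cont, of _ "\<lambda>p. (snd p * (1 - fst p), fst p)", simplified])
  have c1: "continuous_on {0..1} (\<lambda>u. (1 - v) *\<^sub>R f (u * (1 - v)) v)" for v
    by (rule continuous_on_compose2[OF c, of _ "\<lambda>u. (v, u)", simplified]) (intro continuous_intros)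
  have c2: "continuous_on {0..1} (\<lambda>v. integral {0..1} (\<lambda>u. (1 - v) *\<^sub>R f (u * (1 - v)) v))"
    using integral_continuous_on_param[of "{0..1}" "0::real" 1 "\<lambda>v u. (1 - v) *\<^sub>R f (u * (1 - v)) v"]
      continuous_on_subset[OF c] by (simp add: cbox_interval split_beta)
  show ?thesis
    unfolding tri_int_def
    by (subst integral_linear[OF _ bl, symmetric, unfolded o_def],
        rule integrable_continuous_interval[OF c2],
        subst integral_linear[OF integrable_continuous_interval[OF c1] bl, symmetric, unfolded o_def])
      (simp add: linear_scale[OF L])
qed

lemma affine_hull_param_mem:
  "x1 + u *\<^sub>R (x2 - x1) + v *\<^sub>R (x3 - x1) \<in> affine hull {x1, x2, x3}"
  unfolding affine_hull_3
  by (rule CollectI, rule exI[of _ "1 - u - v"], rule exI[of _ u], rule exI[of _ v]) (simp add: algebra_simps)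

text \<open>Reduces to the vector-valued case with values in \<open>real^1\<close>. Continuity is
  demanded on the whole plane because commuting the coordinate map with \<open>tri_int\<close> uses
  an integrand continuous for all parameters.\<close>

lemma surface_integral_triangle:
  fixes f :: "real^3 \<Rightarrow> real" and x1 x2 x3 :: "real^3"
  defines "S \<equiv> convex hull {x1, x2, x3}"
  assumes nc: "\<not> collinear {x1, x2, x3}" and cont: "continuous_on (affine hull {x1, x2, x3}) f"
  shows "(LINT x:S|surface_measure S. f x)
    = norm (cross3 (x2 - x1) (x3 - x1)) * tri_int (\<lambda>u v. f (x1 + u *\<^sub>R (x2 - x1) + v *\<^sub>R (x3 - x1)))"
proof -
  define F where "F x = (vec (f x) :: real^1)" for x
  define L where "L v = v $ 1" for v :: "real^1"
  have bl: "bounded_linear L" unfolding L_def by (rule bounded_linear_vec_nth)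
  have LF: "L (F x) = f x" for x by (simp add: L_def F_def)
  have "continuous_on (affine hull {x1, x2, x3}) F"
    unfolding F_def by (subst continuous_on_componentwise) (auto simp: Basis_vec_def inner_axis cont)
  then have cS: "continuous_on S F" and
    cU: "continuous_on UNIV (\<lambda>p. F (x1 + fst p *\<^sub>R (x2 - x1) + snd p *\<^sub>R (x3 - x1)))"
    unfolding S_def
    by (rule continuous_on_subset[OF _ convex_hull_subset_affine_hull])
       (rule continuous_on_compose2[OF \<open>continuous_on _ F\<close>],
        auto intro!: continuous_intros affine_hull_param_mem)
  note I = surface_integral_triangle_vec[OF nc, of F, folded S_def, OF cS]
  have "(LINT x:S|surface_measure S. f x) = L (LINT x:S|surface_measure S. F x)"
    unfolding set_lebesgue_integral_def
    by (subst integral_bounded_linear[OF bl, symmetric])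
      (use I(2) in \<open>simp_all add: set_integrable_def linear_scale[OF bounded_linear.linear[OF bl]] LF\<close>)
  also have "\<dots> = norm (cross3 (x2 - x1) (x3 - x1)) * tri_int (\<lambda>u v. f (x1 + u *\<^sub>R (x2 - x1) + v *\<^sub>R (x3 - x1)))"
    unfolding I(1) linear_scale[OF bounded_linear.linear[OF bl]]
    by (subst tri_int_linear[OF bounded_linear.linear[OF bl] cU]) (simp add: LF)
  finally show ?thesis .
qed

text \<open>The case of the constant integrand 1. It ties the area occurring in
  \<open>unit_normal\<close> to the cross product, so that the normal really has length one.\<close>

lemma norm_cross_eq_area:
  assumes "\<not> collinear {x1, x2, x3}"
  shows "norm (cross3 (x2 - x1) (x3 - x1)) = 2 * surface_area (convex hull {x1, x2, x3})"
proof -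
  have "compact (convex hull {x1, x2, x3})" by (auto intro!: finite_imp_compact_convex_hull)
  then have "convex hull {x1, x2, x3} \<in> sets borel" by (simp add: borel_closed compact_imp_closed)
  then have "surface_area (convex hull {x1, x2, x3}) =
    (LINT x:convex hull {x1, x2, x3}|surface_measure (convex hull {x1, x2, x3}). 1)"
    by (simp add: surface_area_def set_lebesgue_integral_def surface_measure_def)
  also have "\<dots> = norm (cross3 (x2 - x1) (x3 - x1)) / 2"
    by (subst surface_integral_triangle[OF assms]) (simp_all add: tri_int_const)
  finally show ?thesis by simp
qed

section \<open>Continuity, Fubini and linearity for integrals over triangles\<close>

lemma continuous_on_tri_integrand:
  fixes f :: "real \<Rightarrow> real \<Rightarrow> 'b::real_normed_vector"
  assumes "continuous_on UNIV (\<lambda>p::real\<times>real. f (fst p) (snd p))"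
  shows "continuous_on S (\<lambda>p. (1 - fst p) *\<^sub>R f (snd p * (1 - fst p)) (fst p))"
  by (intro continuous_intros
      continuous_on_compose2[OF assms, of S "\<lambda>p. (snd p * (1 - fst p), fst p)", simplified])

lemma tri_int_eq_integral:
  fixes f :: "real \<Rightarrow> real \<Rightarrow> 'b::euclidean_space"
  assumes "continuous_on UNIV (\<lambda>p::real\<times>real. f (fst p) (snd p))"
  shows "tri_int f = integral (cbox (0,0) (1,1)) (\<lambda>p. (1 - fst p) *\<^sub>R f (snd p * (1 - fst p)) (fst p))"
  using integral_prod_continuous[OF continuous_on_tri_integrand[OF assms, of "cbox (0,0) (1,1)"]]
  by (simp add: tri_int_def cbox_interval)

lemma continuous_on_tri_int:
  fixes f :: "'a::topological_space \<Rightarrow> real \<Rightarrow> real \<Rightarrow> 'b::euclidean_space"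
  assumes "continuous_on UNIV (\<lambda>q. f (fst q) (fst (snd q)) (snd (snd q)))"
  shows "continuous_on UNIV (\<lambda>x. tri_int (f x))"
proof -
  have 1: "continuous_on UNIV (\<lambda>p. f x (fst p) (snd p))" for x
    by (rule continuous_on_compose2[OF assms, of _ "\<lambda>p. (x, p)", simplified]) (intro continuous_intros)
  have 2: "continuous_on UNIV (\<lambda>q. (1 - fst (snd q)) *\<^sub>R f (fst q) (snd (snd q) * (1 - fst (snd q))) (fst (snd q)))"
    by (intro continuous_intros
      continuous_on_compose2[OF assms, of _ "\<lambda>q. (fst q, snd (snd q) * (1 - fst (snd q)), fst (snd q))", simplified])
  show ?thesis
    unfolding tri_int_eq_integral[OF 1]
    by (rule integral_continuous_on_param) (use continuous_on_subset[OF 2] in \<open>simp add: split_beta\<close>)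
qed

lemma continuous_on_integral_unit:
  fixes f :: "'a::topological_space \<Rightarrow> real \<Rightarrow> 'b::euclidean_space"
  assumes "continuous_on UNIV (\<lambda>q. f (fst q) (snd q))"
  shows "continuous_on UNIV (\<lambda>x. integral {0..1} (f x))"
  using integral_continuous_on_param[of UNIV 0 1 f] continuous_on_subset[OF assms] by (simp add: cbox_interval split_beta)

lemma tri_int_swap:
  fixes f :: "real \<Rightarrow> real \<Rightarrow> real \<Rightarrow> real \<Rightarrow> 'b::euclidean_space"
  assumes c: "continuous_on UNIV (\<lambda>q. f (fst (fst q)) (snd (fst q)) (fst (snd q)) (snd (snd q)))"
  shows "tri_int (\<lambda>u v. tri_int (f u v)) = tri_int (\<lambda>w z. tri_int (\<lambda>u v. f u v w z))"
proof -
  have 1: "continuous_on UNIV (\<lambda>p. f u v (fst p) (snd p))" for u v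
    by (rule continuous_on_compose2[OF c, of _ "\<lambda>p. ((u, v), p)", simplified]) (intro continuous_intros)
  have 2: "continuous_on UNIV (\<lambda>p. f (fst p) (snd p) w z)" for w z
    by (rule continuous_on_compose2[OF c, of _ "\<lambda>p. (p, (w, z))", simplified]) (intro continuous_intros)
  have 3: "continuous_on UNIV (\<lambda>p. tri_int (f (fst p) (snd p)))"
    by (rule continuous_on_tri_int) (rule c)
  have c': "continuous_on UNIV (\<lambda>q. f (fst (snd q)) (snd (snd q)) (fst (fst q)) (snd (fst q)))"
    by (rule continuous_on_compose2[OF c, of _ "\<lambda>q. (snd q, fst q)", simplified]) (intro continuous_intros)
  have 4: "continuous_on UNIV (\<lambda>p. tri_int (\<lambda>u v. f u v (fst p) (snd p)))"
    by (rule continuous_on_tri_int) (rule c')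
  let ?F = "\<lambda>p q. (1 - fst p) *\<^sub>R (1 - fst q) *\<^sub>R f (snd p * (1 - fst p)) (fst p) (snd q * (1 - fst q)) (fst q)"
  have 5: "continuous_on S (\<lambda>(p, q). ?F p q)" for S
    unfolding split_beta
    by (intro continuous_intros continuous_on_compose2[OF c, of S "\<lambda>q. ((snd (fst q) * (1 - fst (fst q)), fst (fst q)), (snd (snd q) * (1 - fst (snd q)), fst (snd q)))", simplified])
  have "integral (cbox (0,0) (1,1)) (\<lambda>p. integral (cbox (0,0) (1,1)) (?F p))
      = integral (cbox (0,0) (1,1)) (\<lambda>q. integral (cbox (0,0) (1,1)) (\<lambda>p. ?F p q))"
    by (rule integral_swap_continuous) (rule 5)
  then show ?thesis
    unfolding tri_int_eq_integral[OF 3] tri_int_eq_integral[OF 4] unfolding tri_int_eq_integral[OF 1] tri_int_eq_integral[OF 2]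
    unfolding integral_cmul[symmetric] by (simp only: scaleR_left_commute)
qed

lemma tri_int_integral_swap:
  fixes f :: "real \<Rightarrow> real \<Rightarrow> real \<Rightarrow> 'b::euclidean_space"
  assumes c: "continuous_on UNIV (\<lambda>q. f (fst (fst q)) (snd (fst q)) (snd q))"
  shows "tri_int (\<lambda>u v. integral {0..1} (f u v)) = integral {0..1} (\<lambda>t. tri_int (\<lambda>u v. f u v t))"
proof -
  have 2: "continuous_on UNIV (\<lambda>p. f (fst p) (snd p) w)" for w
    by (rule continuous_on_compose2[OF c, of _ "\<lambda>p. (p, w)", simplified]) (intro continuous_intros)
  have 3: "continuous_on UNIV (\<lambda>p. integral {0..1} (f (fst p) (snd p)))"
    by (rule continuous_on_integral_unit) (rule c)
  let ?F = "\<lambda>p t. (1 - fst p) *\<^sub>R f (snd p * (1 - fst p)) (fst p) t"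
  have 5: "continuous_on S (\<lambda>(p, q). ?F p q)" for S
    unfolding split_beta
    by (intro continuous_intros continuous_on_compose2[OF c, of S "\<lambda>q. ((snd (fst q) * (1 - fst (fst q)), fst (fst q)), snd q)", simplified])
  have "integral (cbox (0,0) (1,1)) (\<lambda>p. integral (cbox 0 1) (?F p))
      = integral (cbox 0 1) (\<lambda>q. integral (cbox (0,0) (1,1)) (\<lambda>p. ?F p q))"
    by (rule integral_swap_continuous) (rule 5)
  then show ?thesis
    unfolding tri_int_eq_integral[OF 3] unfolding tri_int_eq_integral[OF 2]
    by (simp add: cbox_interval)
qed

lemma tri_int_add:
  fixes f g :: "real \<Rightarrow> real \<Rightarrow> 'b::euclidean_space"
  assumes f: "continuous_on UNIV (\<lambda>p. f (fst p) (snd p))" and g: "continuous_on UNIV (\<lambda>p. g (fst p) (snd p))"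
  shows "tri_int (\<lambda>u v. f u v + g u v) = tri_int f + tri_int g"
proof -
  have fg: "continuous_on UNIV (\<lambda>p. f (fst p) (snd p) + g (fst p) (snd p))" by (intro continuous_intros f g)
  show ?thesis
    unfolding tri_int_eq_integral[OF f] tri_int_eq_integral[OF g] tri_int_eq_integral[OF fg]
    by (subst integral_add[symmetric], (intro integrable_continuous continuous_on_tri_integrand f g)+) (simp add: scaleR_add_right)
qed

lemma tri_int_cmult:
  "tri_int (\<lambda>u v. k * f u v :: real) = k * tri_int f"
proof -
  have "(\<lambda>u. (1 - v) *\<^sub>R (k * f (u * (1 - v)) v)) = (\<lambda>u. k * ((1 - v) *\<^sub>R f (u * (1 - v)) v))" for v
    by (simp add: algebra_simps)
  then show ?thesis by (simp only: tri_int_def integral_mult_right)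
qed

text \<open>On the unit square \<open>u \<mapsto> (u (1 - v), v)\<close> the divergence of \<open>((u + s) g, (v + t) g)\<close> times the
  Jacobian \<open>1 - v\<close> is \<open>\<partial>\<^sub>u\<close> of boundary terms plus \<open>\<partial>\<^sub>v\<close> of \<open>(1 - v) (v + t) g\<close>.\<close>

lemma tri_int_divergence:
  fixes g g1 g2 :: "real \<Rightarrow> real \<Rightarrow> real"
  assumes d: "\<And>u v. ((\<lambda>p. g (fst p) (snd p)) has_derivative (\<lambda>h. g1 u v * fst h + g2 u v * snd h)) (at (u, v))"
    and c1: "continuous_on UNIV (\<lambda>p. g1 (fst p) (snd p))" and c2: "continuous_on UNIV (\<lambda>p. g2 (fst p) (snd p))"
  shows "tri_int (\<lambda>u v. 2 * g u v + (u + s) * g1 u v + (v + t) * g2 u v)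
    = (1 + s + t) * integral {0..1} (\<lambda>v. g (1 - v) v) - s * integral {0..1} (\<lambda>v. g 0 v) - t * integral {0..1} (\<lambda>u. g u 0)"
proof -
  have c0: "continuous_on UNIV (\<lambda>p. g (fst p) (snd p))"
    by (rule continuous_at_imp_continuous_on) (use has_derivative_continuous[OF d] in auto)
  have chain: "((\<lambda>x. g (a x) (b x)) has_real_derivative g1 (a x) (b x) * a' + g2 (a x) (b x) * b') (at x within S)"
    if "(a has_real_derivative a') (at x within S)" "(b has_real_derivative b') (at x within S)" for a b a' b' x S
  proof -
    have "((\<lambda>x. (a x, b x)) has_derivative (\<lambda>h. (a' * h, b' * h))) (at x within S)"
      using that by (intro has_derivative_Pair) (auto simp: has_field_derivative_def)
    from has_derivative_compose[OF this, of "\<lambda>p. g (fst p) (snd p)", OF d, unfolded fst_conv snd_conv] show ?thesis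
      unfolding has_field_derivative_def by (rule has_derivative_eq_rhs) (auto simp: algebra_simps)
  qed
  note ci = continuous_on_compose2[OF c0, of _ "\<lambda>q. (a q, b q)" for a b, simplified]
    continuous_on_compose2[OF c1, of _ "\<lambda>q. (a q, b q)" for a b, simplified]
    continuous_on_compose2[OF c2, of _ "\<lambda>q. (a q, b q)" for a b, simplified]
  define m where "m v = integral {0..1} (\<lambda>u. (1 - v) * ((v + t) * g (u * (1 - v)) v))" for v
  define m1 where "m1 v u = - ((v + t) * g (u * (1 - v)) v) + (1 - v) * (g (u * (1 - v)) v
     + (v + t) * (g1 (u * (1 - v)) v * (- u) + g2 (u * (1 - v)) v))" for u v
  have m1c: "continuous_on S (\<lambda>q. m1 (fst q) (snd q))" for S
    unfolding m1_def by (intro continuous_intros ci)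
  have m1c': "continuous_on S (m1 v)" for v S
    by (rule continuous_on_compose2[OF m1c[of UNIV], of _ "\<lambda>u. (v, u)", simplified]) (intro continuous_intros)
  have dm: "(m has_real_derivative integral {0..1} (m1 v)) (at v within {0..1})" if "v \<in> {0..1}" for v
    unfolding m_def
  proof (rule leibniz_rule_field_derivative[of "{0..1}" 0 "1::real", unfolded cbox_interval, OF _ _ _ that])
    fix x u :: real
    show "((\<lambda>v. (1 - v) * ((v + t) * g (u * (1 - v)) v)) has_real_derivative m1 x u) (at x within {0..1})"
      unfolding m1_def by (auto intro!: derivative_eq_intros chain simp: algebra_simps)
    show "(\<lambda>u. (1 - x) * ((x + t) * g (u * (1 - x)) x)) integrable_on {0..1}"
      by (intro integrable_continuous_interval continuous_intros ci)
  next
    show "continuous_on ({0..1} \<times> {0..1}) (\<lambda>(x, t). m1 x t)"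
      using m1c by (simp add: split_beta)
  qed (auto simp: convex_real_interval)
  have inner: "integral {0..1} (\<lambda>u. (1 - v) * (2 * g (u * (1 - v)) v + (u * (1 - v) + s) * g1 (u * (1 - v)) v + (v + t) * g2 (u * (1 - v)) v))
     = (1 + s + t) * g (1 - v) v - s * g 0 v + integral {0..1} (m1 v)" for v
  proof -
    \<comment> \<open>The second summand absorbs what \<open>m1\<close> contains beyond the
      divergence: the derivative of the factor \<open>1 - v\<close>, and the term with
      \<open>- u\<close> that arises because \<open>u * (1 - v)\<close> moves with \<open>v\<close>.
      At \<open>u = 1\<close> the two weights add up to the constant
      \<open>1 + s + t\<close>.\<close>
    let ?A = "\<lambda>u. (u * (1 - v) + s) * g (u * (1 - v)) v + u * ((v + t) * g (u * (1 - v)) v)"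
    let ?A' = "\<lambda>u. (1 - v) * g (u * (1 - v)) v + (u * (1 - v) + s) * (g1 (u * (1 - v)) v * (1 - v))
        + ((v + t) * g (u * (1 - v)) v + u * ((v + t) * (g1 (u * (1 - v)) v * (1 - v))))"
    have "(?A' has_integral ?A 1 - ?A 0) {0..1}"
      by (rule fundamental_theorem_of_calculus)
        (auto simp: has_real_derivative_iff_has_vector_derivative[symmetric] intro!: derivative_eq_intros chain simp: algebra_simps)
    moreover have "(m1 v has_integral integral {0..1} (m1 v)) {0..1}"
      by (intro integrable_integral integrable_continuous_interval m1c')
    ultimately have "((\<lambda>u. ?A' u + m1 v u) has_integral (?A 1 - ?A 0) + integral {0..1} (m1 v)) {0..1}"
      by (rule has_integral_add)
    moreover have "(\<lambda>u. ?A' u + m1 v u) = (\<lambda>u. (1 - v) * (2 * g (u * (1 - v)) v + (u * (1 - v) + s) * g1 (u * (1 - v)) v + (v + t) * g2 (u * (1 - v)) v))"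
      unfolding m1_def by (simp add: fun_eq_iff algebra_simps)
    ultimately have "((\<lambda>u. (1 - v) * (2 * g (u * (1 - v)) v + (u * (1 - v) + s) * g1 (u * (1 - v)) v + (v + t) * g2 (u * (1 - v)) v))
      has_integral (?A 1 - ?A 0) + integral {0..1} (m1 v)) {0..1}"
      by (simp only:)
    then show ?thesis by (subst integral_unique) (auto simp: algebra_simps)
  qed
  have "((\<lambda>v. integral {0..1} (m1 v)) has_integral m 1 - m 0) {0..1}"
    by (rule fundamental_theorem_of_calculus)
      (auto simp: has_real_derivative_iff_has_vector_derivative[symmetric] intro!: dm)
  moreover have "((\<lambda>v. (1 + s + t) * g (1 - v) v - s * g 0 v) has_integral
      (1 + s + t) * integral {0..1} (\<lambda>v. g (1 - v) v) - s * integral {0..1} (\<lambda>v. g 0 v)) {0..1}"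
    by (intro has_integral_diff has_integral_mult_right integrable_integral integrable_continuous_interval ci continuous_intros)
  ultimately have "((\<lambda>v. (1 + s + t) * g (1 - v) v - s * g 0 v + integral {0..1} (m1 v)) has_integral
     (1 + s + t) * integral {0..1} (\<lambda>v. g (1 - v) v) - s * integral {0..1} (\<lambda>v. g 0 v) + (m 1 - m 0)) {0..1}"
    by (intro has_integral_add)
  \<comment> \<open>The collapsed edge \<open>v = 1\<close> has weight \<open>1 - v = 0\<close>;
    only the edge \<open>v = 0\<close> contributes.\<close>
  moreover have "m 1 = 0" "m 0 = t * integral {0..1} (\<lambda>u. g u 0)" by (auto simp: m_def)
  ultimately show ?thesis
    unfolding tri_int_def real_scaleR_def inner by (simp add: integral_unique)
qed

section \<open>Radial means and the divergence theorem\<close>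

text \<open>The open half-line reaches below 0 because the arguments are squared lengths:
  derivatives at 0 stay two-sided. For \<open>c > 0\<close> it is mapped into itself by the factors
  \<open>t\<^sup>2\<close> of a radial mean and by Pythagorean shifts.\<close>

definition C1_above :: "real \<Rightarrow> (real \<Rightarrow> real) \<Rightarrow> (real \<Rightarrow> real) \<Rightarrow> bool" where
  "C1_above c \<psi> \<psi>' \<longleftrightarrow> (\<forall>x>-c. (\<psi> has_real_derivative \<psi>' x) (at x)) \<and> continuous_on {-c<..} \<psi>'"

definition radial_mean :: "nat \<Rightarrow> (real \<Rightarrow> real) \<Rightarrow> real \<Rightarrow> real" where
  "radial_mean d \<psi> x = integral {0..1} (\<lambda>t. t ^ (d - 1) * \<psi> (t\<^sup>2 * x))"

lemma C1_above_continuous: "C1_above c \<psi> \<psi>' \<Longrightarrow> continuous_on {-c<..} \<psi>"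
  unfolding C1_above_def by (auto intro!: DERIV_atLeastAtMost_imp_continuous_on continuous_at_imp_continuous_on DERIV_isCont)

lemma C1_above_shift: "C1_above c \<psi> \<psi>' \<Longrightarrow> C1_above c (\<lambda>x. \<psi> (x + h\<^sup>2)) (\<lambda>x. \<psi>' (x + h\<^sup>2))"
  unfolding C1_above_def
proof (intro conjI allI impI; elim conjE)
  fix x assume *: "\<forall>x>- c. (\<psi> has_real_derivative \<psi>' x) (at x)" "x > - c"
  then have "x + h\<^sup>2 > - c" using zero_le_power2[of h] by linarith
  with * have "(\<psi> has_real_derivative \<psi>' (x + h\<^sup>2)) (at (x + h\<^sup>2))" by blast
  from DERIV_chain2[where f = \<psi> and g = "\<lambda>x. x + h\<^sup>2" and Db = 1 and x = x and s = UNIV, OF this]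
  have "((\<lambda>x. \<psi> (x + h\<^sup>2)) has_real_derivative \<psi>' (x + h\<^sup>2) * 1) (at x)"
    by (rule meta_mp) (auto intro!: derivative_eq_intros)
  then show "((\<lambda>x. \<psi> (x + h\<^sup>2)) has_real_derivative \<psi>' (x + h\<^sup>2)) (at x)" by simp
next
  assume "continuous_on {-c<..} \<psi>'"
  then show "continuous_on {-c<..} (\<lambda>x. \<psi>' (x + h\<^sup>2))"
    by (rule continuous_on_compose2) (auto intro!: continuous_intros intro: less_le_trans[of "-c"])
qed

lemma sq_scale_above:
  assumes "0 < c" "-c < x" "0 \<le> t" "t \<le> (1::real)"
  shows "-c < t\<^sup>2 * x"
proof (cases "x \<ge> 0")
  case False
  have "t\<^sup>2 \<le> 1" using assms by (simp add: power_le_one)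
  then have "1 * x \<le> t\<^sup>2 * x" using False by (intro mult_right_mono_neg) auto
  then show ?thesis using assms by simp
qed (use assms in \<open>auto intro: less_le_trans[of _ 0]\<close>)

lemma radial_mean_integrand_continuous:
  fixes \<psi> :: "real \<Rightarrow> real"
  assumes "continuous_on {-c<..} \<psi>" "0 < c" "-c < x"
  shows "continuous_on {0..1} (\<lambda>t. t ^ n * \<psi> (t\<^sup>2 * x))"
  by (intro continuous_intros continuous_on_compose2[OF assms(1)]) (use sq_scale_above assms in auto)

text \<open>Differentiation under the integral produces a factor \<open>t\<^sup>2\<close>, which
  raises the weight from \<open>d\<close> to \<open>d + 2\<close>.\<close>

lemma C1_above_radial_mean:
  assumes C: "C1_above c \<psi> \<psi>'" and c: "0 < c" and d: "d \<ge> 1"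
  shows "C1_above c (radial_mean d \<psi>) (radial_mean (d + 2) \<psi>')"
proof -
  have cont: "continuous_on {-c<..} \<psi>'" using C by (simp add: C1_above_def)
  have d': "d + 2 - 1 = (d - 1) + 2" using d by simp
  have cjoint: "continuous_on ({-c<..} \<times> {0..1}) (\<lambda>(x, t). t ^ (d + 2 - 1) * \<psi>' (t\<^sup>2 * x))"
    unfolding split_beta
    by (intro continuous_intros continuous_on_compose2[OF cont]) (use sq_scale_above c in auto)
  have "(radial_mean d \<psi> has_real_derivative radial_mean (d + 2) \<psi>' x) (at x)" if x: "-c < x" for x
  proof -
    have "(radial_mean d \<psi> has_real_derivative radial_mean (d + 2) \<psi>' x) (at x within {-c<..})"
      unfolding radial_mean_def
    proof (rule leibniz_rule_field_derivative[of "{-c<..}" 0 "1::real", unfolded cbox_interval])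
      fix y t :: real assume "y \<in> {-c<..}" "t \<in> {0..1}"
      then have "(\<psi> has_real_derivative \<psi>' (t\<^sup>2 * y)) (at (t\<^sup>2 * y))"
        using C sq_scale_above[OF c] by (auto simp: C1_above_def)
      from DERIV_chain2[where f = \<psi> and g = "\<lambda>y. t\<^sup>2 * y" and Db = "t\<^sup>2" and x = y and s = "{-c<..}", OF this]
      have *: "((\<lambda>y. \<psi> (t\<^sup>2 * y)) has_real_derivative \<psi>' (t\<^sup>2 * y) * t\<^sup>2) (at y within {-c<..})"
        by (rule meta_mp) (auto intro!: derivative_eq_intros)
      show "((\<lambda>y. t ^ (d - 1) * \<psi> (t\<^sup>2 * y)) has_real_derivative t ^ (d + 2 - 1) * \<psi>' (t\<^sup>2 * y)) (at y within {-c<..})"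
        unfolding d' power_add by (rule derivative_eq_intros * refl | simp)+
    next
      fix y assume "y \<in> {-c<..}"
      then show "(\<lambda>t. t ^ (d - 1) * \<psi> (t\<^sup>2 * y)) integrable_on {0..1}"
        by (intro integrable_continuous_interval radial_mean_integrand_continuous[OF C1_above_continuous[OF C] c]) auto
    qed (use x cjoint in auto)
    then show ?thesis using x by (simp add: at_within_open[of x "{-c<..}"])
  qed
  moreover have "continuous_on {-c<..} (radial_mean (d + 2) \<psi>')"
    unfolding radial_mean_def
    using integral_continuous_on_param[of "{-c<..}" 0 "1::real" "\<lambda>x t. t ^ (d + 2 - 1) * \<psi>' (t\<^sup>2 * x)"] cjoint
    by (simp add: cbox_interval)
  ultimately show ?thesis by (simp add: C1_above_def)
qed

text \<open>Integrate the derivative of \<open>t ^ d * \<psi> (t\<^sup>2 * x)\<close> over the unit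
  interval; since \<open>d\<close> is positive, the lower end contributes nothing.\<close>

lemma radial_mean_ode:
  assumes C: "C1_above c \<psi> \<psi>'" and c: "0 < c" and d: "d \<ge> 1" and x: "-c < x"
  shows "real d * radial_mean d \<psi> x + 2 * x * radial_mean (d + 2) \<psi>' x = \<psi> x"
proof -
  have d': "d + 2 - 1 = (d - 1) + 2" using d by simp
  let ?f = "\<lambda>t. real d * (t ^ (d - 1) * \<psi> (t\<^sup>2 * x)) + (2 * x) * (t ^ (d + 2 - 1) * \<psi>' (t\<^sup>2 * x))"
  have "(?f has_integral (1 ^ d * \<psi> (1\<^sup>2 * x) - 0 ^ d * \<psi> (0\<^sup>2 * x))) {0..1}"
  proof (rule fundamental_theorem_of_calculus)
    fix t :: real assume t: "t \<in> {0..1}"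
    then have "(\<psi> has_real_derivative \<psi>' (t\<^sup>2 * x)) (at (t\<^sup>2 * x))"
      using C sq_scale_above[OF c x] by (auto simp: C1_above_def)
    from DERIV_chain2[where f = \<psi> and g = "\<lambda>t. t\<^sup>2 * x" and Db = "2 * t * x" and x = t and s = "{0..1}", OF this]
    have *: "((\<lambda>t. \<psi> (t\<^sup>2 * x)) has_real_derivative \<psi>' (t\<^sup>2 * x) * (2 * t * x)) (at t within {0..1})"
      by (rule meta_mp) (auto intro!: derivative_eq_intros)
    have td: "t ^ d = t * t ^ (d - 1)" using d by (cases d) auto
    have "((\<lambda>t. t ^ d * \<psi> (t\<^sup>2 * x)) has_real_derivative ?f t) (at t within {0..1})"
      unfolding d' power_add by (rule derivative_eq_intros * refl | simp add: td power2_eq_square)+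
    then show "((\<lambda>t. t ^ d * \<psi> (t\<^sup>2 * x)) has_vector_derivative ?f t) (at t within {0..1})"
      by (simp add: has_real_derivative_iff_has_vector_derivative)
  qed simp
  moreover have "(?f has_integral real d * radial_mean d \<psi> x + (2 * x) * radial_mean (d + 2) \<psi>' x) {0..1}"
    unfolding radial_mean_def
    by (intro has_integral_add has_integral_mult_right integrable_integral integrable_continuous_interval
        radial_mean_integrand_continuous[OF _ c x] C1_above_continuous[OF C]) (use C in \<open>simp add: C1_above_def\<close>)
  ultimately have "real d * radial_mean d \<psi> x + (2 * x) * radial_mean (d + 2) \<psi>' x = 1 ^ d * \<psi> (1\<^sup>2 * x) - 0 ^ d * \<psi> (0\<^sup>2 * x)"
    by (rule has_integral_unique[symmetric])
  then show ?thesis using d by (simp add: power_0_left)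
qed

lemma continuous_on_sq_norm:
  fixes g :: "'a::topological_space \<Rightarrow> 'b::real_normed_vector"
  assumes "continuous_on {-c<..} \<psi>" "0 < c" "continuous_on S g"
  shows "continuous_on S (\<lambda>x. \<psi> ((norm (g x))\<^sup>2))"
  by (rule continuous_on_compose2[OF assms(1)]) (use assms in \<open>auto intro!: continuous_intros intro: less_le_trans[of _ 0]\<close>)

text \<open>This and the following integrals run over the parameter domain, without a Jacobian. They
  remain meaningful when the direction vectors are linearly dependent, as four vectors in a plane
  are.\<close>

definition line_int :: "(real \<Rightarrow> real) \<Rightarrow> 'a::real_inner \<Rightarrow> 'a \<Rightarrow> real" where
  "line_int \<psi> a e = integral {0..1} (\<lambda>t. \<psi> ((norm (e + t *\<^sub>R a))\<^sup>2))"

definition simplex_int :: "(real \<Rightarrow> real) \<Rightarrow> 'a::real_inner \<Rightarrow> 'a \<Rightarrow> 'a \<Rightarrow> real" where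
  "simplex_int \<psi> a b e = tri_int (\<lambda>u v. \<psi> ((norm (e + u *\<^sub>R a + v *\<^sub>R b))\<^sup>2))"

definition parallelogram_int :: "(real \<Rightarrow> real) \<Rightarrow> 'a::real_inner \<Rightarrow> 'a \<Rightarrow> 'a \<Rightarrow> real" where
  "parallelogram_int \<psi> a b e = integral {0..1} (\<lambda>t. line_int \<psi> b (e + t *\<^sub>R a))"

definition prism_int :: "(real \<Rightarrow> real) \<Rightarrow> 'a::real_inner \<Rightarrow> 'a \<Rightarrow> 'a \<Rightarrow> 'a \<Rightarrow> real" where
  "prism_int \<psi> a b c e = tri_int (\<lambda>u v. line_int \<psi> c (e + u *\<^sub>R a + v *\<^sub>R b))"

definition duoprism_int :: "(real \<Rightarrow> real) \<Rightarrow> 'a::real_inner \<Rightarrow> 'a \<Rightarrow> 'a \<Rightarrow> 'a \<Rightarrow> 'a \<Rightarrow> real" where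
  "duoprism_int \<psi> a b c d e = tri_int (\<lambda>u v. simplex_int \<psi> c d (e + u *\<^sub>R a + v *\<^sub>R b))"

text \<open>The divergence formula traverses the hypotenuse of a triangle from \<open>e + a\<close>,
  whereas \<open>rec_T\<close> and \<open>rec_I3\<close> traverse it from \<open>e + b\<close>. The
  substitution \<open>t \<mapsto> 1 - t\<close> mediates.\<close>

lemma line_int_reverse:
  assumes "continuous_on {-c<..} \<psi>" "0 < c"
  shows "line_int \<psi> (a - b) (e + b) = line_int \<psi> (b - a) (e + a)"
proof -
  have "((\<lambda>t. \<psi> ((norm (e + b + t *\<^sub>R (a - b)))\<^sup>2)) has_integral line_int \<psi> (a - b) (e + b)) (cbox 0 1)"
    unfolding line_int_def cbox_interval
    by (intro integrable_integral integrable_continuous_interval continuous_on_sq_norm[OF assms] continuous_intros)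
  from has_integral_affinity[OF this, of "-1" 1]
  have "((\<lambda>t. \<psi> ((norm (e + b + (1 - t) *\<^sub>R (a - b)))\<^sup>2)) has_integral line_int \<psi> (a - b) (e + b)) {0..1}"
    by simp
  also have "(\<lambda>t. \<psi> ((norm (e + b + (1 - t) *\<^sub>R (a - b)))\<^sup>2)) = (\<lambda>t. \<psi> ((norm (e + a + t *\<^sub>R (b - a)))\<^sup>2))"
    by (simp add: algebra_simps)
  finally show ?thesis unfolding line_int_def[of _ "b - a"] by (simp add: integral_unique)
qed

section \<open>Divergence formulas on a segment and a triangle\<close>

lemma line_divergence:
  assumes C: "C1_above c \<psi> \<psi>'" and c: "0 < c"
  shows "integral {0..1} (\<lambda>t. \<psi> ((norm (e + t *\<^sub>R a))\<^sup>2) + (t + s) * (2 * (a \<bullet> (e + t *\<^sub>R a)) * \<psi>' ((norm (e + t *\<^sub>R a))\<^sup>2)))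
    = (1 + s) * \<psi> ((norm (e + a))\<^sup>2) - s * \<psi> ((norm e)\<^sup>2)" (is "integral _ ?f = _")
proof -
  have "(?f has_integral ((1 + s) * \<psi> ((norm (e + 1 *\<^sub>R a))\<^sup>2) - (0 + s) * \<psi> ((norm (e + 0 *\<^sub>R a))\<^sup>2))) {0..1}"
  proof (rule fundamental_theorem_of_calculus)
    fix t :: real
    have "- c < (norm (e + t *\<^sub>R a))\<^sup>2" using c by (simp add: less_le_trans[of _ 0])
    then have 1: "(\<psi> has_real_derivative \<psi>' ((norm (e + t *\<^sub>R a))\<^sup>2)) (at ((norm (e + t *\<^sub>R a))\<^sup>2))"
      using C by (simp add: C1_above_def)
    have 2: "((\<lambda>t. (norm (e + t *\<^sub>R a))\<^sup>2) has_real_derivative 2 * (a \<bullet> (e + t *\<^sub>R a))) (at t within {0..1})"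
      unfolding power2_norm_eq_inner has_field_derivative_def
      by (rule has_derivative_eq_rhs, (rule derivative_intros)+) (auto simp: inner_commute algebra_simps)
    have 3: "((\<lambda>t. \<psi> ((norm (e + t *\<^sub>R a))\<^sup>2)) has_real_derivative
        \<psi>' ((norm (e + t *\<^sub>R a))\<^sup>2) * (2 * (a \<bullet> (e + t *\<^sub>R a)))) (at t within {0..1})"
      by (rule DERIV_chain2[OF 1 2])
    have "((\<lambda>t. (t + s) * \<psi> ((norm (e + t *\<^sub>R a))\<^sup>2)) has_real_derivative ?f t) (at t within {0..1})"
      by (rule derivative_eq_intros 3 refl)+ (simp add: algebra_simps)
    then show "((\<lambda>t. (t + s) * \<psi> ((norm (e + t *\<^sub>R a))\<^sup>2)) has_vector_derivative ?f t) (at t within {0..1})"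
      by (simp add: has_real_derivative_iff_has_vector_derivative)
  qed simp
  then show ?thesis by (simp add: integral_unique)
qed

lemma simplex_divergence:
  fixes a b e :: "'a::real_inner"
  defines "X \<equiv> \<lambda>u v. e + u *\<^sub>R a + v *\<^sub>R b"
  assumes C: "C1_above c \<psi> \<psi>'" and c: "0 < c"
  shows "tri_int (\<lambda>u v. 2 * \<psi> ((norm (X u v))\<^sup>2) + (u + s) * (2 * (a \<bullet> X u v) * \<psi>' ((norm (X u v))\<^sup>2))
      + (v + t) * (2 * (b \<bullet> X u v) * \<psi>' ((norm (X u v))\<^sup>2)))
    = (1 + s + t) * line_int \<psi> (b - a) (e + a) - s * line_int \<psi> b e - t * line_int \<psi> a e"
proof -
  have C': "continuous_on {-c<..} \<psi>'" using C by (simp add: C1_above_def)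
  have "((\<lambda>p. \<psi> ((norm (X (fst p) (snd p)))\<^sup>2)) has_derivative (\<lambda>h. 2 * (a \<bullet> X u v) * \<psi>' ((norm (X u v))\<^sup>2) * fst h
     + 2 * (b \<bullet> X u v) * \<psi>' ((norm (X u v))\<^sup>2) * snd h)) (at (u, v))" for u v
  proof -
    have "- c < (norm (X u v))\<^sup>2" using c by (simp add: less_le_trans[of _ 0])
    then have 1: "(\<psi> has_derivative (\<lambda>h. \<psi>' ((norm (X u v))\<^sup>2) * h)) (at ((norm (X (fst (u, v)) (snd (u, v))))\<^sup>2))"
      using C by (simp add: C1_above_def has_field_derivative_def)
    have 2: "((\<lambda>p. (norm (X (fst p) (snd p)))\<^sup>2) has_derivative (\<lambda>h. 2 * (a \<bullet> X u v) * fst h + 2 * (b \<bullet> X u v) * snd h)) (at (u, v))"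
      unfolding power2_norm_eq_inner X_def
      by (rule has_derivative_eq_rhs, (rule derivative_intros)+) (auto simp: inner_commute algebra_simps)
    show ?thesis by (rule has_derivative_eq_rhs, rule has_derivative_compose[OF 2 1]) (simp add: algebra_simps)
  qed
  then have "tri_int (\<lambda>u v. 2 * \<psi> ((norm (X u v))\<^sup>2) + (u + s) * (2 * (a \<bullet> X u v) * \<psi>' ((norm (X u v))\<^sup>2))
      + (v + t) * (2 * (b \<bullet> X u v) * \<psi>' ((norm (X u v))\<^sup>2)))
    = (1 + s + t) * integral {0..1} (\<lambda>v. \<psi> ((norm (X (1 - v) v))\<^sup>2)) - s * integral {0..1} (\<lambda>v. \<psi> ((norm (X 0 v))\<^sup>2))
       - t * integral {0..1} (\<lambda>u. \<psi> ((norm (X u 0))\<^sup>2))"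
    by (rule tri_int_divergence) (unfold X_def, (intro continuous_intros continuous_on_sq_norm[OF C' c])+)
  moreover have "(\<lambda>v. \<psi> ((norm (X (1 - v) v))\<^sup>2)) = (\<lambda>v. \<psi> ((norm (e + a + v *\<^sub>R (b - a)))\<^sup>2))"
    by (simp add: X_def algebra_simps)
  moreover have "(\<lambda>v. \<psi> ((norm (X 0 v))\<^sup>2)) = (\<lambda>v. \<psi> ((norm (e + v *\<^sub>R b))\<^sup>2))"
    "(\<lambda>v. \<psi> ((norm (X v 0))\<^sup>2)) = (\<lambda>v. \<psi> ((norm (e + v *\<^sub>R a))\<^sup>2))"
    by (simp_all add: X_def)
  ultimately show ?thesis by (simp only: line_int_def)
qed

lemma continuous_on_line_int:
  fixes g :: "'x::topological_space \<Rightarrow> 'a::real_inner"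
  assumes "continuous_on {-c<..} \<psi>" "0 < c" "continuous_on UNIV g"
  shows "continuous_on UNIV (\<lambda>x. line_int \<psi> a (g x))"
  unfolding line_int_def
  by (intro continuous_on_integral_unit continuous_on_sq_norm[OF assms(1,2)] continuous_intros
      continuous_on_compose2[OF assms(3)]) auto

context
  fixes \<psi> \<psi>' :: "real \<Rightarrow> real" and c :: real
  assumes C: "C1_above c \<psi> \<psi>'" and c: "0 < c"
begin

section \<open>Flux formulas in dimensions one to four\<close>

lemma radial_mean_split:
  assumes "d \<ge> 1"
  shows "\<psi> ((norm X)\<^sup>2) = real d * radial_mean d \<psi> ((norm X)\<^sup>2) + 2 * (X \<bullet> X) * radial_mean (d + 2) \<psi>' ((norm X)\<^sup>2)"
  using radial_mean_ode[OF C c assms, of "(norm X)\<^sup>2"] c by (simp add: power2_norm_eq_inner less_le_trans[of _ 0])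

text \<open>Expanding one factor of \<open>X \<bullet> X\<close> spreads the radial term over the
  directions: \<open>2 * (a1 \<bullet> X) * radial_mean (d + 2) \<psi>' ((norm X)\<^sup>2)\<close>
  is the derivative of \<open>radial_mean d \<psi> ((norm X)\<^sup>2)\<close> along
  \<open>a1\<close>. When \<open>d\<close> is the number of directions, the sum is the divergence of
  the field with weights \<open>p1\<close>, \<open>p2\<close>.\<close>

lemma radial_mean_split2:
  assumes "d \<ge> 1" "X = p1 *\<^sub>R a1 + p2 *\<^sub>R a2"
  shows "\<psi> ((norm X)\<^sup>2) = real d * radial_mean d \<psi> ((norm X)\<^sup>2)
    + p1 * (2 * (a1 \<bullet> X) * radial_mean (d + 2) \<psi>' ((norm X)\<^sup>2)) + p2 * (2 * (a2 \<bullet> X) * radial_mean (d + 2) \<psi>' ((norm X)\<^sup>2))"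
proof -
  have "X \<bullet> X = p1 * (a1 \<bullet> X) + p2 * (a2 \<bullet> X)"
    by (subst (1) assms(2)) (simp add: inner_add_left)
  then show ?thesis
    unfolding radial_mean_split[OF assms(1), of X] by (simp only:) (simp add: distrib_left distrib_right mult_ac)
qed

lemma radial_mean_split3:
  assumes "d \<ge> 1" "X = p1 *\<^sub>R a1 + p2 *\<^sub>R a2 + p3 *\<^sub>R a3"
  shows "\<psi> ((norm X)\<^sup>2) = real d * radial_mean d \<psi> ((norm X)\<^sup>2)
    + p1 * (2 * (a1 \<bullet> X) * radial_mean (d + 2) \<psi>' ((norm X)\<^sup>2)) + p2 * (2 * (a2 \<bullet> X) * radial_mean (d + 2) \<psi>' ((norm X)\<^sup>2))
    + p3 * (2 * (a3 \<bullet> X) * radial_mean (d + 2) \<psi>' ((norm X)\<^sup>2))"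
proof -
  have "X \<bullet> X = p1 * (a1 \<bullet> X) + p2 * (a2 \<bullet> X) + p3 * (a3 \<bullet> X)"
    by (subst (1) assms(2)) (simp add: inner_add_left)
  then show ?thesis
    unfolding radial_mean_split[OF assms(1), of X] by (simp only:) (simp add: distrib_left distrib_right mult_ac)
qed

lemma radial_mean_split4:
  assumes "d \<ge> 1" "X = p1 *\<^sub>R a1 + p2 *\<^sub>R a2 + p3 *\<^sub>R a3 + p4 *\<^sub>R a4"
  shows "\<psi> ((norm X)\<^sup>2) = real d * radial_mean d \<psi> ((norm X)\<^sup>2)
    + p1 * (2 * (a1 \<bullet> X) * radial_mean (d + 2) \<psi>' ((norm X)\<^sup>2)) + p2 * (2 * (a2 \<bullet> X) * radial_mean (d + 2) \<psi>' ((norm X)\<^sup>2))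
    + p3 * (2 * (a3 \<bullet> X) * radial_mean (d + 2) \<psi>' ((norm X)\<^sup>2)) + p4 * (2 * (a4 \<bullet> X) * radial_mean (d + 2) \<psi>' ((norm X)\<^sup>2))"
proof -
  have "X \<bullet> X = p1 * (a1 \<bullet> X) + p2 * (a2 \<bullet> X) + p3 * (a3 \<bullet> X) + p4 * (a4 \<bullet> X)"
    by (subst (1) assms(2)) (simp add: inner_add_left)
  then show ?thesis
    unfolding radial_mean_split[OF assms(1), of X] by (simp only:) (simp add: distrib_left distrib_right mult_ac)
qed

text \<open>The end of the descent: the faces of a segment are two points, whose distances from 0
  become the arguments of the terminal function.\<close>

lemma line_int_radial:
  "line_int \<psi> a (s *\<^sub>R a) = (1 + s) * radial_mean 1 \<psi> ((\<bar>1 + s\<bar> * norm a)\<^sup>2) - s * radial_mean 1 \<psi> ((\<bar>s\<bar> * norm a)\<^sup>2)"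
proof -
  let ?X = "\<lambda>t. s *\<^sub>R a + t *\<^sub>R a"
  have *: "radial_mean 1 \<psi> ((norm (?X t))\<^sup>2) + (t + s) * (2 * (a \<bullet> ?X t) * radial_mean (1 + 2) \<psi>' ((norm (?X t))\<^sup>2))
    = \<psi> ((norm (?X t))\<^sup>2)" for t
  proof -
    have "?X t \<bullet> ?X t = (t + s) * (a \<bullet> ?X t)" by (simp add: algebra_simps)
    then show ?thesis unfolding radial_mean_split[of 1 "?X t", simplified] by simp
  qed
  have n: "(norm (s *\<^sub>R a + a))\<^sup>2 = (\<bar>1 + s\<bar> * norm a)\<^sup>2" "(norm (s *\<^sub>R a))\<^sup>2 = (\<bar>s\<bar> * norm a)\<^sup>2"
    by (metis norm_scaleR scaleR_add_left scaleR_one add.commute) simp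
  show ?thesis
    using line_divergence[OF C1_above_radial_mean[OF C c order_refl] c, of "s *\<^sub>R a" a s]
    unfolding * n by (simp add: line_int_def)
qed

lemma simplex_int_radial:
  assumes e: "e = s *\<^sub>R a + t *\<^sub>R b"
  shows "simplex_int \<psi> a b e = - s * line_int (radial_mean 2 \<psi>) b e - t * line_int (radial_mean 2 \<psi>) a e
    + (1 + s + t) * line_int (radial_mean 2 \<psi>) (a - b) (e + b)"
proof -
  let ?X = "\<lambda>u v. e + u *\<^sub>R a + v *\<^sub>R b"
  have C2: "C1_above c (radial_mean 2 \<psi>) (radial_mean (2 + 2) \<psi>')"
    by (rule C1_above_radial_mean[OF C c]) simp
  have *: "2 * radial_mean 2 \<psi> ((norm (?X u v))\<^sup>2) + (u + s) * (2 * (a \<bullet> ?X u v) * radial_mean (2 + 2) \<psi>' ((norm (?X u v))\<^sup>2))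
      + (v + t) * (2 * (b \<bullet> ?X u v) * radial_mean (2 + 2) \<psi>' ((norm (?X u v))\<^sup>2)) = \<psi> ((norm (?X u v))\<^sup>2)" for u v
  proof -
    have "?X u v = (u + s) *\<^sub>R a + (v + t) *\<^sub>R b" by (simp add: e algebra_simps)
    from radial_mean_split2[OF _ this, of 2] show ?thesis by simp
  qed
  show ?thesis
    using simplex_divergence[OF C2 c, of e a b s t] line_int_reverse[OF C1_above_continuous[OF C2] c, of a b e]
    unfolding * by (simp add: simplex_int_def)
qed

lemma parallelogram_int_swap: "parallelogram_int \<psi> a b e = parallelogram_int \<psi> b a e"
proof -
  have "continuous_on (cbox (0, 0) (1, 1)) (\<lambda>(x, y). \<psi> ((norm (e + x *\<^sub>R a + y *\<^sub>R b))\<^sup>2))"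
    unfolding split_beta by (intro continuous_on_sq_norm[OF C1_above_continuous[OF C] c] continuous_intros)
  from integral_swap_continuous[OF this] show ?thesis
    unfolding parallelogram_int_def line_int_def
    by (simp add: cbox_interval add.assoc add.commute[of "_ *\<^sub>R b"])
qed

text \<open>The two copies of the mean are shared out, one to each factor of the product, and each
  half is integrated first over its own variable, where it is an exact derivative.\<close>

lemma parallelogram_int_radial:
  assumes e: "e = s *\<^sub>R a + t *\<^sub>R b"
  shows "parallelogram_int \<psi> a b e
    = (1 + s) * line_int (radial_mean 2 \<psi>) b (e + a) - s * line_int (radial_mean 2 \<psi>) b e
    + (1 + t) * line_int (radial_mean 2 \<psi>) a (e + b) - t * line_int (radial_mean 2 \<psi>) a e"
proof -
  let ?X = "\<lambda>u v. e + u *\<^sub>R a + v *\<^sub>R b" and ?P = "radial_mean 2 \<psi>" and ?P' = "radial_mean (2 + 2) \<psi>'"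
  have C2: "C1_above c ?P ?P'" by (rule C1_above_radial_mean[OF C c]) simp
  note cP = C1_above_continuous[OF C2]
  have cP': "continuous_on {-c<..} ?P'" using C2 by (simp add: C1_above_def)
  let ?A = "\<lambda>u v. ?P ((norm (?X u v))\<^sup>2) + (u + s) * (2 * (a \<bullet> ?X u v) * ?P' ((norm (?X u v))\<^sup>2))"
  let ?B = "\<lambda>u v. ?P ((norm (?X u v))\<^sup>2) + (v + t) * (2 * (b \<bullet> ?X u v) * ?P' ((norm (?X u v))\<^sup>2))"
  have *: "\<psi> ((norm (?X u v))\<^sup>2) = ?A u v + ?B u v" for u v
  proof -
    have "?X u v = (u + s) *\<^sub>R a + (v + t) *\<^sub>R b" by (simp add: e algebra_simps)
    from radial_mean_split2[OF _ this, of 2] show ?thesis by simp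
  qed
  have cA: "continuous_on S (\<lambda>q. ?A (fst q) (snd q))" and cB: "continuous_on S (\<lambda>q. ?B (fst q) (snd q))" for S
    by (intro continuous_intros continuous_on_sq_norm[OF cP c] continuous_on_sq_norm[OF cP' c])+
  have cA1: "continuous_on S (?A u)" and cB1: "continuous_on S (?B u)" for u S
    by (intro continuous_intros continuous_on_sq_norm[OF cP c] continuous_on_sq_norm[OF cP' c])+
  have cL: "continuous_on S (\<lambda>x. line_int ?P y (g x))" if "continuous_on UNIV g" for S y and g :: "real \<Rightarrow> 'a"
    by (rule continuous_on_subset[OF continuous_on_line_int[OF cP c that]]) simp
  have "parallelogram_int \<psi> a b e = integral {0..1} (\<lambda>u. integral {0..1} (\<lambda>v. ?A u v + ?B u v))"
    unfolding parallelogram_int_def line_int_def * ..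
  also have "\<dots> = integral {0..1} (\<lambda>u. integral {0..1} (?A u) + integral {0..1} (?B u))"
    by (intro integral_cong integral_add integrable_continuous_interval cA1 cB1)
  also have "\<dots> = integral {0..1} (\<lambda>u. integral {0..1} (?A u)) + integral {0..1} (\<lambda>u. integral {0..1} (?B u))"
    by (intro integral_add integrable_continuous_interval
        continuous_on_subset[OF continuous_on_integral_unit[OF cA]] continuous_on_subset[OF continuous_on_integral_unit[OF cB]]) auto
  also have "integral {0..1} (\<lambda>u. integral {0..1} (?A u)) = integral {0..1} (\<lambda>v. integral {0..1} (\<lambda>u. ?A u v))"
    using integral_swap_continuous[of 0 0 1 1 ?A] cA by (simp add: split_beta cbox_interval)
  also have "(\<lambda>v. integral {0..1} (\<lambda>u. ?A u v)) = (\<lambda>v. (1 + s) * ?P ((norm (e + a + v *\<^sub>R b))\<^sup>2) - s * ?P ((norm (e + v *\<^sub>R b))\<^sup>2))"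
  proof
    fix v
    have "?X u v = e + v *\<^sub>R b + u *\<^sub>R a" for u by (simp add: algebra_simps)
    then show "integral {0..1} (\<lambda>u. ?A u v) = (1 + s) * ?P ((norm (e + a + v *\<^sub>R b))\<^sup>2) - s * ?P ((norm (e + v *\<^sub>R b))\<^sup>2)"
      using line_divergence[OF C2 c, of "e + v *\<^sub>R b" a s] by (simp add: ac_simps)
  qed
  also have "integral {0..1} \<dots> = (1 + s) * line_int ?P b (e + a) - s * line_int ?P b e"
    unfolding line_int_def
    by (subst integral_diff) (auto intro!: integrable_continuous_interval continuous_intros continuous_on_sq_norm[OF cP c])
  also have "(\<lambda>u. integral {0..1} (?B u)) = (\<lambda>u. (1 + t) * ?P ((norm (e + b + u *\<^sub>R a))\<^sup>2) - t * ?P ((norm (e + u *\<^sub>R a))\<^sup>2))"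
    using line_divergence[OF C2 c, of "e + u *\<^sub>R a" b t for u] by (simp add: ac_simps)
  also have "integral {0..1} \<dots> = (1 + t) * line_int ?P a (e + b) - t * line_int ?P a e"
    unfolding line_int_def
    by (subst integral_diff) (auto intro!: integrable_continuous_interval continuous_intros continuous_on_sq_norm[OF cP c])
  finally show ?thesis by simp
qed

text \<open>Here \<open>3 = 2 + 1\<close>: the part \<open>?A\<close> with two copies of the mean
  belongs to the triangle and produces the lateral parallelograms; \<open>?B\<close> with one copy
  belongs to the segment and produces the two end triangles.\<close>

lemma prism_int_radial:
  fixes a b d e :: "'a::real_inner"
  assumes e: "e = s *\<^sub>R a + t *\<^sub>R b + r *\<^sub>R d"
  shows "prism_int \<psi> a b d e
    = (1 + s + t) * parallelogram_int (radial_mean 3 \<psi>) d (b - a) (e + a)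
    - s * parallelogram_int (radial_mean 3 \<psi>) d b e - t * parallelogram_int (radial_mean 3 \<psi>) d a e
    + (1 + r) * simplex_int (radial_mean 3 \<psi>) a b (e + d) - r * simplex_int (radial_mean 3 \<psi>) a b e"
proof -
  let ?X = "\<lambda>u v w. e + u *\<^sub>R a + v *\<^sub>R b + w *\<^sub>R d" and ?P = "radial_mean 3 \<psi>" and ?P' = "radial_mean (3 + 2) \<psi>'"
  have C3: "C1_above c ?P ?P'" by (rule C1_above_radial_mean[OF C c]) simp
  note cP = C1_above_continuous[OF C3]
  have cP': "continuous_on {-c<..} ?P'" using C3 by (simp add: C1_above_def)
  let ?A = "\<lambda>u v w. 2 * ?P ((norm (?X u v w))\<^sup>2) + (u + s) * (2 * (a \<bullet> ?X u v w) * ?P' ((norm (?X u v w))\<^sup>2))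
      + (v + t) * (2 * (b \<bullet> ?X u v w) * ?P' ((norm (?X u v w))\<^sup>2))"
  let ?B = "\<lambda>u v w. ?P ((norm (?X u v w))\<^sup>2) + (w + r) * (2 * (d \<bullet> ?X u v w) * ?P' ((norm (?X u v w))\<^sup>2))"
  have *: "\<psi> ((norm (?X u v w))\<^sup>2) = ?A u v w + ?B u v w" for u v w
  proof -
    have "?X u v w = (u + s) *\<^sub>R a + (v + t) *\<^sub>R b + (w + r) *\<^sub>R d" by (simp add: e algebra_simps)
    from radial_mean_split3[OF _ this, of 3] show ?thesis by simp
  qed
  have cA: "continuous_on UNIV (\<lambda>q. ?A (fst (fst q)) (snd (fst q)) (snd q))"
    and cB: "continuous_on UNIV (\<lambda>q. ?B (fst (fst q)) (snd (fst q)) (snd q))"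
    by (intro continuous_intros continuous_on_sq_norm[OF cP c] continuous_on_sq_norm[OF cP' c])+
  have cA1: "continuous_on S (?A u v)" and cB1: "continuous_on S (?B u v)" for u v S
    by (intro continuous_intros continuous_on_sq_norm[OF cP c] continuous_on_sq_norm[OF cP' c])+
  have int: "(\<lambda>w. k * line_int ?P y (f + w *\<^sub>R d)) integrable_on {0..1}" for k y f
    by (rule integrable_continuous_interval, rule continuous_on_subset[OF _ subset_UNIV],
        intro continuous_intros continuous_on_line_int[OF cP c])
  have "prism_int \<psi> a b d e = tri_int (\<lambda>u v. integral {0..1} (\<lambda>w. ?A u v w + ?B u v w))"
    unfolding prism_int_def line_int_def * ..
  also have "\<dots> = tri_int (\<lambda>u v. integral {0..1} (?A u v) + integral {0..1} (?B u v))"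
    by (intro tri_int_cong integral_add integrable_continuous_interval cA1 cB1)
  also have "\<dots> = tri_int (\<lambda>u v. integral {0..1} (?A u v)) + tri_int (\<lambda>u v. integral {0..1} (?B u v))"
    by (intro tri_int_add continuous_on_integral_unit cA cB)
  \<comment> \<open>Fubini brings the triangle variables inside, where
    \<open>simplex_divergence\<close> applies for each fixed \<open>w\<close>.\<close>
  also have "tri_int (\<lambda>u v. integral {0..1} (?A u v)) = integral {0..1} (\<lambda>w. tri_int (\<lambda>u v. ?A u v w))"
    by (rule tri_int_integral_swap) (rule cA)
  also have "(\<lambda>w. tri_int (\<lambda>u v. ?A u v w)) = (\<lambda>w. (1 + s + t) * line_int ?P (b - a) (e + a + w *\<^sub>R d)
      - s * line_int ?P b (e + w *\<^sub>R d) - t * line_int ?P a (e + w *\<^sub>R d))"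
  proof
    fix w
    have X: "?X u v w = e + w *\<^sub>R d + u *\<^sub>R a + v *\<^sub>R b" for u v by (simp add: algebra_simps)
    have A: "(\<lambda>u v. ?A u v w) = (\<lambda>u v. (\<lambda>x. 2 * ?P ((norm x)\<^sup>2) + (u + s) * (2 * (a \<bullet> x) * ?P' ((norm x)\<^sup>2))
      + (v + t) * (2 * (b \<bullet> x) * ?P' ((norm x)\<^sup>2))) (e + w *\<^sub>R d + u *\<^sub>R a + v *\<^sub>R b))"
      by (intro ext arg_cong[where f = "\<lambda>x. 2 * ?P ((norm x)\<^sup>2) + (u + s) * (2 * (a \<bullet> x) * ?P' ((norm x)\<^sup>2))
      + (v + t) * (2 * (b \<bullet> x) * ?P' ((norm x)\<^sup>2))" for u v] X)
    have "e + a + w *\<^sub>R d = e + w *\<^sub>R d + a" by (simp add: algebra_simps)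
    then show "tri_int (\<lambda>u v. ?A u v w) = (1 + s + t) * line_int ?P (b - a) (e + a + w *\<^sub>R d)
      - s * line_int ?P b (e + w *\<^sub>R d) - t * line_int ?P a (e + w *\<^sub>R d)"
      by (simp only: A simplex_divergence[OF C3 c, of "e + w *\<^sub>R d" a b s t])
  qed
  also have "integral {0..1} \<dots> = (1 + s + t) * parallelogram_int ?P d (b - a) (e + a)
      - s * parallelogram_int ?P d b e - t * parallelogram_int ?P d a e"
    unfolding parallelogram_int_def integral_mult_right[symmetric]
    by (subst integral_diff[OF integrable_diff[OF int int] int], subst integral_diff[OF int int]) (rule refl)
  also have "(\<lambda>u v. integral {0..1} (?B u v)) = (\<lambda>u v. (1 + r) * ?P ((norm (e + d + u *\<^sub>R a + v *\<^sub>R b))\<^sup>2)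
      + (- r) * ?P ((norm (e + u *\<^sub>R a + v *\<^sub>R b))\<^sup>2))"
  proof (intro ext)
    fix u v
    have "e + d + u *\<^sub>R a + v *\<^sub>R b = e + u *\<^sub>R a + v *\<^sub>R b + d" by (simp add: algebra_simps)
    then show "integral {0..1} (?B u v) = (1 + r) * ?P ((norm (e + d + u *\<^sub>R a + v *\<^sub>R b))\<^sup>2)
      + (- r) * ?P ((norm (e + u *\<^sub>R a + v *\<^sub>R b))\<^sup>2)"
      using line_divergence[OF C3 c, of "e + u *\<^sub>R a + v *\<^sub>R b" d r] by (simp add: ac_simps)
  qed
  also have "tri_int \<dots> = (1 + r) * simplex_int ?P a b (e + d) + (- r) * simplex_int ?P a b e"
    unfolding simplex_int_def
    by (subst tri_int_add; (intro continuous_intros continuous_on_sq_norm[OF cP c])?) (simp only: tri_int_cmult)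
  finally show ?thesis by simp
qed

text \<open>Here \<open>4 = 2 + 2\<close>: each triangle takes two copies of the mean, and its
  divergence formula leaves its edges times the other triangle, which are prisms.\<close>

lemma duoprism_int_radial:
  fixes a1 a2 a3 a4 e :: "'a::real_inner"
  assumes e: "e = s1 *\<^sub>R a1 + s2 *\<^sub>R a2 + s3 *\<^sub>R a3 + s4 *\<^sub>R a4"
  shows "duoprism_int \<psi> a1 a2 a3 a4 e
    = - s4 * prism_int (radial_mean 4 \<psi>) a1 a2 a3 e
    + (1 + s3 + s4) * prism_int (radial_mean 4 \<psi>) a1 a2 (a4 - a3) (e + a3)
    - s3 * prism_int (radial_mean 4 \<psi>) a1 a2 a4 e
    - s2 * prism_int (radial_mean 4 \<psi>) a3 a4 a1 e
    + (1 + s1 + s2) * prism_int (radial_mean 4 \<psi>) a3 a4 (a2 - a1) (e + a1)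
    - s1 * prism_int (radial_mean 4 \<psi>) a3 a4 a2 e"
proof -
  let ?X = "\<lambda>u v w z. e + u *\<^sub>R a1 + v *\<^sub>R a2 + w *\<^sub>R a3 + z *\<^sub>R a4" and ?P = "radial_mean 4 \<psi>" and ?P' = "radial_mean (4 + 2) \<psi>'"
  have C4: "C1_above c ?P ?P'" by (rule C1_above_radial_mean[OF C c]) simp
  note cP = C1_above_continuous[OF C4]
  have cP': "continuous_on {-c<..} ?P'" using C4 by (simp add: C1_above_def)
  let ?A = "\<lambda>u v w z. 2 * ?P ((norm (?X u v w z))\<^sup>2) + (u + s1) * (2 * (a1 \<bullet> ?X u v w z) * ?P' ((norm (?X u v w z))\<^sup>2))
      + (v + s2) * (2 * (a2 \<bullet> ?X u v w z) * ?P' ((norm (?X u v w z))\<^sup>2))"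
  let ?B = "\<lambda>u v w z. 2 * ?P ((norm (?X u v w z))\<^sup>2) + (w + s3) * (2 * (a3 \<bullet> ?X u v w z) * ?P' ((norm (?X u v w z))\<^sup>2))
      + (z + s4) * (2 * (a4 \<bullet> ?X u v w z) * ?P' ((norm (?X u v w z))\<^sup>2))"
  have *: "\<psi> ((norm (?X u v w z))\<^sup>2) = ?A u v w z + ?B u v w z" for u v w z
  proof -
    have "?X u v w z = (u + s1) *\<^sub>R a1 + (v + s2) *\<^sub>R a2 + (w + s3) *\<^sub>R a3 + (z + s4) *\<^sub>R a4" by (simp add: e algebra_simps)
    from radial_mean_split4[OF _ this, of 4] show ?thesis by simp
  qed
  have cA: "continuous_on UNIV (\<lambda>q. ?A (fst (fst q)) (snd (fst q)) (fst (snd q)) (snd (snd q)))"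
    and cB: "continuous_on UNIV (\<lambda>q. ?B (fst (fst q)) (snd (fst q)) (fst (snd q)) (snd (snd q)))"
    by (intro continuous_intros continuous_on_sq_norm[OF cP c] continuous_on_sq_norm[OF cP' c])+
  have cA1: "continuous_on UNIV (\<lambda>p. ?A u v (fst p) (snd p))" and cB1: "continuous_on UNIV (\<lambda>p. ?B u v (fst p) (snd p))" for u v
    by (intro continuous_intros continuous_on_sq_norm[OF cP c] continuous_on_sq_norm[OF cP' c])+
  \<comment> \<open>Both halves end in this shape, edge integrals accumulated over the other
    triangle.\<close>
  have face: "tri_int (\<lambda>u v. (1 + s + t) * line_int ?P (q - p) (f + p + u *\<^sub>R b + v *\<^sub>R d)
      - s * line_int ?P q (f + u *\<^sub>R b + v *\<^sub>R d) - t * line_int ?P p (f + u *\<^sub>R b + v *\<^sub>R d))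
    = (1 + s + t) * prism_int ?P b d (q - p) (f + p) - s * prism_int ?P b d q f - t * prism_int ?P b d p f"
    for s t and p q b d f :: 'a
  proof -
    have "tri_int (\<lambda>u v. (1 + s + t) * line_int ?P (q - p) (f + p + u *\<^sub>R b + v *\<^sub>R d)
      + (- s) * line_int ?P q (f + u *\<^sub>R b + v *\<^sub>R d) + (- t) * line_int ?P p (f + u *\<^sub>R b + v *\<^sub>R d))
      = (1 + s + t) * prism_int ?P b d (q - p) (f + p) + (- s) * prism_int ?P b d q f + (- t) * prism_int ?P b d p f"
      unfolding prism_int_def
      by (subst tri_int_add; (intro continuous_intros continuous_on_line_int[OF cP c])?)+ (simp only: tri_int_cmult)
    then show ?thesis by simp
  qed
  have "duoprism_int \<psi> a1 a2 a3 a4 e = tri_int (\<lambda>u v. tri_int (\<lambda>w z. ?A u v w z + ?B u v w z))"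
    unfolding duoprism_int_def simplex_int_def * ..
  also have "\<dots> = tri_int (\<lambda>u v. tri_int (?A u v) + tri_int (?B u v))"
    by (intro tri_int_cong tri_int_add cA1 cB1)
  also have "\<dots> = tri_int (\<lambda>u v. tri_int (?A u v)) + tri_int (\<lambda>u v. tri_int (?B u v))"
    by (intro tri_int_add continuous_on_tri_int cA cB)
  also have "tri_int (\<lambda>u v. tri_int (?A u v)) = tri_int (\<lambda>w z. tri_int (\<lambda>u v. ?A u v w z))"
    by (rule tri_int_swap) (rule cA)
  also have "(\<lambda>w z. tri_int (\<lambda>u v. ?A u v w z)) = (\<lambda>w z. (1 + s1 + s2) * line_int ?P (a2 - a1) (e + a1 + w *\<^sub>R a3 + z *\<^sub>R a4)
      - s1 * line_int ?P a2 (e + w *\<^sub>R a3 + z *\<^sub>R a4) - s2 * line_int ?P a1 (e + w *\<^sub>R a3 + z *\<^sub>R a4))"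
  proof (intro ext)
    fix w z
    have X: "?X u v w z = e + w *\<^sub>R a3 + z *\<^sub>R a4 + u *\<^sub>R a1 + v *\<^sub>R a2" for u v by (simp add: algebra_simps)
    have A: "(\<lambda>u v. ?A u v w z) = (\<lambda>u v. (\<lambda>x. 2 * ?P ((norm x)\<^sup>2) + (u + s1) * (2 * (a1 \<bullet> x) * ?P' ((norm x)\<^sup>2))
      + (v + s2) * (2 * (a2 \<bullet> x) * ?P' ((norm x)\<^sup>2))) (e + w *\<^sub>R a3 + z *\<^sub>R a4 + u *\<^sub>R a1 + v *\<^sub>R a2))"
      by (intro ext arg_cong[where f = "\<lambda>x. 2 * ?P ((norm x)\<^sup>2) + (u + s1) * (2 * (a1 \<bullet> x) * ?P' ((norm x)\<^sup>2))
      + (v + s2) * (2 * (a2 \<bullet> x) * ?P' ((norm x)\<^sup>2))" for u v] X)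
    have "e + a1 + w *\<^sub>R a3 + z *\<^sub>R a4 = e + w *\<^sub>R a3 + z *\<^sub>R a4 + a1" by (simp add: algebra_simps)
    then show "tri_int (\<lambda>u v. ?A u v w z) = (1 + s1 + s2) * line_int ?P (a2 - a1) (e + a1 + w *\<^sub>R a3 + z *\<^sub>R a4)
      - s1 * line_int ?P a2 (e + w *\<^sub>R a3 + z *\<^sub>R a4) - s2 * line_int ?P a1 (e + w *\<^sub>R a3 + z *\<^sub>R a4)"
      by (simp only: A simplex_divergence[OF C4 c, of "e + w *\<^sub>R a3 + z *\<^sub>R a4" a1 a2 s1 s2])
  qed
  also have "tri_int \<dots> = (1 + s1 + s2) * prism_int ?P a3 a4 (a2 - a1) (e + a1) - s1 * prism_int ?P a3 a4 a2 e - s2 * prism_int ?P a3 a4 a1 e"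
    by (rule face)
  also have "(\<lambda>u v. tri_int (?B u v)) = (\<lambda>u v. (1 + s3 + s4) * line_int ?P (a4 - a3) (e + a3 + u *\<^sub>R a1 + v *\<^sub>R a2)
      - s3 * line_int ?P a4 (e + u *\<^sub>R a1 + v *\<^sub>R a2) - s4 * line_int ?P a3 (e + u *\<^sub>R a1 + v *\<^sub>R a2))"
  proof (intro ext)
    fix u v
    have "e + a3 + u *\<^sub>R a1 + v *\<^sub>R a2 = e + u *\<^sub>R a1 + v *\<^sub>R a2 + a3" by (simp add: algebra_simps)
    then show "tri_int (?B u v) = (1 + s3 + s4) * line_int ?P (a4 - a3) (e + a3 + u *\<^sub>R a1 + v *\<^sub>R a2)
      - s3 * line_int ?P a4 (e + u *\<^sub>R a1 + v *\<^sub>R a2) - s4 * line_int ?P a3 (e + u *\<^sub>R a1 + v *\<^sub>R a2)"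
      by (simp only: simplex_divergence[OF C4 c, of "e + u *\<^sub>R a1 + v *\<^sub>R a2" a3 a4 s3 s4])
  qed
  also have "tri_int \<dots> = (1 + s3 + s4) * prism_int ?P a1 a2 (a4 - a3) (e + a3) - s3 * prism_int ?P a1 a2 a4 e - s4 * prism_int ?P a1 a2 a3 e"
    by (rule face)
  finally show ?thesis by simp
qed

end

section \<open>The recursion as iterated radial means\<close>

lemma h_perp_nonneg: "h_perp as e \<ge> 0"
  by (simp add: h_perp_def)

lemma h_perp_eq_0_iff: "h_perp as e = 0 \<longleftrightarrow> e \<in> span (set as)"
proof
  assume "h_perp as e = 0"
  then have "e = e_par as e" by (simp add: h_perp_def)
  then show "e \<in> span (set as)" using e_par(1)[of as e] by metis
next
  assume "e \<in> span (set as)"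
  then have "e_par as e = e" by (intro e_par_unique) (auto simp: orthogonal_def)
  then show "h_perp as e = 0" by (simp add: h_perp_def)
qed

lemma e_par_eq: "e \<in> span (set as) \<Longrightarrow> e_par as e = e"
  by (rule e_par_unique) (auto simp: orthogonal_def)

lemma norm_e_par_add:
  assumes "w \<in> span (set as)"
  shows "(norm (e + w))\<^sup>2 = (norm (e_par as e + w))\<^sup>2 + (h_perp as e)\<^sup>2"
proof -
  have "orthogonal (e_par as e + w) (e - e_par as e)"
    using e_par(2)[of as e] span_add[OF e_par(1)[of as e] assms] orthogonal_commute by blast
  from norm_add_Pythagorean[OF this] show ?thesis by (simp add: h_perp_def algebra_simps)
qed

text \<open>Only segments, parallelograms and the full product get such a projection formula: the
  prisms and triangles of the recursion start from a point that already lies in their span.\<close>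

lemma line_int_e_par: "line_int \<psi> a e = line_int (\<lambda>x. \<psi> (x + (h_perp [a] e)\<^sup>2)) a (e_par [a] e)"
proof -
  have "t *\<^sub>R a \<in> span (set [a])" for t by (simp add: span_base span_scale)
  then show ?thesis unfolding line_int_def using norm_e_par_add[of _ "[a]" e] by simp
qed

lemma parallelogram_int_e_par:
  "parallelogram_int \<psi> a b e = parallelogram_int (\<lambda>x. \<psi> (x + (h_perp [a, b] e)\<^sup>2)) a b (e_par [a, b] e)"
proof -
  have "u *\<^sub>R a + t *\<^sub>R b \<in> span (set [a, b])" for u t by (simp add: span_base span_scale span_add)
  from norm_e_par_add[OF this, of e] show ?thesis
    unfolding parallelogram_int_def line_int_def by (simp add: add.assoc)
qed

lemma duoprism_int_e_par:
  "duoprism_int \<psi> a b c d e = duoprism_int (\<lambda>x. \<psi> (x + (h_perp [a, b, c, d] e)\<^sup>2)) a b c d (e_par [a, b, c, d] e)"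
proof -
  have "u *\<^sub>R a + (t *\<^sub>R b + (w *\<^sub>R c + z *\<^sub>R d)) \<in> span (set [a, b, c, d])" for u t w z
    by (intro span_add span_scale span_base) auto
  from norm_e_par_add[OF this, of e] show ?thesis
    unfolding duoprism_int_def simplex_int_def by (simp add: add.assoc)
qed

lemma coefficient_choiceD:
  assumes "coefficient_choice s"
  shows "e_par [a] e = s [a] e 1 *\<^sub>R a"
    and "e_par [a, b] e = s [a, b] e 1 *\<^sub>R a + s [a, b] e 2 *\<^sub>R b"
    and "e_par [a, b, c] e = s [a, b, c] e 1 *\<^sub>R a + s [a, b, c] e 2 *\<^sub>R b + s [a, b, c] e 3 *\<^sub>R c"
    and "e_par [a, b, c, d] e = s [a, b, c, d] e 1 *\<^sub>R a + s [a, b, c, d] e 2 *\<^sub>R b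
      + s [a, b, c, d] e 3 *\<^sub>R c + s [a, b, c, d] e 4 *\<^sub>R d"
  using assms by (simp_all add: coefficient_choice_def numeral_eq_Suc)

text \<open>A dimension count: two independent vectors fill a space of dimension at most
  two.\<close>

lemma span_insert_subset_2dim:
  fixes a b x y :: "'a::euclidean_space"
  assumes "x \<in> span {a, b}" "y \<in> span {a, b}" "x \<notin> span {y}" "y \<noteq> 0"
  shows "span {a, b} \<subseteq> span {x, y}"
proof (rule card_ge_dim_independent)
  show "independent {x, y}" using assms by (simp add: independent_insert)
  have "dim (span {a, b}) \<le> card {a, b}" by (rule dim_le_card) auto
  also have "\<dots> \<le> 2" by (simp add: card_insert_if)
  also have "x \<noteq> y" using assms(3) span_base[of y "{y}"] by auto
  then have "2 = card {x, y}" by simp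
  finally show "dim (span {a, b}) \<le> card {x, y}" .
qed (use assms in auto)

lemma in_span_singleton_sym:
  assumes "a \<in> span {b}" "a \<noteq> 0"
  shows "b \<in> span {a}"
proof -
  obtain k where k: "a = k *\<^sub>R b" using assms(1) by (auto simp: span_singleton)
  then have "b = (1 / k) *\<^sub>R a" using assms(2) by auto
  then show ?thesis by (metis span_base span_scale singletonI)
qed

lemma scaleR_in_span_iff: "k *\<^sub>R a \<in> span S \<longleftrightarrow> k = 0 \<or> a \<in> span S"
  using span_scale[of "k *\<^sub>R a" S "1 / k"] by (auto simp: span_scale span_zero split: if_splits)

context
  fixes F :: terminal and s :: choice and h4 c :: real and \<psi> \<psi>' :: "real \<Rightarrow> real"
  assumes s: "coefficient_choice s"
    and C: "C1_above c \<psi> \<psi>'" and c: "0 < c"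
    and F: "\<And>h1 h2 P. \<lbrakk>h1 \<ge> 0; h2 \<ge> 0; P > 0; h1 > 0 \<and> h2 = 0 \<or> h1 = 0 \<and> h2 > 0\<rbrakk> \<Longrightarrow>
      F h1 h2 0 h4 P = radial_mean 1 (\<lambda>x. radial_mean 2 (\<lambda>x. radial_mean 3 \<psi> (x + h2\<^sup>2)) (x + h1\<^sup>2)) (P\<^sup>2)"
begin

section \<open>The recursion for vectors in a plane\<close>

lemma C1_above_mean3: "C1_above c (radial_mean 3 \<psi>) (radial_mean (3 + 2) \<psi>')"
  by (rule C1_above_radial_mean[OF C c]) simp

lemma C1_above_mean2: "C1_above c (radial_mean 2 (\<lambda>x. radial_mean 3 \<psi> (x + h\<^sup>2))) (radial_mean (2 + 2) (\<lambda>x. radial_mean (3 + 2) \<psi>' (x + h\<^sup>2)))"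
  by (rule C1_above_radial_mean[OF C1_above_shift[OF C1_above_mean3] c]) simp

text \<open>The hypothesis \<open>h\<close> says that exactly one of \<open>h1\<close>,
  \<open>h2\<close> vanishes, because \<open>h1 = 0\<close> means that \<open>e\<close> lies on the
  line of \<open>a\<close>.\<close>

lemma rec_I1_eq:
  assumes a: "a \<noteq> 0" and h2: "h2 \<ge> 0" and h: "e \<in> span {a} \<longleftrightarrow> h2 \<noteq> 0"
  shows "rec_I1 F s h2 0 h4 a e = line_int (radial_mean 2 (\<lambda>x. radial_mean 3 \<psi> (x + h2\<^sup>2))) a e"
proof -
  define h1 where "h1 = h_perp [a] e"
  have h1: "h1 \<ge> 0" "h1 = 0 \<longleftrightarrow> e \<in> span {a}" using h_perp_nonneg h_perp_eq_0_iff[of "[a]" e] by (auto simp: h1_def)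
  \<comment> \<open>For \<open>k = 0\<close> the length is 0, where nothing is known about the
    terminal function, but both products are 0.\<close>
  have t: "k * F h1 h2 0 h4 (\<bar>k\<bar> * norm a)
     = k * radial_mean 1 (\<lambda>x. radial_mean 2 (\<lambda>x. radial_mean 3 \<psi> (x + h2\<^sup>2)) (x + h1\<^sup>2)) ((\<bar>k\<bar> * norm a)\<^sup>2)" for k
  proof (cases "k = 0")
    case False
    then show ?thesis using F[of h1 h2 "\<bar>k\<bar> * norm a"] h1 h2 h a by auto
  qed simp
  have "line_int (radial_mean 2 (\<lambda>x. radial_mean 3 \<psi> (x + h2\<^sup>2))) a e =
    line_int (\<lambda>x. radial_mean 2 (\<lambda>x. radial_mean 3 \<psi> (x + h2\<^sup>2)) (x + h1\<^sup>2)) a (s [a] e 1 *\<^sub>R a)"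
    unfolding line_int_e_par[of _ a e] h1_def coefficient_choiceD[OF s] ..
  also have "\<dots> = rec_I1 F s h2 0 h4 a e"
    unfolding line_int_radial[OF C1_above_shift[OF C1_above_mean2] c] rec_I1_def Let_def h1_def[symmetric] t ..
  finally show ?thesis ..
qed

text \<open>The hypothesis \<open>h\<close> allows two situations: independent sides with
  \<open>h2 = 0\<close>, or parallel sides with \<open>e\<close> off their line, so
  \<open>h2 \<noteq> 0\<close>. For a nonzero coefficient \<open>k\<close> the point
  \<open>k *\<^sub>R a + l *\<^sub>R b\<close> is on the line of \<open>b\<close> exactly in the
  second situation, which is what \<open>rec_I1_eq\<close> asks for.\<close>

lemma rec_Q_eq:
  assumes a: "a \<noteq> 0" "b \<noteq> 0" and h: "e \<in> span {a, b} \<longleftrightarrow> a \<notin> span {b}"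
  shows "rec_Q F s 0 h4 a b e = parallelogram_int (radial_mean 3 \<psi>) a b e"
proof -
  define h2 where "h2 = h_perp [a, b] e"
  define p where "p = e_par [a, b] e"
  define s1 s2 where "s1 = s [a, b] e 1" and "s2 = s [a, b] e 2"
  have h2: "h2 \<ge> 0" "h2 \<noteq> 0 \<longleftrightarrow> a \<in> span {b}" using h_perp_nonneg h_perp_eq_0_iff[of "[a, b]" e] h by (auto simp: h2_def)
  have p: "p = s1 *\<^sub>R a + s2 *\<^sub>R b" unfolding p_def s1_def s2_def by (rule coefficient_choiceD[OF s])
  have ab: "b \<in> span {a} \<longleftrightarrow> a \<in> span {b}" using in_span_singleton_sym a by blast
  have sa: "x + k *\<^sub>R b \<in> span {b} \<longleftrightarrow> x \<in> span {b}" "k *\<^sub>R b + x \<in> span {b} \<longleftrightarrow> x \<in> span {b}"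
    "x + k *\<^sub>R a \<in> span {a} \<longleftrightarrow> x \<in> span {a}" "k *\<^sub>R a + x \<in> span {a} \<longleftrightarrow> x \<in> span {a}" for x k
    by (auto simp: span_add_eq span_add_eq2 span_base span_scale)
  let ?L = "line_int (radial_mean 2 (\<lambda>x. radial_mean 3 \<psi> (x + h2\<^sup>2)))"
  have t: "k * rec_I1 F s h2 0 h4 b q = k * ?L b q" if "q = k *\<^sub>R a + l *\<^sub>R b" for k l q
  proof (cases "k = 0")
    case False
    then show ?thesis using rec_I1_eq[OF a(2) h2(1), of q] h2(2) by (simp add: that sa scaleR_in_span_iff)
  qed simp
  have t': "k * rec_I1 F s h2 0 h4 a q = k * ?L a q" if "q = l *\<^sub>R a + k *\<^sub>R b" for k l q
  proof (cases "k = 0")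
    case False
    then show ?thesis using rec_I1_eq[OF a(1) h2(1), of q] h2(2) ab by (simp add: that sa scaleR_in_span_iff)
  qed simp
  have "parallelogram_int (radial_mean 3 \<psi>) a b e = parallelogram_int (\<lambda>x. radial_mean 3 \<psi> (x + h2\<^sup>2)) a b p"
    unfolding parallelogram_int_e_par[of _ a b e] h2_def p_def ..
  also have "\<dots> = (1 + s1) * ?L b (p + a) - s1 * ?L b p + (1 + s2) * ?L a (p + b) - s2 * ?L a p"
    by (rule parallelogram_int_radial[OF C1_above_shift[OF C1_above_mean3] c p])
  also have "s1 * ?L b p = s1 * rec_I1 F s h2 0 h4 b p" by (rule t[symmetric, OF p])
  also have "s2 * ?L a p = s2 * rec_I1 F s h2 0 h4 a p" by (rule t'[symmetric, OF p])
  also have "(1 + s1) * ?L b (p + a) = (1 + s1) * rec_I1 F s h2 0 h4 b (p + a)"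
    by (rule t[symmetric, of _ _ s2]) (simp add: p algebra_simps)
  also have "(1 + s2) * ?L a (p + b) = (1 + s2) * rec_I1 F s h2 0 h4 a (p + b)"
    by (rule t'[symmetric, of _ s1]) (simp add: p algebra_simps)
  finally show ?thesis unfolding rec_Q_def Let_def s1_def s2_def p_def h2_def ..
qed

text \<open>The sides are independent and \<open>e\<close> is in their plane, so
  \<open>h2 = 0\<close>. A nonzero coefficient of an edge says that the point is off the line
  through 0 in the direction of that edge, so \<open>h1 > 0\<close>.\<close>

lemma rec_T_eq:
  assumes a: "a \<notin> span {b}" "b \<noteq> 0" and h: "e \<in> span {a, b}"
  shows "rec_T F s 0 h4 a b e = simplex_int (radial_mean 3 \<psi>) a b e"
proof -
  define p where "p = e_par [a, b] e"
  define s1 s2 where "s1 = s [a, b] e 1" and "s2 = s [a, b] e 2"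
  have h2: "h_perp [a, b] e = 0" using h_perp_eq_0_iff[of "[a, b]" e] h by auto
  have pe: "p = e" unfolding p_def using h by (intro e_par_eq) simp
  have p: "p = s1 *\<^sub>R a + s2 *\<^sub>R b" unfolding p_def s1_def s2_def by (rule coefficient_choiceD[OF s])
  have a0: "a \<noteq> 0" using a by (auto simp: span_zero)
  have ba: "b \<notin> span {a}" using in_span_singleton_sym a by blast
  have bab: "b \<notin> span {a - b}" and ab0: "a - b \<noteq> 0"
  proof -
    show "a - b \<noteq> 0" using a by (auto simp: span_base)
    show "b \<notin> span {a - b}"
    proof
      assume "b \<in> span {a - b}"
      then have "a - b \<in> span {b}" using a in_span_singleton_sym by blast
      from span_add[OF this span_base[of b]] show False using a(1) by simp
    qed
  qed
  let ?L = "line_int (radial_mean 2 (radial_mean 3 \<psi>))"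
  have t: "k * rec_I1 F s 0 0 h4 x q = k * ?L x q" if "q = k *\<^sub>R y + l *\<^sub>R x" "y \<notin> span {x}" "x \<noteq> 0" for k l q x y
  proof (cases "k = 0")
    case False
    have "k *\<^sub>R y + l *\<^sub>R x \<in> span {x} \<longleftrightarrow> k *\<^sub>R y \<in> span {x}" by (simp add: span_add_eq2 span_base span_scale)
    then show ?thesis using rec_I1_eq[OF that(3) order_refl, of q] False that by (simp add: scaleR_in_span_iff)
  qed simp
  have "simplex_int (radial_mean 3 \<psi>) a b e = - s1 * ?L b p - s2 * ?L a p + (1 + s1 + s2) * ?L (a - b) (p + b)"
    unfolding pe using simplex_int_radial[OF C1_above_mean3 c p] pe by simp
  also have "- s1 * ?L b p = - (s1 * rec_I1 F s 0 0 h4 b p)" using t[OF p a] by auto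
  also have "s2 * ?L a p = s2 * rec_I1 F s 0 0 h4 a p" using t[OF _ ba a0, of p s2 s1] p by (auto simp: add.commute)
  also have "(1 + s1 + s2) * ?L (a - b) (p + b) = (1 + s1 + s2) * rec_I1 F s 0 0 h4 (a - b) (p + b)"
    by (rule t[symmetric, OF _ bab ab0, of _ _ s1]) (simp add: p algebra_simps)
  finally show ?thesis unfolding rec_T_def Let_def s1_def s2_def p_def h2 by simp
qed

text \<open>Everything takes place in the plane of \<open>a\<close> and \<open>b\<close>, so
  \<open>h3 = 0\<close> and the projection does not move \<open>e\<close>. The work is to see that
  each parallelogram with nonzero coefficient meets the alternative required by
  \<open>rec_Q_eq\<close>.\<close>

lemma rec_I3_eq:
  assumes a: "a \<notin> span {b}" "b \<noteq> 0" and d: "d \<noteq> 0" "d \<in> span {a, b}" and e: "e \<in> span {a, b}"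
  shows "rec_I3 F s h4 a b d e = prism_int \<psi> a b d e"
proof -
  define s1 s2 s3 where "s1 = s [a, b, d] e 1" and "s2 = s [a, b, d] e 2" and "s3 = s [a, b, d] e 3"
  have "span {a, b} \<subseteq> span (set [a, b, d])" by (rule span_mono) auto
  then have e3: "e \<in> span (set [a, b, d])" using e by blast
  have h3: "h_perp [a, b, d] e = 0" using h_perp_eq_0_iff e3 by blast
  have pe: "e_par [a, b, d] e = e" by (rule e_par_eq[OF e3])
  have p: "e = s1 *\<^sub>R a + s2 *\<^sub>R b + s3 *\<^sub>R d"
    unfolding s1_def s2_def s3_def using coefficient_choiceD(3)[OF s, of a b d e] pe by simp
  have ba: "b \<notin> span {a}" using in_span_singleton_sym a by blast
  have W: "a \<in> span {a, b}" "b \<in> span {a, b}" by (auto intro: span_base)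
  let ?Q = "parallelogram_int (radial_mean 3 \<psi>)" and ?T = "simplex_int (radial_mean 3 \<psi>)"
  \<comment> \<open>If \<open>x\<close> and \<open>d\<close> are independent, they span the plane,
    which contains \<open>q\<close>. If \<open>x\<close> is parallel to \<open>d\<close> and
    \<open>q\<close> were on their line, then \<open>k *\<^sub>R y\<close> would be too, making
    \<open>y\<close> parallel to \<open>d\<close> and hence \<open>x\<close> parallel to
    \<open>y\<close>.\<close>
  have t: "k * rec_Q F s 0 h4 x d q = k * ?Q x d q"
    if q: "q = k *\<^sub>R y + l *\<^sub>R x + r *\<^sub>R d" and xy: "x \<notin> span {y}" "y \<noteq> 0" "x \<in> span {a, b}" "y \<in> span {a, b}" for k l r q x y
  proof (cases "k = 0")
    case False
    have x0: "x \<noteq> 0" using xy by (auto simp: span_zero)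
    have "q \<in> span {x, d} \<longleftrightarrow> x \<notin> span {d}"
    proof
      assume "x \<notin> span {d}"
      then have "span {a, b} \<subseteq> span {x, d}" using xy d by (intro span_insert_subset_2dim) auto
      moreover have "q \<in> span {a, b}" unfolding q using xy d by (intro span_add span_scale) auto
      ultimately show "q \<in> span {x, d}" by blast
    next
      assume *: "q \<in> span {x, d}"
      show "x \<notin> span {d}"
      proof
        assume x: "x \<in> span {d}"
        have "span {x, d} = span {d}" using x by (simp add: span_redundant)
        with * have "k *\<^sub>R y + l *\<^sub>R x + r *\<^sub>R d \<in> span {d}" using q by simp
        from span_diff[OF this, of "l *\<^sub>R x + r *\<^sub>R d"] have "k *\<^sub>R y \<in> span {d}"
          using x by (simp add: span_add span_scale span_base algebra_simps)
        then have "y \<in> span {d}" using False by (simp add: scaleR_in_span_iff)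
        then have "d \<in> span {y}" using in_span_singleton_sym xy by blast
        then have "span {d} \<subseteq> span {y}" by (simp add: span_minimal)
        then show False using x xy by blast
      qed
    qed
    then show ?thesis using rec_Q_eq[OF x0 d(1), of q] by simp
  qed simp
  have abb: "a - b \<notin> span {b}" using a(1) span_add_eq[of b "{b}" "a - b"] by (auto simp: span_base)
  have "prism_int \<psi> a b d e = (1 + s1 + s2) * ?Q d (b - a) (e + a) - s1 * ?Q d b e - s2 * ?Q d a e
      + (1 + s3) * ?T a b (e + d) - s3 * ?T a b e"
    by (rule prism_int_radial[OF C c p])
  also have "?Q d (b - a) (e + a) = ?Q d (a - b) (e + b)"
    unfolding parallelogram_int_def using line_int_reverse[OF C1_above_continuous[OF C1_above_mean3] c, of a b "e + t *\<^sub>R d" for t]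
    by (simp add: ac_simps)
  also have "\<dots> = ?Q (a - b) d (e + b)" by (rule parallelogram_int_swap[OF C1_above_mean3 c])
  also have "(1 + s1 + s2) * ?Q (a - b) d (e + b) = (1 + s1 + s2) * rec_Q F s 0 h4 (a - b) d (e + b)"
    using W by (intro t[symmetric, where y = b and l = s1 and r = s3] abb a span_diff) (subst p, simp add: algebra_simps)
  also have "s1 * ?Q d b e = s1 * rec_Q F s 0 h4 b d e"
    unfolding parallelogram_int_swap[OF C1_above_mean3 c, of d]
    using W a ba by (intro t[symmetric, where y = a and l = s2 and r = s3] p) (auto simp: span_zero)
  also have "s2 * ?Q d a e = s2 * rec_Q F s 0 h4 a d e"
    unfolding parallelogram_int_swap[OF C1_above_mean3 c, of d]
    using W a by (intro t[symmetric, where y = b and l = s1 and r = s3]) (auto simp: p)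
  also have "?T a b (e + d) = rec_T F s 0 h4 a b (e + d)"
    using a d e by (intro rec_T_eq[symmetric] span_add) auto
  also have "?T a b e = rec_T F s 0 h4 a b e"
    using a e by (intro rec_T_eq[symmetric]) auto
  finally show ?thesis unfolding rec_I3_def Let_def s1_def s2_def s3_def h3 pe by simp
qed

end

text \<open>The shift by \<open>h4\<^sup>2\<close> precedes the first radial mean, so regularity is
  required of the shifted kernel only; this admits a kernel singular at 0.\<close>

lemma rec_I4_eq:
  fixes F :: terminal and s :: choice and c :: real and \<psi> \<psi>' :: "real \<Rightarrow> real" and a1 a2 a3 a4 e :: "real^3"
  defines "h4 \<equiv> h_perp [a1, a2, a3, a4] e"
  assumes s: "coefficient_choice s" and C: "C1_above c (\<lambda>x. \<psi> (x + h4\<^sup>2)) \<psi>'" and c: "0 < c"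
    and F: "\<And>h1 h2 P. \<lbrakk>h1 \<ge> 0; h2 \<ge> 0; P > 0; h1 > 0 \<and> h2 = 0 \<or> h1 = 0 \<and> h2 > 0\<rbrakk> \<Longrightarrow>
      F h1 h2 0 h4 P = radial_mean 1 (\<lambda>x. radial_mean 2 (\<lambda>x. radial_mean 3 (radial_mean 4 (\<lambda>x. \<psi> (x + h4\<^sup>2))) (x + h2\<^sup>2)) (x + h1\<^sup>2)) (P\<^sup>2)"
    and a: "a1 \<notin> span {a2}" "a2 \<noteq> 0" "a3 \<notin> span {a4}" "a4 \<noteq> 0" "span {a3, a4} = span {a1, a2}"
  shows "rec_I4 F s a1 a2 a3 a4 e = duoprism_int \<psi> a1 a2 a3 a4 e"
proof -
  define s1 s2 s3 s4 where "s1 = s [a1, a2, a3, a4] e 1" and "s2 = s [a1, a2, a3, a4] e 2"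
    and "s3 = s [a1, a2, a3, a4] e 3" and "s4 = s [a1, a2, a3, a4] e 4"
  define p where "p = e_par [a1, a2, a3, a4] e"
  have p: "p = s1 *\<^sub>R a1 + s2 *\<^sub>R a2 + s3 *\<^sub>R a3 + s4 *\<^sub>R a4"
    unfolding p_def s1_def s2_def s3_def s4_def by (rule coefficient_choiceD(4)[OF s])
  have W: "a1 \<in> span {a1, a2}" "a2 \<in> span {a1, a2}" "a3 \<in> span {a1, a2}" "a4 \<in> span {a1, a2}"
    using span_base[of a3 "{a3, a4}"] span_base[of a4 "{a3, a4}"] unfolding a(5) by (auto intro: span_base)
  have pW: "p \<in> span {a1, a2}" unfolding p by (intro span_add span_scale W)
  have nz: "a1 \<noteq> 0" "a3 \<noteq> 0" "a4 - a3 \<noteq> 0" "a2 - a1 \<noteq> 0" using a by (auto simp: span_zero span_base)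
  have C4: "C1_above c (radial_mean 4 (\<lambda>x. \<psi> (x + h4\<^sup>2))) (radial_mean (4 + 2) \<psi>')"
    by (rule C1_above_radial_mean[OF C c]) simp
  have I3: "rec_I3 F s h4 a b d q = prism_int (radial_mean 4 (\<lambda>x. \<psi> (x + h4\<^sup>2))) a b d q"
    if "a \<notin> span {b}" "b \<noteq> 0" "d \<noteq> 0" "d \<in> span {a, b}" "q \<in> span {a, b}" for a b d q
    by (rule rec_I3_eq[OF s C4 c _ that]) (rule F)
  show ?thesis
    unfolding duoprism_int_e_par[of \<psi> a1 a2 a3 a4 e] h4_def[symmetric] p_def[symmetric]
      duoprism_int_radial[OF C c p]
      rec_I4_def Let_def s1_def[symmetric] s2_def[symmetric] s3_def[symmetric] s4_def[symmetric]
    using a nz W pW by (simp add: I3 span_add span_diff)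
qed

section \<open>Closed forms of the terminal functions\<close>

text \<open>Substitute \<open>r = t * \<rho>\<close>. At 0 only continuity of the primitive is asked
  for, since some primitives below involve quotients that merely extend continuously there.\<close>

lemma radial_mean_closed_form:
  assumes \<rho>: "0 < \<rho>" and d: "d \<ge> 1" and cont: "continuous_on {0..\<rho>} A"
    and der: "\<And>r. 0 < r \<Longrightarrow> (A has_real_derivative r ^ (d - 1) * \<phi> (r\<^sup>2)) (at r)"
  shows "radial_mean d \<phi> (\<rho>\<^sup>2) = (A \<rho> - A 0) / \<rho> ^ d"
proof -
  have "((\<lambda>t. t ^ (d - 1) * \<phi> (t\<^sup>2 * \<rho>\<^sup>2)) has_integral A (1 * \<rho>) / \<rho> ^ d - A (0 * \<rho>) / \<rho> ^ d) {0..1}"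
  proof (rule fundamental_theorem_of_calculus_interior)
    show "continuous_on {0..1} (\<lambda>t. A (t * \<rho>) / \<rho> ^ d)"
      using \<rho> by (intro continuous_intros continuous_on_compose2[OF cont]) (auto simp: mult_left_le_one_le)
    fix t :: real assume t: "t \<in> {0<..<1}"
    have \<rho>d: "\<rho> ^ d = \<rho> * \<rho> ^ (d - 1)" using d by (cases d) auto
    have "(A has_real_derivative (t * \<rho>) ^ (d - 1) * \<phi> ((t * \<rho>)\<^sup>2)) (at (t * \<rho>))"
      using t \<rho> by (intro der) auto
    from DERIV_chain2[where f = A and g = "\<lambda>t. t * \<rho>" and x = t and Db = \<rho> and s = UNIV, OF this]
    have "((\<lambda>t. A (t * \<rho>)) has_real_derivative (t * \<rho>) ^ (d - 1) * \<phi> ((t * \<rho>)\<^sup>2) * \<rho>) (at t)"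
      by (rule meta_mp) (auto intro!: derivative_eq_intros)
    from DERIV_cdivide[OF this, of "\<rho> ^ d"]
    have "((\<lambda>t. A (t * \<rho>) / \<rho> ^ d) has_real_derivative t ^ (d - 1) * \<phi> (t\<^sup>2 * \<rho>\<^sup>2)) (at t)"
      using \<rho> by (simp add: \<rho>d power_mult_distrib)
    then show "((\<lambda>t. A (t * \<rho>) / \<rho> ^ d) has_vector_derivative t ^ (d - 1) * \<phi> (t\<^sup>2 * \<rho>\<^sup>2)) (at t)"
      by (simp add: has_real_derivative_iff_has_vector_derivative)
  qed simp
  then show ?thesis unfolding radial_mean_def by (simp add: integral_unique diff_divide_distrib)
qed

section \<open>Derivatives of square roots and logarithms\<close>

lemma DERIV_sqrt_sq_plus:
  assumes "0 < (h::real)"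
  shows "((\<lambda>r. sqrt (r\<^sup>2 + h\<^sup>2)) has_real_derivative r / sqrt (r\<^sup>2 + h\<^sup>2)) (at r)"
proof -
  have pos: "r\<^sup>2 + h\<^sup>2 > 0" using assms by (simp add: sum_power2_gt_zero_iff)
  have der: "((\<lambda>r. r\<^sup>2 + h\<^sup>2) has_real_derivative 2 * r) (at r)"
    by (auto intro!: derivative_eq_intros)
  have *: "inverse (sqrt (r\<^sup>2 + h\<^sup>2)) / 2 * (2 * r) = r / sqrt (r\<^sup>2 + h\<^sup>2)" by (simp add: field_simps)
  show ?thesis
    using DERIV_chain2[where f = sqrt and g = "\<lambda>r. r\<^sup>2 + h\<^sup>2" and x = r, OF DERIV_real_sqrt[OF pos] der] unfolding * .
qed

lemma sqrt_sq_plus_pos: "0 < h \<Longrightarrow> 0 < sqrt (r\<^sup>2 + h\<^sup>2)" for r h :: real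
  by (simp add: sum_power2_gt_zero_iff)

lemma add_sqrt_sq_plus_pos: "0 < h \<Longrightarrow> 0 < r + sqrt (r\<^sup>2 + h\<^sup>2)" for r h :: real
  using real_less_rsqrt[of "\<bar>r\<bar>" "r\<^sup>2 + h\<^sup>2"] by (simp add: abs_less_iff)

lemma DERIV_ln_add_sqrt:
  fixes r h k :: real
  assumes h: "0 < h" and k: "0 < k"
  shows "((\<lambda>r. ln ((r + sqrt (r\<^sup>2 + h\<^sup>2)) / k)) has_real_derivative 1 / sqrt (r\<^sup>2 + h\<^sup>2)) (at r)"
proof -
  define R where "R = sqrt (r\<^sup>2 + h\<^sup>2)"
  have R: "R > 0" "r + R > 0" using sqrt_sq_plus_pos[OF h] add_sqrt_sq_plus_pos[OF h] by (auto simp: R_def)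
  have pos: "(r + sqrt (r\<^sup>2 + h\<^sup>2)) / k > 0" using R k by (simp add: R_def)
  have "1 / ((r + R) / k) * ((1 + r / R) / k) = 1 / R"
  proof -
    have "1 + r / R = (r + R) / R" using R by (simp add: field_simps)
    then show ?thesis using R k by simp
  qed
  then show ?thesis
    using DERIV_chain2[where f = ln and g = "\<lambda>r. (r + sqrt (r\<^sup>2 + h\<^sup>2)) / k" and x = r,
      OF DERIV_ln_divide[OF pos] DERIV_cdivide[OF DERIV_add[OF DERIV_ident DERIV_sqrt_sq_plus[OF h]]]]
    by (simp add: R_def)
qed

lemma tendsto_ln_add_sqrt_div:
  fixes h :: real
  assumes h: "0 < h"
  shows "((\<lambda>r. ln ((r + sqrt (r\<^sup>2 + h\<^sup>2)) / h) / r) \<longlongrightarrow> 1 / h) (at 0)"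
  using DERIV_ln_add_sqrt[OF h h, of 0] h unfolding has_field_derivative_iff by simp

section \<open>The last two radial means from one primitive\<close>

context
  fixes f K :: "real \<Rightarrow> real"
  assumes K: "\<And>r. 0 < r \<Longrightarrow> (K has_real_derivative r * f (r\<^sup>2)) (at r)"
begin

lemma radial_mean_2_closed:
  assumes K0: "(K \<longlongrightarrow> 0) (at_right 0)" and \<rho>: "0 < \<rho>"
  shows "radial_mean 2 f (\<rho>\<^sup>2) = K \<rho> / \<rho>\<^sup>2"
proof -
  \<comment> \<open>\<open>K\<close> will be given by a formula dividing by \<open>r\<close>, whose
    value at 0 is not its limit; \<open>A\<close> is the continuous extension.\<close>
  define A where "A r = (if r = 0 then 0 else K r)" for r
  have ev: "eventually (\<lambda>x. K x = A x) (nhds r)" if "0 < r" for r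
  proof -
    have "eventually (\<lambda>x. x \<in> {0<..}) (nhds r)"
      using that by (intro eventually_nhds_in_open) auto
    then show ?thesis by (rule eventually_mono) (simp add: A_def)
  qed
  have dA: "(A has_real_derivative r * f (r\<^sup>2)) (at r)" if "0 < r" for r
    using K[OF that] DERIV_cong_ev[OF refl ev[OF that] refl, of "r * f (r\<^sup>2)"] by simp
  have "continuous_on {0..\<rho>} A"
    unfolding continuous_on_eq_continuous_within
  proof
    fix r assume r: "r \<in> {0..\<rho>}"
    show "continuous (at r within {0..\<rho>}) A"
    proof (cases "r = 0")
      case True
      have "(A \<longlongrightarrow> 0) (at_right 0)"
        using K0 by (rule Lim_transform_eventually) (auto simp: eventually_at_filter A_def)
      then have "(A \<longlongrightarrow> A 0) (at 0 within {0..\<rho>})"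
        using \<rho> by (simp add: at_within_Icc_at_right A_def)
      then show ?thesis using True by (simp add: continuous_within)
    next
      case False
      then have "isCont A r" using r by (intro DERIV_isCont[OF dA]) auto
      then show ?thesis by (rule continuous_at_imp_continuous_at_within)
    qed
  qed
  from radial_mean_closed_form[OF \<rho> _ this, of 2 f] dA show ?thesis
    using \<rho> by (simp add: A_def)
qed

text \<open>\<open>\<lambda>r. K (sqrt (r\<^sup>2 + h\<^sup>2))\<close> is again a primitive,
  because the inner derivative \<open>r / sqrt (r\<^sup>2 + h\<^sup>2)\<close> cancels the outer
  radius. The argument of \<open>K\<close> stays at least \<open>h\<close>, away from 0.\<close>

lemma radial_mean_2_shift_closed:
  assumes \<rho>: "0 < \<rho>" and h: "0 < h"
  shows "radial_mean 2 (\<lambda>x. f (x + h\<^sup>2)) (\<rho>\<^sup>2) = (K (sqrt (\<rho>\<^sup>2 + h\<^sup>2)) - K h) / \<rho>\<^sup>2"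
proof -
  let ?A = "\<lambda>r. K (sqrt (r\<^sup>2 + h\<^sup>2))"
  have dA: "(?A has_real_derivative r * f (r\<^sup>2 + h\<^sup>2)) (at r)" for r
  proof -
    have "(K has_real_derivative sqrt (r\<^sup>2 + h\<^sup>2) * f ((sqrt (r\<^sup>2 + h\<^sup>2))\<^sup>2)) (at (sqrt (r\<^sup>2 + h\<^sup>2)))"
      by (rule K[OF sqrt_sq_plus_pos[OF h]])
    from DERIV_chain2[where f = K and g = "\<lambda>r. sqrt (r\<^sup>2 + h\<^sup>2)" and x = r, OF this DERIV_sqrt_sq_plus[OF h]]
    show ?thesis using sqrt_sq_plus_pos[OF h, of r] h by (auto simp: ac_simps)
  qed
  have "continuous_on {0..\<rho>} ?A"
    by (intro continuous_at_imp_continuous_on ballI DERIV_isCont[OF dA])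
  from radial_mean_closed_form[OF \<rho> _ this, of 2 "\<lambda>x. f (x + h\<^sup>2)"] dA show ?thesis
    using h by simp
qed

text \<open>The case \<open>h2 = 0\<close>: the shift is applied after the mean of order 2, so
  \<open>K\<close> is divided by the squared shifted radius, and \<open>W\<close> is a primitive of
  that.\<close>

lemma terminal_closed_h1:
  assumes K0: "(K \<longlongrightarrow> 0) (at_right 0)" and h: "0 < h" and P: "0 < P" and W0: "W 0 = 0"
    and W: "\<And>r. 0 \<le> r \<Longrightarrow> (W has_real_derivative K (sqrt (r\<^sup>2 + h\<^sup>2)) / (r\<^sup>2 + h\<^sup>2)) (at r)"
  shows "radial_mean 1 (\<lambda>x. radial_mean 2 f (x + h\<^sup>2)) (P\<^sup>2) = W P / P"
proof -
  have c: "continuous_on {0..P} W"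
    by (intro continuous_at_imp_continuous_on ballI DERIV_isCont[OF W]) auto
  have "radial_mean 2 f (r\<^sup>2 + h\<^sup>2) = K (sqrt (r\<^sup>2 + h\<^sup>2)) / (r\<^sup>2 + h\<^sup>2)" for r
    using radial_mean_2_closed[OF K0 sqrt_sq_plus_pos[OF h, of r]] by simp
  then show ?thesis
    using radial_mean_closed_form[OF P _ c, of 1 "\<lambda>x. radial_mean 2 f (x + h\<^sup>2)"] W W0 by simp
qed

text \<open>The case \<open>h1 = 0\<close>: the shift sits inside the mean of order 2, whose closed
  form divides by \<open>r\<^sup>2\<close>; hence at 0 only continuity of \<open>W\<close> is asked
  for.\<close>

lemma terminal_closed_h2:
  assumes h: "0 < h" and P: "0 < P" and W0: "W 0 = 0" and Wc: "isCont W 0"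
    and W: "\<And>r. 0 < r \<Longrightarrow> (W has_real_derivative (K (sqrt (r\<^sup>2 + h\<^sup>2)) - K h) / r\<^sup>2) (at r)"
  shows "radial_mean 1 (radial_mean 2 (\<lambda>x. f (x + h\<^sup>2))) (P\<^sup>2) = W P / P"
proof -
  have "isCont W r" if "0 \<le> r" for r
    using that Wc DERIV_isCont[OF W, of r] by (cases "r = 0") auto
  then have c: "continuous_on {0..P} W"
    by (intro continuous_at_imp_continuous_on ballI) auto
  show ?thesis
    using radial_mean_closed_form[OF P _ c, of 1 "radial_mean 2 (\<lambda>x. f (x + h\<^sup>2))"] W W0 radial_mean_2_shift_closed[OF _ h] by simp
qed

end

section \<open>Hypotenuses and their logarithms\<close>

definition hyp :: "real \<Rightarrow> real \<Rightarrow> real" where "hyp h r = sqrt (r\<^sup>2 + h\<^sup>2)"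

lemma hyp_pos: "0 < h \<Longrightarrow> 0 < hyp h r"
  unfolding hyp_def by (rule sqrt_sq_plus_pos)

lemma hyp_sq: "(hyp h r)\<^sup>2 = r\<^sup>2 + h\<^sup>2"
  by (simp add: hyp_def)

lemma hyp_0: "0 < h \<Longrightarrow> hyp h 0 = h"
  by (simp add: hyp_def)

text \<open>Through this factorisation the powers of \<open>r\<close> in denominators cancel against
  \<open>hyp h r - h\<close>.\<close>

lemma sq_eq_hyp: "r\<^sup>2 = (hyp h r - h) * (hyp h r + h)"
  using hyp_sq[of h r] by (simp add: algebra_simps power2_eq_square)

lemma DERIV_hyp: "0 < h \<Longrightarrow> (hyp h has_real_derivative r / hyp h r) (at r)"
  unfolding hyp_def[abs_def] by (rule DERIV_sqrt_sq_plus)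

text \<open>For \<open>k = h > 0\<close> this is \<open>arsinh (r / h)\<close>.\<close>

definition ln_hyp :: "real \<Rightarrow> real \<Rightarrow> real \<Rightarrow> real" where "ln_hyp h k r = ln ((r + hyp h r) / k)"

lemma DERIV_ln_hyp: "0 < h \<Longrightarrow> 0 < k \<Longrightarrow> (ln_hyp h k has_real_derivative 1 / hyp h r) (at r)"
  unfolding hyp_def ln_hyp_def[abs_def] by (rule DERIV_ln_add_sqrt)

lemma ln_hyp_0: "0 < h \<Longrightarrow> ln_hyp h h 0 = 0"
  by (simp add: ln_hyp_def hyp_0)

lemma tendsto_hyp: "0 < h \<Longrightarrow> (hyp h \<longlongrightarrow> h) (at_right 0)"
  using DERIV_isCont[OF DERIV_hyp[of h 0]] hyp_0[of h] by (auto simp: isCont_def intro: tendsto_mono[OF at_le])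

lemma tendsto_ln_hyp_div: "0 < h \<Longrightarrow> ((\<lambda>r. ln_hyp h h r / r) \<longlongrightarrow> 1 / h) (at_right 0)"
  unfolding hyp_def ln_hyp_def by (rule tendsto_mono[OF at_le tendsto_ln_add_sqrt_div]) auto

text \<open>Primitives of \<open>r \<mapsto> r f (r\<^sup>2)\<close>, where \<open>f\<close> is the radial mean reached from the kernel
  \<open>\<bar>x - y\<bar>\<^sup>-\<^sup>3\<close> respectively \<open>\<bar>x - y\<bar>\<^sup>-\<^sup>1\<close>; the constants make them vanish at \<open>0\<close>.\<close>

definition cubic_K :: "real \<Rightarrow> real \<Rightarrow> real" where
  "cubic_K h r = 1 / (hyp h r + h) + 1 / (2 * h) - ln_hyp h h r / r"

definition newton_K :: "real \<Rightarrow> real \<Rightarrow> real" where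
  "newton_K h r = (hyp h r + h\<^sup>2 * (ln_hyp h h r / r)) / 2 - h"

text \<open>The primitive is \<open>R - 2 * h + h\<^sup>2 / R\<close> with
  \<open>R = hyp h r\<close>, written as a square over \<open>R\<close>. By \<open>sq_eq_hyp\<close>
  the square cancels against the fourth power of \<open>r\<close>.\<close>

lemma radial_mean_4_cubic:
  assumes h: "0 < h" and r: "0 < r"
  shows "radial_mean 4 (\<lambda>x. 1 / (sqrt (x + h\<^sup>2)) ^ 3) (r\<^sup>2) = 1 / (hyp h r * (hyp h r + h)\<^sup>2)"
proof -
  let ?A = "\<lambda>r. (hyp h r - h)\<^sup>2 / hyp h r"
  have dA: "(?A has_real_derivative x ^ (4 - 1) * (1 / (sqrt (x\<^sup>2 + h\<^sup>2)) ^ 3)) (at x)" for x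
  proof -
    define R where "R = hyp h x"
    have R: "R > 0" using hyp_pos[OF h] by (simp add: R_def)
    have x2: "x ^ 3 = x * ((R - h) * (R + h))" unfolding R_def sq_eq_hyp[of x h, symmetric] by (simp add: power3_eq_cube power2_eq_square)
    have "(?A has_real_derivative (2 * (hyp h x - h) * (x / hyp h x) * hyp h x - (hyp h x - h)\<^sup>2 * (x / hyp h x)) / (hyp h x * hyp h x)) (at x)"
      using hyp_pos[OF h, of x] by (auto intro!: derivative_eq_intros DERIV_hyp h simp: power2_eq_square)
    moreover have "(2 * (R - h) * (x / R) * R - (R - h)\<^sup>2 * (x / R)) / (R * R) = x ^ 3 * (1 / R ^ 3)"
      unfolding x2 using R by (simp add: field_simps power2_eq_square power3_eq_cube)
    ultimately show ?thesis by (simp add: R_def flip: hyp_def)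
  qed
  have "continuous_on {0..r} ?A" by (intro continuous_at_imp_continuous_on ballI DERIV_isCont[OF dA])
  from radial_mean_closed_form[OF r _ this dA]
  have "radial_mean 4 (\<lambda>x. 1 / (sqrt (x + h\<^sup>2)) ^ 3) (r\<^sup>2) = (hyp h r - h)\<^sup>2 / hyp h r / (r\<^sup>2)\<^sup>2"
    using h by (simp add: hyp_0 ln_hyp_0)
  also have "\<dots> = (hyp h r - h)\<^sup>2 / hyp h r / ((hyp h r - h) * (hyp h r + h))\<^sup>2"
    by (simp only: sq_eq_hyp[of r h])
  also have "hyp h r - h \<noteq> 0" using sq_eq_hyp[of r h] r by auto
  then have "(hyp h r - h)\<^sup>2 / hyp h r / ((hyp h r - h) * (hyp h r + h))\<^sup>2 = 1 / (hyp h r * (hyp h r + h)\<^sup>2)"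
    by (simp add: power_mult_distrib)
  finally show ?thesis .
qed

text \<open>With \<open>R = hyp h r\<close> the integrand is
  \<open>1 / R - 2 * h / (R * (R + h))\<close>, and \<open>h / (R * (R + h))\<close> is the
  derivative of \<open>r / (R + h)\<close>.\<close>

lemma radial_mean_3_cubic:
  assumes h: "0 < h" and r: "0 < r"
  shows "radial_mean 3 (radial_mean 4 (\<lambda>x. 1 / (sqrt (x + h\<^sup>2)) ^ 3)) (r\<^sup>2)
    = (ln_hyp h h r - 2 * r / (hyp h r + h)) / r ^ 3"
proof -
  let ?A = "\<lambda>r. ln_hyp h h r - 2 * r / (hyp h r + h)"
  have d: "(?A has_real_derivative x\<^sup>2 * (1 / (hyp h x * (hyp h x + h)\<^sup>2))) (at x)" for x
  proof -
    define R where "R = hyp h x"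
    have R: "R > 0" using hyp_pos[OF h] by (simp add: R_def)
    have x2: "x\<^sup>2 = (R - h) * (R + h)" unfolding R_def by (rule sq_eq_hyp)
    have "(?A has_real_derivative 1 / hyp h x - (2 * (hyp h x + h) - 2 * x * (x / hyp h x)) / ((hyp h x + h) * (hyp h x + h))) (at x)"
      using hyp_pos[OF h, of x] h by (auto intro!: derivative_eq_intros DERIV_hyp DERIV_ln_hyp h)
    moreover have "1 / R - (2 * (R + h) - 2 * x * (x / R)) / ((R + h) * (R + h)) = x\<^sup>2 * (1 / (R * (R + h)\<^sup>2))"
    proof -
      have e: "2 * x * (x / R) = 2 * x\<^sup>2 / R" by (simp add: power2_eq_square)
      have "R + h \<noteq> 0" using R h by simp
      then show ?thesis unfolding e x2 using R by (simp add: divide_simps) (simp add: algebra_simps power2_eq_square)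
    qed
    ultimately show ?thesis by (simp add: R_def)
  qed
  have c: "continuous_on {0..r} ?A" by (intro continuous_at_imp_continuous_on ballI DERIV_isCont[OF d])
  have "(?A has_real_derivative x ^ (3 - 1) * radial_mean 4 (\<lambda>x. 1 / (sqrt (x + h\<^sup>2)) ^ 3) (x\<^sup>2)) (at x)" if "0 < x" for x
    using d[of x] unfolding radial_mean_4_cubic[OF h that] by simp
  from radial_mean_closed_form[OF r _ c this] show ?thesis using h by (simp add: hyp_0 ln_hyp_0)
qed

lemma DERIV_cubic_K:
  assumes h: "0 < h" and r: "0 < r"
  shows "(cubic_K h has_real_derivative r * radial_mean 3 (radial_mean 4 (\<lambda>x. 1 / (sqrt (x + h\<^sup>2)) ^ 3)) (r\<^sup>2)) (at r)"
proof -
  define R l where "R = hyp h r" and "l = ln_hyp h h r"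
  have R: "R > 0" using hyp_pos[OF h] by (simp add: R_def)
  have x2: "r\<^sup>2 = (R - h) * (R + h)" unfolding R_def by (rule sq_eq_hyp)
  have "(cubic_K h has_real_derivative - (r / hyp h r) / ((hyp h r + h) * (hyp h r + h))
      - (1 / hyp h r * r - ln_hyp h h r) / (r * r)) (at r)"
    unfolding cubic_K_def[abs_def]
    using hyp_pos[OF h, of r] h r by (auto intro!: derivative_eq_intros DERIV_hyp DERIV_ln_hyp h)
  moreover have "- (r / R) / ((R + h) * (R + h)) - (1 / R * r - l) / (r * r) = r * ((l - 2 * r / (R + h)) / r ^ 3)"
  proof -
    have "R + h \<noteq> 0" using R h by simp
    have "r\<^sup>2 * (1 / (R * (R + h)\<^sup>2)) + 1 / R = 2 / (R + h)"
      unfolding x2 using R \<open>R + h \<noteq> 0\<close> by (simp add: divide_simps) (simp add: algebra_simps power2_eq_square)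
    then have "2 * r / (R + h) = r * (r\<^sup>2 * (1 / (R * (R + h)\<^sup>2)) + 1 / R)" by simp
    then show ?thesis
      using R r \<open>R + h \<noteq> 0\<close> by (simp only:) (simp add: divide_simps power2_eq_square power3_eq_cube, simp add: algebra_simps)
  qed
  ultimately show ?thesis unfolding radial_mean_3_cubic[OF h r] by (simp add: R_def l_def)
qed

lemma tendsto_cubic_K:
  assumes h: "0 < h"
  shows "(cubic_K h \<longlongrightarrow> 0) (at_right 0)"
proof -
  have "(cubic_K h \<longlongrightarrow> 1 / (h + h) + 1 / (2 * h) - 1 / h) (at_right 0)"
    unfolding cubic_K_def[abs_def] using h by (intro tendsto_intros tendsto_hyp tendsto_ln_hyp_div h) auto
  then show ?thesis by (simp add: field_simps)
qed

lemma radial_mean_3_newton: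
  assumes h: "0 < h" and r: "0 < r"
  shows "radial_mean 3 (\<lambda>x. 1 / sqrt (x + h\<^sup>2)) (r\<^sup>2) = (r * hyp h r - h\<^sup>2 * ln_hyp h h r) / 2 / r ^ 3"
proof -
  let ?A = "\<lambda>r. (r * hyp h r - h\<^sup>2 * ln_hyp h h r) / 2"
  have d: "(?A has_real_derivative x ^ (3 - 1) * (1 / sqrt (x\<^sup>2 + h\<^sup>2))) (at x)" for x
  proof -
    define R where "R = hyp h x"
    have R: "R > 0" using hyp_pos[OF h] by (simp add: R_def)
    have x2: "x\<^sup>2 = (R - h) * (R + h)" unfolding R_def by (rule sq_eq_hyp)
    have "(?A has_real_derivative (hyp h x + x * (x / hyp h x) - h\<^sup>2 * (1 / hyp h x)) / 2) (at x)"
      by (rule DERIV_cong[OF DERIV_cdivide[OF DERIV_diff[OF DERIV_mult[OF DERIV_ident DERIV_hyp[OF h]]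
              DERIV_cmult[OF DERIV_ln_hyp[OF h h]]]]]) simp
    moreover have "(R + x * (x / R) - h\<^sup>2 * (1 / R)) / 2 = x\<^sup>2 * (1 / R)"
    proof -
      have e: "x * (x / R) = x\<^sup>2 / R" by (simp add: power2_eq_square)
      show ?thesis unfolding e x2 using R by (simp add: field_simps power2_eq_square)
    qed
    ultimately show ?thesis by (simp add: R_def flip: hyp_def)
  qed
  have c: "continuous_on {0..r} ?A" by (intro continuous_at_imp_continuous_on ballI DERIV_isCont[OF d])
  from radial_mean_closed_form[OF r _ c d] show ?thesis using h by (simp add: hyp_0 ln_hyp_0)
qed

lemma DERIV_newton_K:
  assumes h: "0 < h" and r: "0 < r"
  shows "(newton_K h has_real_derivative r * radial_mean 3 (\<lambda>x. 1 / sqrt (x + h\<^sup>2)) (r\<^sup>2)) (at r)"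
proof -
  define R l where "R = hyp h r" and "l = ln_hyp h h r"
  have R: "R > 0" using hyp_pos[OF h] by (simp add: R_def)
  have h2: "h\<^sup>2 = R\<^sup>2 - r\<^sup>2" unfolding R_def using hyp_sq[of h r] by simp
  have "(newton_K h has_real_derivative (r / hyp h r + h\<^sup>2 * ((1 / hyp h r * r - ln_hyp h h r) / (r * r))) / 2) (at r)"
    unfolding newton_K_def[abs_def]
    using hyp_pos[OF h, of r] h r
    by (auto intro!: derivative_eq_intros DERIV_hyp DERIV_ln_hyp h simp: algebra_simps diff_divide_distrib)
  moreover have "(r / R + h\<^sup>2 * ((1 / R * r - l) / (r * r))) / 2 = r * ((r * R - h\<^sup>2 * l) / 2 / r ^ 3)"
    unfolding h2 using R r by (simp add: divide_simps power2_eq_square power3_eq_cube) (simp add: algebra_simps)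
  ultimately show ?thesis unfolding radial_mean_3_newton[OF h r] R_def l_def by (simp only:)
qed

lemma tendsto_newton_K:
  assumes h: "0 < h"
  shows "(newton_K h \<longlongrightarrow> 0) (at_right 0)"
proof -
  have "(newton_K h \<longlongrightarrow> (h + h\<^sup>2 * (1 / h)) / 2 - h) (at_right 0)"
    unfolding newton_K_def[abs_def] using h by (intro tendsto_intros tendsto_hyp tendsto_ln_hyp_div h) auto
  then show ?thesis using h by (simp add: power2_eq_square)
qed

section \<open>Primitives behind the terminal functions\<close>

lemma hyp_commute: "hyp (hyp h k) P = hyp h (hyp k P)"
  by (simp add: hyp_def algebra_simps)

lemma hyp_sq_above: "0 < h \<Longrightarrow> 0 < r \<Longrightarrow> h < hyp h r"
  unfolding hyp_def by (intro real_less_rsqrt) simp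

text \<open>\<open>P\<close> times \<open>\<Phi>2\<close>, with the inner square root evaluated to
  \<open>h\<close>. For positive \<open>h\<close> and \<open>\<eta>\<close> it equals
  \<open>arctan (P / \<eta>) - arctan (h * P / (\<eta> * R))\<close> with
  \<open>R = hyp (hyp h \<eta>) P\<close>.\<close>

definition angle :: "real \<Rightarrow> real \<Rightarrow> real \<Rightarrow> real" where
  "angle h \<eta> P = arctan (\<eta> * P / ((hyp h \<eta>)\<^sup>2 + hyp (hyp h \<eta>) P * h))"

text \<open>The derivative comes out simple because of the factorisation \<open>m\<close>: the sum
  of squares \<open>(k\<^sup>2 + R * h)\<^sup>2 + (\<eta> * P)\<^sup>2\<close> is the square of
  \<open>k * (R + h)\<close>.\<close>

lemma DERIV_angle:
  assumes h: "0 < h"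
  shows "(angle h \<eta> has_real_derivative \<eta> / (hyp (hyp h \<eta>) P * (hyp (hyp h \<eta>) P + h))) (at P)"
proof -
  define k R where "k = hyp h \<eta>" and "R = hyp k P"
  have k: "k > 0" unfolding k_def using h by (rule hyp_pos)
  have R: "R > 0" unfolding R_def using k by (rule hyp_pos)
  have pos: "k\<^sup>2 + R * h > 0" using k R h by (simp add: add_pos_pos)
  have d: "((\<lambda>P. \<eta> * P / (k\<^sup>2 + hyp k P * h)) has_real_derivative
      (\<eta> * (k\<^sup>2 + R * h) - \<eta> * P * (P / R * h)) / ((k\<^sup>2 + R * h) * (k\<^sup>2 + R * h))) (at P)"
    unfolding R_def using pos[unfolded R_def]
    by (auto intro!: derivative_eq_intros DERIV_hyp[OF k])
  have n: "\<eta> * (k\<^sup>2 + R * h) - \<eta> * P * (P / R * h) = \<eta> * k\<^sup>2 * (R + h) / R"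
  proof -
    have "\<eta> * P * (P / R * h) = \<eta> * h * P\<^sup>2 / R" by (simp add: power2_eq_square)
    also have "P\<^sup>2 = R\<^sup>2 - k\<^sup>2" unfolding R_def hyp_sq by simp
    finally show ?thesis using R by (simp add: field_simps power2_eq_square)
  qed
  have m: "(k\<^sup>2 + R * h)\<^sup>2 + (\<eta> * P)\<^sup>2 = k\<^sup>2 * (R + h)\<^sup>2"
  proof -
    have "P\<^sup>2 = R\<^sup>2 - k\<^sup>2" unfolding R_def hyp_sq by simp
    moreover have "\<eta>\<^sup>2 = k\<^sup>2 - h\<^sup>2" unfolding k_def hyp_sq by simp
    ultimately show ?thesis by (simp add: power_mult_distrib) (simp add: algebra_simps power2_eq_square)
  qed
  have pos2: "k\<^sup>2 * (R + h)\<^sup>2 > 0" using k R h by simp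
  have "inverse (1 + (\<eta> * P / (k\<^sup>2 + R * h))\<^sup>2) * ((\<eta> * (k\<^sup>2 + R * h) - \<eta> * P * (P / R * h)) / ((k\<^sup>2 + R * h) * (k\<^sup>2 + R * h)))
     = \<eta> / (R * (R + h))"
  proof -
    have "1 + (\<eta> * P / (k\<^sup>2 + R * h))\<^sup>2 = k\<^sup>2 * (R + h)\<^sup>2 / (k\<^sup>2 + R * h)\<^sup>2"
      using pos unfolding m[symmetric] by (simp add: power_divide add_divide_distrib)
    then have "inverse (1 + (\<eta> * P / (k\<^sup>2 + R * h))\<^sup>2) * ((\<eta> * (k\<^sup>2 + R * h) - \<eta> * P * (P / R * h)) / ((k\<^sup>2 + R * h) * (k\<^sup>2 + R * h)))
      = (k\<^sup>2 + R * h)\<^sup>2 / (k\<^sup>2 * (R + h)\<^sup>2) * ((\<eta> * k\<^sup>2 * (R + h) / R) / (k\<^sup>2 + R * h)\<^sup>2)"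
      unfolding n by (simp add: power2_eq_square)
    also have "\<dots> = (\<eta> * k\<^sup>2 * (R + h) / R) / (k\<^sup>2 * (R + h)\<^sup>2)" using pos by simp
    also have "\<dots> = \<eta> / (R * (R + h))" using k R h by (simp add: power2_eq_square)
    finally show ?thesis .
  qed
  then show ?thesis
    using DERIV_chain2[where f = arctan and g = "\<lambda>P. \<eta> * P / (k\<^sup>2 + hyp k P * h)" and x = P, OF DERIV_arctan d]
    unfolding angle_def[abs_def] k_def[symmetric] R_def[symmetric] by simp
qed

lemma DERIV_ln_hyp_hyp:
  assumes "0 < h" "0 < \<eta>"
  shows "((\<lambda>P. ln_hyp h h (hyp \<eta> P)) has_real_derivative 1 / hyp h (hyp \<eta> P) * (P / hyp \<eta> P)) (at P)"
  using DERIV_chain2[where f = "ln_hyp h h" and g = "hyp \<eta>" and x = P, OF DERIV_ln_hyp DERIV_hyp] assms by blast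

text \<open>The junk value \<open>ln_gap h \<eta> 0 = 0\<close> is the continuous extension.\<close>

definition ln_gap :: "real \<Rightarrow> real \<Rightarrow> real \<Rightarrow> real" where
  "ln_gap h \<eta> P = (hyp \<eta> P * ln_hyp h h (hyp \<eta> P) - \<eta> * ln_hyp h h \<eta>) / P"

lemma DERIV_ln_gap_numerator:
  assumes "0 < h" "0 < \<eta>"
  shows "((\<lambda>P. hyp \<eta> P * ln_hyp h h (hyp \<eta> P) - \<eta> * ln_hyp h h \<eta>) has_real_derivative
    P * ln_hyp h h (hyp \<eta> P) / hyp \<eta> P + P / hyp h (hyp \<eta> P)) (at P)"
  using DERIV_diff[OF DERIV_mult[OF DERIV_hyp[OF assms(2)] DERIV_ln_hyp_hyp[OF assms]] DERIV_const[of "\<eta> * ln_hyp h h \<eta>"], of P]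
    hyp_pos[OF assms(2), of P] by simp

text \<open>The numerator vanishes at 0, so \<open>ln_gap\<close> is its difference quotient there,
  and the derivative of the numerator at 0 is 0.\<close>

lemma isCont_ln_gap:
  assumes "0 < h" "0 < \<eta>"
  shows "isCont (ln_gap h \<eta>) 0"
  using DERIV_ln_gap_numerator[OF assms, of 0] assms
  unfolding has_field_derivative_iff isCont_def ln_gap_def[abs_def] by (simp add: hyp_0)

lemma DERIV_ln_gap:
  assumes "0 < h" "0 < \<eta>" "0 < P"
  shows "(ln_gap h \<eta> has_real_derivative ln_hyp h h (hyp \<eta> P) / hyp \<eta> P + 1 / hyp h (hyp \<eta> P)
     - (hyp \<eta> P * ln_hyp h h (hyp \<eta> P) - \<eta> * ln_hyp h h \<eta>) / P\<^sup>2) (at P)"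
  unfolding ln_gap_def[abs_def]
  by (rule DERIV_cong[OF DERIV_divide[OF DERIV_ln_gap_numerator[OF assms(1,2)] DERIV_ident]])
    (use assms in \<open>simp_all add: field_simps power2_eq_square\<close>)

lemma DERIV_quotient_hyp:
  assumes "0 < k" "0 \<le> h"
  shows "((\<lambda>P. P / (hyp k P + h)) has_real_derivative (hyp k P + h - P\<^sup>2 / hyp k P) / (hyp k P + h)\<^sup>2) (at P)"
  by (rule DERIV_cong[OF DERIV_divide[OF DERIV_ident DERIV_add[OF DERIV_hyp[OF assms(1)] DERIV_const]]])
    (use hyp_pos[OF assms(1), of P] assms in \<open>simp_all add: power2_eq_square\<close>)

text \<open>The function differentiated is \<open>P\<close> times \<open>\<Phi>3\<close>.\<close>

lemma DERIV_ln_hyp_div: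
  assumes "0 < h" "0 < \<eta>"
  shows "((\<lambda>P. P / hyp \<eta> P * ln_hyp h h (hyp \<eta> P)) has_real_derivative
    \<eta>\<^sup>2 / (hyp \<eta> P) ^ 3 * ln_hyp h h (hyp \<eta> P) + P\<^sup>2 / ((hyp \<eta> P)\<^sup>2 * hyp h (hyp \<eta> P))) (at P)"
proof -
  define \<rho> where "\<rho> = hyp \<eta> P"
  have \<rho>: "\<rho> > 0" unfolding \<rho>_def using assms by (simp add: hyp_pos)
  have e: "\<eta>\<^sup>2 = \<rho>\<^sup>2 - P\<^sup>2" unfolding \<rho>_def hyp_sq by simp
  have "((\<lambda>P. P / hyp \<eta> P * ln_hyp h h (hyp \<eta> P)) has_real_derivative
      (1 * \<rho> - P * (P / \<rho>)) / (\<rho> * \<rho>) * ln_hyp h h \<rho> + 1 / hyp h \<rho> * (P / \<rho>) * (P / \<rho>)) (at P)"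
    unfolding \<rho>_def
    by (rule DERIV_mult[OF DERIV_divide[OF DERIV_ident DERIV_hyp[OF assms(2)]] DERIV_ln_hyp_hyp[OF assms]])
      (use \<rho> in \<open>simp add: \<rho>_def\<close>)
  moreover have "(1 * \<rho> - P * (P / \<rho>)) / (\<rho> * \<rho>) = \<eta>\<^sup>2 / \<rho> ^ 3"
    unfolding e using \<rho> by (simp add: field_simps power2_eq_square power3_eq_cube)
  moreover have "1 / hyp h \<rho> * (P / \<rho>) * (P / \<rho>) = P\<^sup>2 / (\<rho>\<^sup>2 * hyp h \<rho>)" by (simp add: power2_eq_square)
  ultimately show ?thesis by (simp only: \<rho>_def)
qed

section \<open>Algebraic identities between the derivatives\<close>

context
  fixes h \<eta> P k r \<rho> l m :: real
  assumes h: "0 < h" and \<eta>: "0 < \<eta>" and P: "0 \<le> P"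
    and k: "k = hyp h \<eta>" and r: "r = hyp k P" and \<rho>: "\<rho> = hyp \<eta> P"
begin

text \<open>Each square root is tied to the others by a difference of squares, which makes the parts
  of the identities below that are free of \<open>l\<close> and \<open>m\<close> rational. These two
  variables stand for the logarithms \<open>ln_hyp h h \<rho>\<close> and
  \<open>ln_hyp h h \<eta>\<close>, in which the identities are linear.\<close>

lemma hyp_facts: "0 < k" "0 < r" "0 < \<rho>" "h < r" "h < k" "\<rho>\<^sup>2 = (r - h) * (r + h)" "\<eta>\<^sup>2 = (k - h) * (k + h)" "P\<^sup>2 = (r - k) * (r + k)"
  "r = hyp h \<rho>" "P > 0 \<Longrightarrow> k < r"
proof -
  show "0 < k" "h < k" using h \<eta> hyp_pos hyp_sq_above by (auto simp: k)
  then show "0 < r" "0 < \<rho>" "P > 0 \<Longrightarrow> k < r" using hyp_pos \<eta> hyp_sq_above by (auto simp: r \<rho>)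
  show "r = hyp h \<rho>" by (simp add: r \<rho> k hyp_commute)
  with h \<open>0 < \<rho>\<close> show "h < r" using hyp_sq_above by auto
  show "\<rho>\<^sup>2 = (r - h) * (r + h)" unfolding \<open>r = hyp h \<rho>\<close> by (rule sq_eq_hyp)
  show "\<eta>\<^sup>2 = (k - h) * (k + h)" unfolding k by (rule sq_eq_hyp)
  show "P\<^sup>2 = (r - k) * (r + k)" unfolding r by (rule sq_eq_hyp)
qed

lemma P_sq: "P\<^sup>2 = \<rho>\<^sup>2 - \<eta>\<^sup>2"
  unfolding hyp_facts by (simp add: algebra_simps)

text \<open>On the left is the derivative of the candidate primitive for \<open>F1'\<close>, on the
  right \<open>cubic_K h \<rho> / \<rho>\<^sup>2\<close>. The terms with \<open>l\<close> match at
  once; the rest is a rational identity once \<open>\<rho>\<^sup>2\<close> is factored.\<close>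

lemma cubic_h1_identity:
  "(1 / r + (\<eta>\<^sup>2 - h\<^sup>2) / (2 * \<eta> * h) * (\<eta> / (r * (r + h))) - (\<eta>\<^sup>2 / \<rho> ^ 3 * l + P\<^sup>2 / (\<rho>\<^sup>2 * r))
    + (r + h - P\<^sup>2 / r) / (r + h)\<^sup>2 / 2) / \<eta>\<^sup>2 = (1 / (r + h) + 1 / (2 * h) - l / \<rho>) / \<rho>\<^sup>2"
proof -
  have "1 / r + (\<eta>\<^sup>2 - h\<^sup>2) / (2 * h * (r * (r + h))) - (\<rho>\<^sup>2 - \<eta>\<^sup>2) / (\<rho>\<^sup>2 * r) + (r + h - (\<rho>\<^sup>2 - \<eta>\<^sup>2) / r) / (r + h)\<^sup>2 / 2
    = \<eta>\<^sup>2 * (1 / (r + h) + 1 / (2 * h)) / \<rho>\<^sup>2"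
    unfolding hyp_facts(6) using hyp_facts(2,4) h
    by (simp add: divide_simps) (simp add: algebra_simps power2_eq_square)
  moreover have "(\<eta>\<^sup>2 - h\<^sup>2) / (2 * \<eta> * h) * (\<eta> / (r * (r + h))) = (\<eta>\<^sup>2 - h\<^sup>2) / (2 * h * (r * (r + h)))"
    using \<eta> by simp
  moreover have "\<eta>\<^sup>2 / \<rho> ^ 3 * l = \<eta>\<^sup>2 * (l / \<rho>) / \<rho>\<^sup>2" by (simp add: power2_eq_square power3_eq_cube)
  ultimately have "1 / r + (\<eta>\<^sup>2 - h\<^sup>2) / (2 * \<eta> * h) * (\<eta> / (r * (r + h))) - (\<eta>\<^sup>2 / \<rho> ^ 3 * l + P\<^sup>2 / (\<rho>\<^sup>2 * r))
    + (r + h - P\<^sup>2 / r) / (r + h)\<^sup>2 / 2 = \<eta>\<^sup>2 * (1 / (r + h) + 1 / (2 * h)) / \<rho>\<^sup>2 - \<eta>\<^sup>2 * (l / \<rho>) / \<rho>\<^sup>2"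
    unfolding P_sq by linarith
  also have "\<dots> = \<eta>\<^sup>2 * ((1 / (r + h) + 1 / (2 * h) - l / \<rho>) / \<rho>\<^sup>2)" by (simp add: algebra_simps diff_divide_distrib)
  finally show ?thesis using \<eta> by simp
qed

lemma newton_h1_identity:
  "((1 - h\<^sup>2 / \<eta>\<^sup>2) * (1 / r) - 2 * h / \<eta> * (\<eta> / (r * (r + h))) + h\<^sup>2 / \<eta>\<^sup>2 * (\<eta>\<^sup>2 / \<rho> ^ 3 * l + P\<^sup>2 / (\<rho>\<^sup>2 * r))) / 2
    = ((r + h\<^sup>2 * (l / \<rho>)) / 2 - h) / \<rho>\<^sup>2"
proof -
  have 1: "(1 - h\<^sup>2 / \<eta>\<^sup>2) * (1 / r) - 2 * h / (r * (r + h)) + h\<^sup>2 / \<eta>\<^sup>2 * ((\<rho>\<^sup>2 - \<eta>\<^sup>2) / (\<rho>\<^sup>2 * r)) = (r - 2 * h) / \<rho>\<^sup>2"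
    unfolding hyp_facts(6) using hyp_facts(2,4) h \<eta>
    by (simp add: divide_simps) (simp add: algebra_simps power2_eq_square)
  have 2: "2 * h / \<eta> * (\<eta> / (r * (r + h))) = 2 * h / (r * (r + h))" using \<eta> by simp
  have 3: "h\<^sup>2 / \<eta>\<^sup>2 * (\<eta>\<^sup>2 / \<rho> ^ 3 * l) = h\<^sup>2 * (l / \<rho>) / \<rho>\<^sup>2" using \<eta> by (simp add: power2_eq_square power3_eq_cube)
  have 4: "((r + h\<^sup>2 * (l / \<rho>)) / 2 - h) / \<rho>\<^sup>2 = ((r - 2 * h) / \<rho>\<^sup>2 + h\<^sup>2 * (l / \<rho>) / \<rho>\<^sup>2) / 2"
    by (simp add: algebra_simps add_divide_distrib diff_divide_distrib)
  have 5: "h\<^sup>2 / \<eta>\<^sup>2 * (\<eta>\<^sup>2 / \<rho> ^ 3 * l + P\<^sup>2 / (\<rho>\<^sup>2 * r))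
    = h\<^sup>2 / \<eta>\<^sup>2 * (\<eta>\<^sup>2 / \<rho> ^ 3 * l) + h\<^sup>2 / \<eta>\<^sup>2 * ((\<rho>\<^sup>2 - \<eta>\<^sup>2) / (\<rho>\<^sup>2 * r))"
    unfolding P_sq by (rule distrib_left)
  show ?thesis unfolding 5 4 3 2 1[symmetric] by (simp only: add.assoc add.commute add.left_commute)
qed

lemma h2_coefficients:
  assumes "0 < P"
  shows "1 / \<rho> - \<rho> / P\<^sup>2 = - (\<eta>\<^sup>2 / (\<rho> * P\<^sup>2))"
proof -
  have "1 / \<rho> - \<rho> / P\<^sup>2 = (P\<^sup>2 - \<rho>\<^sup>2) / (\<rho> * P\<^sup>2)"
    using assms hyp_facts(3) by (simp add: field_simps power2_eq_square)
  then show ?thesis unfolding P_sq by simp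
qed

lemma quotient_hyp_identity: "(r + k - P\<^sup>2 / r) / (r + k)\<^sup>2 = k / (r * (r + k))"
  unfolding hyp_facts(8) using hyp_facts(1,2) by (simp add: divide_simps) (simp add: algebra_simps power2_eq_square)

lemma cubic_h2_identity:
  assumes "0 < P"
  shows "- ((1 / r - h / \<eta> * (\<eta> / (r * (r + h))) - (l / \<rho> + 1 / r - (\<rho> * l - \<eta> * m) / P\<^sup>2) + (r + k - P\<^sup>2 / r) / (r + k)\<^sup>2) / \<eta>\<^sup>2)
    = ((1 / (r + h) + 1 / (2 * h) - l / \<rho>) - (1 / (k + h) + 1 / (2 * h) - m / \<eta>)) / P\<^sup>2"
proof -
  \<comment> \<open>The part free of logarithms: the two terms \<open>1 / r\<close> cancel, and
    \<open>quotient_hyp_identity\<close> simplifies the last one.\<close>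
  have "h / (r * (r + h)) - k / (r * (r + k)) = \<eta>\<^sup>2 * (1 / (r + h) - 1 / (k + h)) / P\<^sup>2"
    unfolding hyp_facts(7,8) using hyp_facts(1,2,4,5) hyp_facts(10)[OF assms] h
    by (simp add: divide_simps) (simp add: algebra_simps power2_eq_square)
  moreover have "h / \<eta> * (\<eta> / (r * (r + h))) = h / (r * (r + h))" using \<eta> by simp
  moreover have "l / \<rho> - (\<rho> * l - \<eta> * m) / P\<^sup>2 = \<eta>\<^sup>2 * (m / \<eta> - l / \<rho>) / P\<^sup>2"
  proof -
    have "l / \<rho> - (\<rho> * l - \<eta> * m) / P\<^sup>2 = l * (1 / \<rho> - \<rho> / P\<^sup>2) + \<eta> * m / P\<^sup>2" by (simp add: algebra_simps diff_divide_distrib)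
    also have "\<dots> = \<eta>\<^sup>2 * (m / \<eta> - l / \<rho>) / P\<^sup>2"
      unfolding h2_coefficients[OF assms] using \<eta> by (simp add: algebra_simps diff_divide_distrib power2_eq_square)
    finally show ?thesis .
  qed
  moreover have "\<eta>\<^sup>2 * (((1 / (r + h) + 1 / (2 * h) - l / \<rho>) - (1 / (k + h) + 1 / (2 * h) - m / \<eta>)) / P\<^sup>2)
    = \<eta>\<^sup>2 * (1 / (r + h) - 1 / (k + h)) / P\<^sup>2 + \<eta>\<^sup>2 * (m / \<eta> - l / \<rho>) / P\<^sup>2"
    by (simp add: algebra_simps add_divide_distrib diff_divide_distrib)
  ultimately have "- (1 / r - h / \<eta> * (\<eta> / (r * (r + h))) - (l / \<rho> + 1 / r - (\<rho> * l - \<eta> * m) / P\<^sup>2) + (r + k - P\<^sup>2 / r) / (r + k)\<^sup>2)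
    = \<eta>\<^sup>2 * (((1 / (r + h) + 1 / (2 * h) - l / \<rho>) - (1 / (k + h) + 1 / (2 * h) - m / \<eta>)) / P\<^sup>2)"
    unfolding quotient_hyp_identity by linarith
  then show ?thesis using \<eta> by (simp only: minus_divide_left) simp
qed

lemma newton_h2_identity:
  assumes "0 < P"
  shows "(k\<^sup>2 / \<eta>\<^sup>2 * (1 / r) - (r + k - P\<^sup>2 / r) / (r + k)\<^sup>2 - h\<^sup>2 / \<eta>\<^sup>2 * (l / \<rho> + 1 / r - (\<rho> * l - \<eta> * m) / P\<^sup>2)) / 2
    = (((r + h\<^sup>2 * (l / \<rho>)) / 2 - h) - ((k + h\<^sup>2 * (m / \<eta>)) / 2 - h)) / P\<^sup>2"
proof -
  have 1: "k\<^sup>2 / \<eta>\<^sup>2 * (1 / r) - k / (r * (r + k)) - h\<^sup>2 / \<eta>\<^sup>2 * (1 / r) = (r - k) / P\<^sup>2"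
    unfolding hyp_facts(7,8) using hyp_facts(1,2,4,5) hyp_facts(10)[OF assms] h
    by (simp add: divide_simps) (simp add: algebra_simps power2_eq_square)
  have 2: "h\<^sup>2 / \<eta>\<^sup>2 * (l / \<rho> - (\<rho> * l - \<eta> * m) / P\<^sup>2) = h\<^sup>2 * (m / \<eta> - l / \<rho>) / P\<^sup>2"
  proof -
    have "l / \<rho> - (\<rho> * l - \<eta> * m) / P\<^sup>2 = l * (1 / \<rho> - \<rho> / P\<^sup>2) + \<eta> * m / P\<^sup>2" by (simp add: algebra_simps diff_divide_distrib)
    also have "\<dots> = \<eta>\<^sup>2 * ((m / \<eta> - l / \<rho>) / P\<^sup>2)"
      unfolding h2_coefficients[OF assms] using \<eta> by (simp add: algebra_simps diff_divide_distrib power2_eq_square)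
    finally show ?thesis using \<eta> by simp
  qed
  have 3: "h\<^sup>2 / \<eta>\<^sup>2 * (l / \<rho> + 1 / r - (\<rho> * l - \<eta> * m) / P\<^sup>2)
    = h\<^sup>2 / \<eta>\<^sup>2 * (l / \<rho> - (\<rho> * l - \<eta> * m) / P\<^sup>2) + h\<^sup>2 / \<eta>\<^sup>2 * (1 / r)"
    by (simp only: distrib_left[symmetric]) simp
  have 4: "(((r + h\<^sup>2 * (l / \<rho>)) / 2 - h) - ((k + h\<^sup>2 * (m / \<eta>)) / 2 - h)) / P\<^sup>2 = ((r - k) / P\<^sup>2 - h\<^sup>2 * (m / \<eta> - l / \<rho>) / P\<^sup>2) / 2"
    by (simp add: algebra_simps add_divide_distrib diff_divide_distrib)
  show ?thesis unfolding quotient_hyp_identity 4 3 2 1[symmetric] by (simp only: diff_diff_eq add.assoc add.commute add.left_commute)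
qed

end

section \<open>The terminal functions as radial means\<close>

lemma hh_eq: "hh \<eta> 0 h = hyp h \<eta>" "hh 0 \<eta> h = hyp h \<eta>"
  by (simp_all add: hh_def hyp_def)

lemma R4_eq: "R4 \<eta> 0 h P = hyp (hyp h \<eta>) P" "R4 0 \<eta> h P = hyp (hyp h \<eta>) P"
  by (simp_all add: R4_def hh_eq flip: hyp_def)

lemma \<Phi>1_eq: "\<Phi>1 \<eta> 0 h P = ln_hyp (hyp h \<eta>) (hyp h \<eta>) P / P" "\<Phi>1 0 \<eta> h P = ln_hyp (hyp h \<eta>) (hyp h \<eta>) P / P"
  by (simp_all add: \<Phi>1_def hh_eq R4_eq ln_hyp_def)

lemma \<Phi>2_eq:
  assumes "0 < h"
  shows "\<Phi>2 \<eta> 0 h P \<eta> = angle h \<eta> P / P" "\<Phi>2 0 \<eta> h P \<eta> = angle h \<eta> P / P"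
  using assms by (simp_all add: \<Phi>2_def hh_eq R4_eq angle_def hyp_sq[of h])

lemma \<Phi>3_eq: "\<Phi>3 \<eta> 0 h P = ln_hyp h h (hyp \<eta> P) / hyp \<eta> P"
  by (simp add: \<Phi>3_def R4_eq ln_hyp_def Let_def hyp_commute flip: hyp_def)

lemma \<Phi>4_eq:
  assumes "0 < h" "0 < \<eta>" "0 < P"
  shows "\<Phi>4 0 \<eta> h P = h\<^sup>2 / \<eta>\<^sup>2 * ln_gap h \<eta> P / P"
proof -
  have "h\<^sup>2 / (P\<^sup>2 * \<eta>) * (x / \<eta> * l - m) = h\<^sup>2 / \<eta>\<^sup>2 * ((x * l - \<eta> * m) / P) / P" for x l m
  proof -
    have "x / \<eta> * l - m = (x * l - \<eta> * m) / \<eta>" using assms by (simp add: diff_divide_distrib)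
    then show ?thesis by (simp add: power2_eq_square)
  qed
  then show ?thesis
    by (simp add: \<Phi>4_def R4_eq hh_eq ln_gap_def ln_hyp_def Let_def hyp_commute flip: hyp_def)
qed

text \<open>The candidate \<open>W\<close> is \<open>P\<close> times the claimed value. Its summands
  have elementary derivatives, which the identities above recombine into the required integrand, and
  \<open>W 0 = 0\<close> fixes the constant of integration.\<close>

lemma F1'_eq_radial_mean:
  assumes h: "0 < h" and P: "0 < P" and c: "0 < h1 \<and> h2 = 0 \<or> h1 = 0 \<and> 0 < h2"
  shows "F1' h1 h2 h3 h P = radial_mean 1 (\<lambda>x. radial_mean 2 (\<lambda>x.
    radial_mean 3 (radial_mean 4 (\<lambda>x. 1 / (sqrt (x + h\<^sup>2)) ^ 3)) (x + h2\<^sup>2)) (x + h1\<^sup>2)) (P\<^sup>2)"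
  using c
proof
  assume "0 < h1 \<and> h2 = 0"
  then have h1: "0 < h1" and h2: "h2 = 0" by auto
  define k where "k = hyp h h1"
  have k: "0 < k" unfolding k_def using h by (rule hyp_pos)
  define W where "W P = (ln_hyp k k P + (h1\<^sup>2 - h\<^sup>2) / (2 * h1 * h) * angle h h1 P - P / hyp h1 P * ln_hyp h h (hyp h1 P)
     + P / (hyp k P + h) / 2) / h1\<^sup>2" for P
  have W0: "W 0 = 0" unfolding W_def using k by (simp add: ln_hyp_0 angle_def)
  have dW: "(W has_real_derivative cubic_K h (sqrt (r\<^sup>2 + h1\<^sup>2)) / (r\<^sup>2 + h1\<^sup>2)) (at r)" if "0 \<le> r" for r
  proof -
    have "(W has_real_derivative (1 / hyp k r + (h1\<^sup>2 - h\<^sup>2) / (2 * h1 * h) * (h1 / (hyp k r * (hyp k r + h)))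
       - (h1\<^sup>2 / (hyp h1 r) ^ 3 * ln_hyp h h (hyp h1 r) + r\<^sup>2 / ((hyp h1 r)\<^sup>2 * hyp h (hyp h1 r)))
       + (hyp k r + h - r\<^sup>2 / hyp k r) / (hyp k r + h)\<^sup>2 / 2) / h1\<^sup>2) (at r)"
      unfolding W_def[abs_def]
      by (intro DERIV_cdivide DERIV_add DERIV_diff DERIV_cmult DERIV_ln_hyp k DERIV_angle[OF h, of h1, folded k_def]
          DERIV_ln_hyp_div[OF h h1] DERIV_quotient_hyp[OF k]) (use h in simp)
    also have "hyp h (hyp h1 r) = hyp k r" by (simp add: k_def hyp_commute)
    also note cubic_h1_identity[OF h h1 that k_def refl refl]
    finally show ?thesis
      unfolding cubic_K_def hyp_def[symmetric] ln_hyp_def[of h h, symmetric] hyp_commute[symmetric] k_def[symmetric] hyp_sq .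
  qed
  define z where "z = hyp k P + h"
  have "F1' h1 0 h3 h P = W P / P"
    using h1 P unfolding F1'_def Let_def \<Phi>1_eq \<Phi>2_eq[OF h] \<Phi>3_eq R4_eq W_def k_def[symmetric] z_def[symmetric]
    by (simp add: algebra_simps add_divide_distrib diff_divide_distrib)
  then show ?thesis
    using terminal_closed_h1[OF DERIV_cubic_K[OF h] tendsto_cubic_K[OF h] h1 P W0 dW] h2 by simp
next
  assume "h1 = 0 \<and> 0 < h2"
  then have h1: "h1 = 0" and h2: "0 < h2" by auto
  define k where "k = hyp h h2"
  have k: "0 < k" unfolding k_def using h by (rule hyp_pos)
  define W where "W P = - ((ln_hyp k k P - h / h2 * angle h h2 P - ln_gap h h2 P + P / (hyp k P + k)) / h2\<^sup>2)" for P
  have W0: "W 0 = 0" unfolding W_def using k by (simp add: ln_hyp_0 angle_def ln_gap_def)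
  \<comment> \<open>The derivative is available only for \<open>r > 0\<close>, so continuity at 0 is
    checked separately; it rests on the value of \<open>ln_gap\<close> there.\<close>
  have Wc: "isCont W 0"
    unfolding W_def[abs_def]
    by (intro continuous_intros DERIV_isCont[OF DERIV_ln_hyp[OF k k]] DERIV_isCont[OF DERIV_angle[OF h]]
        isCont_ln_gap[OF h h2] DERIV_isCont[OF DERIV_quotient_hyp[OF k]]) (use k h2 in auto)
  have dW: "(W has_real_derivative (cubic_K h (sqrt (r\<^sup>2 + h2\<^sup>2)) - cubic_K h h2) / r\<^sup>2) (at r)" if r: "0 < r" for r
  proof -
    have "(W has_real_derivative - ((1 / hyp k r - h / h2 * (h2 / (hyp k r * (hyp k r + h)))
       - (ln_hyp h h (hyp h2 r) / hyp h2 r + 1 / hyp h (hyp h2 r) - (hyp h2 r * ln_hyp h h (hyp h2 r) - h2 * ln_hyp h h h2) / r\<^sup>2)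
       + (hyp k r + k - r\<^sup>2 / hyp k r) / (hyp k r + k)\<^sup>2) / h2\<^sup>2)) (at r)"
      unfolding W_def[abs_def]
      by (intro DERIV_minus DERIV_cdivide DERIV_add DERIV_diff DERIV_cmult DERIV_ln_hyp k DERIV_angle[OF h, of h2, folded k_def]
          DERIV_ln_gap[OF h h2 r] DERIV_quotient_hyp[OF k]) (use k in simp)
    also have "hyp h (hyp h2 r) = hyp k r" by (simp add: k_def hyp_commute)
    also note cubic_h2_identity[OF h h2 less_imp_le[OF r] k_def refl refl r]
    finally show ?thesis
      unfolding cubic_K_def hyp_def[symmetric] ln_hyp_def[of h h, symmetric] hyp_commute[symmetric] k_def[symmetric] .
  qed
  have "F1' 0 h2 h3 h P = W P / P"
  proof -
    \<comment> \<open>Both numerators factor as differences of squares, so the bracket is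
      \<open>(hyp k P - h) - (k - h)\<close>, and \<open>hyp k P - k\<close> is
      \<open>P\<^sup>2 / (hyp k P + k)\<close>.\<close>
    have e: "1 / P\<^sup>2 * ((hyp h2 P)\<^sup>2 / (hyp k P + h) - h2\<^sup>2 / (k + h)) = P / (hyp k P + k) / P"
    proof -
      have "hyp k P + h > 0" "k + h > 0" "hyp k P + k > 0" using hyp_pos[OF k, of P] h k by auto
      moreover have "(hyp h2 P)\<^sup>2 = (hyp k P - h) * (hyp k P + h)" "h2\<^sup>2 = (k - h) * (k + h)" "P\<^sup>2 = (hyp k P - k) * (hyp k P + k)"
        using hyp_facts[OF h h2 less_imp_le[OF P] k_def refl refl] by blast+
      moreover have "hyp k P - k > 0" using hyp_sq_above[OF k P] by simp
      ultimately show ?thesis using P by simp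
    qed
    have "h2\<^sup>2 / h\<^sup>2 * (h\<^sup>2 / h2\<^sup>2 * ln_gap h h2 P / P) = ln_gap h h2 P / P" using h h2 by simp
    then show ?thesis
      using h2 P unfolding F1'_def Let_def \<Phi>1_eq \<Phi>2_eq[OF h] \<Phi>4_eq[OF h h2 P] R4_eq hh_eq W_def k_def[symmetric] hyp_def[symmetric] e
      by (simp add: algebra_simps add_divide_distrib diff_divide_distrib)
  qed
  then show ?thesis
    using terminal_closed_h2[OF DERIV_cubic_K[OF h] h2 P W0 Wc dW] h1 by simp
qed

text \<open>There is one radial mean fewer than for \<open>F1'\<close>, since the descent starts
  from a three-dimensional integral, with the Newton kernel.\<close>

lemma F1_tilde_eq_radial_mean:
  assumes h: "0 < h" and P: "0 < P" and c: "0 < h1 \<and> h2 = 0 \<or> h1 = 0 \<and> 0 < h2"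
  shows "F1_tilde h1 h2 h3 h P = radial_mean 1 (\<lambda>x. radial_mean 2 (\<lambda>x.
    radial_mean 3 (\<lambda>x. 1 / sqrt (x + h\<^sup>2)) (x + h2\<^sup>2)) (x + h1\<^sup>2)) (P\<^sup>2)"
  using c
proof
  assume "0 < h1 \<and> h2 = 0"
  then have h1: "0 < h1" and h2: "h2 = 0" by auto
  define k where "k = hyp h h1"
  have k: "0 < k" unfolding k_def using h by (rule hyp_pos)
  define W where "W P = ((1 - h\<^sup>2 / h1\<^sup>2) * ln_hyp k k P - 2 * h / h1 * angle h h1 P
    + h\<^sup>2 / h1\<^sup>2 * (P / hyp h1 P * ln_hyp h h (hyp h1 P))) / 2" for P
  have W0: "W 0 = 0" unfolding W_def using k by (simp add: ln_hyp_0 angle_def)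
  have dW: "(W has_real_derivative newton_K h (sqrt (r\<^sup>2 + h1\<^sup>2)) / (r\<^sup>2 + h1\<^sup>2)) (at r)" if "0 \<le> r" for r
  proof -
    have "(W has_real_derivative ((1 - h\<^sup>2 / h1\<^sup>2) * (1 / hyp k r) - 2 * h / h1 * (h1 / (hyp k r * (hyp k r + h)))
       + h\<^sup>2 / h1\<^sup>2 * (h1\<^sup>2 / (hyp h1 r) ^ 3 * ln_hyp h h (hyp h1 r) + r\<^sup>2 / ((hyp h1 r)\<^sup>2 * hyp h (hyp h1 r)))) / 2) (at r)"
      unfolding W_def[abs_def]
      by (intro DERIV_cdivide DERIV_add DERIV_diff DERIV_cmult DERIV_ln_hyp k DERIV_angle[OF h, of h1, folded k_def]
          DERIV_ln_hyp_div[OF h h1])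
    also have "hyp h (hyp h1 r) = hyp k r" by (simp add: k_def hyp_commute)
    also note newton_h1_identity[OF h h1 that k_def refl refl]
    finally show ?thesis
      unfolding newton_K_def hyp_def[symmetric] ln_hyp_def[of h h, symmetric] hyp_commute[symmetric] k_def[symmetric] hyp_sq .
  qed
  have "F1_tilde h1 0 h3 h P = W P / P"
    using h1 P unfolding F1_tilde_def Let_def \<Phi>1_eq \<Phi>2_eq[OF h] \<Phi>3_eq R4_eq W_def k_def[symmetric]
    by (simp add: algebra_simps add_divide_distrib diff_divide_distrib)
  then show ?thesis
    using terminal_closed_h1[OF DERIV_newton_K[OF h] tendsto_newton_K[OF h] h1 P W0 dW] h2 by simp
next
  assume "h1 = 0 \<and> 0 < h2"
  then have h1: "h1 = 0" and h2: "0 < h2" by auto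
  define k where "k = hyp h h2"
  have k: "0 < k" unfolding k_def using h by (rule hyp_pos)
  define W where "W P = (k\<^sup>2 / h2\<^sup>2 * ln_hyp k k P - P / (hyp k P + k) - h\<^sup>2 / h2\<^sup>2 * ln_gap h h2 P) / 2" for P
  have W0: "W 0 = 0" unfolding W_def using k by (simp add: ln_hyp_0 ln_gap_def)
  have Wc: "isCont W 0"
    unfolding W_def[abs_def]
    by (intro continuous_intros DERIV_isCont[OF DERIV_ln_hyp[OF k k]]
        isCont_ln_gap[OF h h2] DERIV_isCont[OF DERIV_quotient_hyp[OF k]]) (use k h2 in auto)
  have dW: "(W has_real_derivative (newton_K h (sqrt (r\<^sup>2 + h2\<^sup>2)) - newton_K h h2) / r\<^sup>2) (at r)" if r: "0 < r" for r
  proof -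
    have "(W has_real_derivative (k\<^sup>2 / h2\<^sup>2 * (1 / hyp k r) - (hyp k r + k - r\<^sup>2 / hyp k r) / (hyp k r + k)\<^sup>2
       - h\<^sup>2 / h2\<^sup>2 * (ln_hyp h h (hyp h2 r) / hyp h2 r + 1 / hyp h (hyp h2 r) - (hyp h2 r * ln_hyp h h (hyp h2 r) - h2 * ln_hyp h h h2) / r\<^sup>2)) / 2) (at r)"
      unfolding W_def[abs_def]
      by (intro DERIV_cdivide DERIV_add DERIV_diff DERIV_cmult DERIV_ln_hyp k
          DERIV_ln_gap[OF h h2 r] DERIV_quotient_hyp[OF k]) (use k in simp)
    also have "hyp h (hyp h2 r) = hyp k r" by (simp add: k_def hyp_commute)
    also note newton_h2_identity[OF h h2 less_imp_le[OF r] k_def refl refl r]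
    finally show ?thesis
      unfolding newton_K_def hyp_def[symmetric] ln_hyp_def[of h h, symmetric] hyp_commute[symmetric] k_def[symmetric] .
  qed
  define z where "z = hyp k P + k"
  have "F1_tilde 0 h2 h3 h P = W P / P"
    using h2 P unfolding F1_tilde_def Let_def \<Phi>1_eq \<Phi>2_eq[OF h] \<Phi>4_eq[OF h h2 P] R4_eq hh_eq W_def k_def[symmetric] z_def[symmetric]
    by (simp add: algebra_simps add_divide_distrib diff_divide_distrib)
  then show ?thesis
    using terminal_closed_h2[OF DERIV_newton_K[OF h] h2 P W0 Wc dW] h1 by simp
qed

section \<open>Gradients of the layer potentials\<close>

lemma DERIV_inverse_power_sqrt:
  assumes "0 < x + h\<^sup>2"
  shows "((\<lambda>x. 1 / (sqrt (x + h\<^sup>2)) ^ n) has_real_derivative - (n / 2) / (sqrt (x + h\<^sup>2)) ^ (n + 2)) (at x)"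
proof -
  have d: "((\<lambda>x. x + h\<^sup>2) has_real_derivative 1) (at x)" by (auto intro!: derivative_eq_intros)
  define q where "q = sqrt (x + h\<^sup>2)"
  have q: "q > 0" using assms by (simp add: q_def)
  have "((\<lambda>x. sqrt (x + h\<^sup>2)) has_real_derivative inverse q / 2) (at x)"
    unfolding q_def using DERIV_chain2[where f = sqrt and g = "\<lambda>x. x + h\<^sup>2" and x = x, OF DERIV_real_sqrt[OF assms] d] by simp
  from DERIV_power[OF this, of n]
  have "((\<lambda>x. (sqrt (x + h\<^sup>2)) ^ n) has_real_derivative real n * (inverse q / 2 * q ^ (n - 1))) (at x)"
    by (simp add: q_def)
  from DERIV_inverse_fun[OF this] q
  have "((\<lambda>x. inverse ((sqrt (x + h\<^sup>2)) ^ n)) has_real_derivative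
    - (inverse (q ^ n) * (real n * (inverse q / 2 * q ^ (n - 1))) * inverse (q ^ n))) (at x)"
    by (simp add: q_def mult_ac)
  moreover have "inverse (q ^ n) * (real n * (inverse q / 2 * q ^ (n - 1))) * inverse (q ^ n) = (n / 2) / q ^ (n + 2)"
    using q by (cases n) (simp_all add: divide_simps power_add power2_eq_square)
  ultimately show ?thesis by (simp add: q_def inverse_eq_divide)
qed

text \<open>Covers both kernels, \<open>n = 3\<close> for \<open>M\<close> and \<open>n = 1\<close>
  for the edge integrals in \<open>L'\<close>. The shift moves the singularity to
  \<open>- h\<^sup>2\<close>, whence the constant.\<close>

lemma C1_above_inverse_power_sqrt:
  "C1_above (h\<^sup>2) (\<lambda>x. 1 / (sqrt (x + h\<^sup>2)) ^ n) (\<lambda>x. - (n / 2) / (sqrt (x + h\<^sup>2)) ^ (n + 2))"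
  unfolding C1_above_def
proof (intro conjI allI impI)
  show "((\<lambda>x. 1 / (sqrt (x + h\<^sup>2)) ^ n) has_real_derivative - (n / 2) / (sqrt (x + h\<^sup>2)) ^ (n + 2)) (at x)"
    if "- h\<^sup>2 < x" for x
    by (rule DERIV_inverse_power_sqrt) (use that in simp)
qed (auto intro!: continuous_intros)

text \<open>The divergence formula is affine in the offsets \<open>s\<close> and \<open>t\<close>; its slopes are the boundary formulas
  for the two partial derivatives.\<close>

lemma simplex_gradient:
  fixes a b e :: "'a::real_inner"
  defines "X \<equiv> \<lambda>u v. e + u *\<^sub>R a + v *\<^sub>R b"
  assumes C: "C1_above c \<psi> \<psi>'" and c: "0 < c"
  shows "tri_int (\<lambda>u v. 2 * (a \<bullet> X u v) * \<psi>' ((norm (X u v))\<^sup>2)) = line_int \<psi> (b - a) (e + a) - line_int \<psi> b e"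
    and "tri_int (\<lambda>u v. 2 * (b \<bullet> X u v) * \<psi>' ((norm (X u v))\<^sup>2)) = line_int \<psi> (b - a) (e + a) - line_int \<psi> a e"
proof -
  have cP: "continuous_on {-c<..} \<psi>" by (rule C1_above_continuous[OF C])
  have cP': "continuous_on {-c<..} \<psi>'" using C by (simp add: C1_above_def)
  let ?D = "\<lambda>s t u v. 2 * \<psi> ((norm (X u v))\<^sup>2) + (u + s) * (2 * (a \<bullet> X u v) * \<psi>' ((norm (X u v))\<^sup>2))
      + (v + t) * (2 * (b \<bullet> X u v) * \<psi>' ((norm (X u v))\<^sup>2))"
  let ?A = "\<lambda>u v. 2 * (a \<bullet> X u v) * \<psi>' ((norm (X u v))\<^sup>2)" and ?B = "\<lambda>u v. 2 * (b \<bullet> X u v) * \<psi>' ((norm (X u v))\<^sup>2)"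
  have cont: "continuous_on UNIV (\<lambda>p. ?D s t (fst p) (snd p))" "continuous_on UNIV (\<lambda>p. ?A (fst p) (snd p))"
    "continuous_on UNIV (\<lambda>p. ?B (fst p) (snd p))" for s t
    unfolding X_def by (intro continuous_intros continuous_on_sq_norm[OF cP c] continuous_on_sq_norm[OF cP' c])+
  have D: "tri_int (?D s t) = (1 + s + t) * line_int \<psi> (b - a) (e + a) - s * line_int \<psi> b e - t * line_int \<psi> a e" for s t
    unfolding X_def by (rule simplex_divergence[OF C c])
  have "(\<lambda>u v. ?D 0 0 u v + ?A u v) = ?D 1 0" by (simp add: fun_eq_iff algebra_simps)
  then show "tri_int ?A = line_int \<psi> (b - a) (e + a) - line_int \<psi> b e"
    using tri_int_add[OF cont(1)[of 0 0] cont(2)] D[of 0 0] D[of 1 0] by (simp only:) simp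
  have "(\<lambda>u v. ?D 0 0 u v + ?B u v) = ?D 0 1" by (simp add: fun_eq_iff algebra_simps)
  then show "tri_int ?B = line_int \<psi> (b - a) (e + a) - line_int \<psi> a e"
    using tri_int_add[OF cont(1)[of 0 0] cont(3)] D[of 0 0] D[of 0 1] by (simp only:) simp
qed

section \<open>Gradients and differentiation under the integral\<close>

lemma gradient_eqI: "GDERIV f x :> D \<Longrightarrow> gradient f x = D"
  unfolding gradient_def
proof (rule the_equality)
  fix D' assume "GDERIV f x :> D" "GDERIV f x :> D'"
  then have "(\<lambda>h. h \<bullet> D') = (\<lambda>h. h \<bullet> D)" unfolding gderiv_def by (rule has_derivative_unique[rotated])
  then show "D' = D" by (metis vector_eq_ldot)
qed

lemma GDERIV_inverse_norm:
  fixes z :: "'a::real_inner"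
  assumes "z \<noteq> 0"
  shows "GDERIV (\<lambda>z. 1 / norm z) z :> - (z /\<^sub>R norm z ^ 3)"
proof -
  have "((\<lambda>r. 1 / r) has_real_derivative - (1 / (norm z)\<^sup>2)) (at (norm z))"
    using assms by (auto intro!: derivative_eq_intros simp: power2_eq_square)
  from GDERIV_DERIV_compose[OF GDERIV_norm[OF assms] this] show ?thesis
    by (rule GDERIV_subst) (simp add: sgn_div_norm power2_eq_square power3_eq_cube divide_inverse)
qed

lemma GDERIV_G:
  assumes "x \<noteq> y"
  shows "GDERIV (\<lambda>x. G x y) x :> - ((x - y) /\<^sub>R norm (x - y) ^ 3)"
    and "GDERIV (\<lambda>y. G x y) y :> (x - y) /\<^sub>R norm (x - y) ^ 3"
proof -
  have 0: "((\<lambda>z. 1 / norm z) has_derivative (\<lambda>h. h \<bullet> - ((x - y) /\<^sub>R norm (x - y) ^ 3))) (at (x - y))"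
    using GDERIV_inverse_norm[of "x - y"] assms by (simp add: gderiv_def)
  have 1: "((\<lambda>x. x - y) has_derivative (\<lambda>h. h)) (at x)" and 2: "((\<lambda>y. x - y) has_derivative (\<lambda>h. - h)) (at y)"
    by (auto intro!: derivative_eq_intros)
  show "GDERIV (\<lambda>x. G x y) x :> - ((x - y) /\<^sub>R norm (x - y) ^ 3)"
    unfolding gderiv_def G_def using has_derivative_compose[OF 1 0] by simp
  show "GDERIV (\<lambda>y. G x y) y :> (x - y) /\<^sub>R norm (x - y) ^ 3"
    unfolding gderiv_def G_def using has_derivative_compose[OF 2 0] by simp
qed

lemma GDERIV_cmult: "GDERIV f x :> D \<Longrightarrow> GDERIV (\<lambda>x. k * f x) x :> k *\<^sub>R D"
  unfolding gderiv_def by (drule has_derivative_mult_right[of _ _ _ k]) simp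

lemma GDERIV_cong_open:
  assumes "open U" "y \<in> U" "\<And>z. z \<in> U \<Longrightarrow> f z = g z" "GDERIV g y :> D"
  shows "GDERIV f y :> D"
  using assms unfolding gderiv_def by (metis has_derivative_transform_within_open)

lemma GDERIV_tri_int:
  fixes f :: "real \<Rightarrow> real \<Rightarrow> 'a::euclidean_space \<Rightarrow> real" and D :: "real \<Rightarrow> real \<Rightarrow> 'a \<Rightarrow> 'a"
  assumes U: "open U" "convex U" "y \<in> U"
    and d: "\<And>u v z. z \<in> U \<Longrightarrow> GDERIV (f u v) z :> D u v z"
    and f: "\<And>z. z \<in> U \<Longrightarrow> continuous_on UNIV (\<lambda>p. f (fst p) (snd p) z)"
    and D: "continuous_on (U \<times> UNIV) (\<lambda>q. D (fst (snd q)) (snd (snd q)) (fst q))"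
  shows "GDERIV (\<lambda>y. tri_int (\<lambda>u v. f u v y)) y :> tri_int (\<lambda>u v. D u v y)"
proof -
  let ?S = "cbox (0, 0) (1, 1) :: (real \<times> real) set"
  let ?w = "\<lambda>p::real \<times> real. 1 - fst p" and ?m = "\<lambda>p::real \<times> real. (snd p * (1 - fst p), fst p)"
  have D1: "continuous_on UNIV (\<lambda>p. D (fst p) (snd p) y)"
    by (rule continuous_on_compose2[OF D, of _ "\<lambda>p. (y, p)", simplified]) (use U in \<open>auto intro!: continuous_intros\<close>)
  let ?V = "\<lambda>z p. ?w p *\<^sub>R D (snd p * (1 - fst p)) (fst p) z"
  have cV: "continuous_on (U \<times> ?S) (\<lambda>q. ?V (fst q) (snd q))"
    by (intro continuous_intros continuous_on_compose2[OF D, of _ "\<lambda>q. (fst q, snd (snd q) * (1 - fst (snd q)), fst (snd q))", simplified])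
      auto
  have V1: "?V y integrable_on ?S"
    by (rule integrable_continuous, rule continuous_on_tri_integrand[OF D1])
  \<comment> \<open>The Leibniz rule takes derivatives as bounded linear maps that depend
    continuously on the point; \<open>blinfun_inner_left\<close> turns the gradient vectors into
    such maps.\<close>
  have "((\<lambda>z. integral ?S (\<lambda>p. ?w p *\<^sub>R f (snd p * (1 - fst p)) (fst p) z)) has_derivative
      integral ?S (\<lambda>p. blinfun_inner_left (?V y p))) (at y within U)"
  proof (rule leibniz_rule[OF _ _ _ U(3) U(2)])
    fix z p assume z: "z \<in> U"
    show "((\<lambda>z. ?w p *\<^sub>R f (snd p * (1 - fst p)) (fst p) z) has_derivative blinfun_inner_left (?V z p)) (at z within U)"
      by (rule has_derivative_eq_rhs[OF has_derivative_scaleR_right[OF has_derivative_at_withinI[OF d[OF z, unfolded gderiv_def]]]])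
        (simp add: fun_eq_iff)
  next
    fix z assume "z \<in> U"
    then show "(\<lambda>p. ?w p *\<^sub>R f (snd p * (1 - fst p)) (fst p) z) integrable_on ?S"
      by (intro integrable_continuous continuous_on_tri_integrand f)
  next
    show "continuous_on (U \<times> ?S) (\<lambda>(z, p). blinfun_inner_left (?V z p))"
      using bounded_linear.continuous_on[OF bounded_linear_blinfun_inner_left cV] by (simp add: split_beta)
  qed
  moreover have "integral ?S (\<lambda>p. blinfun_inner_left (?V y p)) = blinfun_inner_left (integral ?S (?V y))"
    using integral_linear[OF V1 bounded_linear_blinfun_inner_left] by (simp add: o_def)
  moreover have "integral ?S (?V y) = tri_int (\<lambda>u v. D u v y)"
    using tri_int_eq_integral[OF D1] by simp
  ultimately have "((\<lambda>z. integral ?S (\<lambda>p. ?w p *\<^sub>R f (snd p * (1 - fst p)) (fst p) z)) has_derivative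
      (\<lambda>h. h \<bullet> tri_int (\<lambda>u v. D u v y))) (at y)"
    using U by (simp add: at_within_open[of y U])
  then have "GDERIV (\<lambda>z. integral ?S (\<lambda>p. ?w p *\<^sub>R f (snd p * (1 - fst p)) (fst p) z)) y :> tri_int (\<lambda>u v. D u v y)"
    by (simp add: gderiv_def)
  then show ?thesis
    by (rule GDERIV_cong_open[OF U(1,3), rotated]) (rule tri_int_eq_integral[OF f])
qed

lemma set_integral_cong_on:
  "(\<And>x. x \<in> S \<Longrightarrow> f x = g x) \<Longrightarrow> (LINT x:S|M. f x) = (LINT x:S|M. g x)"
  unfolding set_lebesgue_integral_def by (intro Bochner_Integration.integral_cong) (auto simp: indicator_def)

section \<open>Triangles in parallel planes\<close>

lemma cross3_nonzero:
  assumes "\<not> collinear {a, b, c :: real^3}"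
  shows "cross3 (b - a) (c - a) \<noteq> 0"
  using assms collinear_3[of b a c] by (simp add: cross_eq_0 insert_commute)

lemma not_in_span_of_cross3:
  assumes "cross3 a b \<noteq> 0"
  shows "a \<notin> span {b}" "b \<noteq> 0"
  using assms by (auto simp: span_singleton cross_mult_left)

text \<open>The sign in the definition is undone by \<open>x1 - x3 = - (x3 - x1)\<close>, and twice
  the area is the norm of the cross product.\<close>

lemma unit_normal_eq:
  assumes "\<not> collinear {x1, x2, x3}"
  shows "unit_normal x1 x2 x3 = cross3 (x2 - x1) (x3 - x1) /\<^sub>R norm (cross3 (x2 - x1) (x3 - x1))"
proof -
  have "cross3 (x2 - x1) (x1 - x3) = - cross3 (x2 - x1) (x3 - x1)"
    using cross_minus_right[of "x2 - x1" "x3 - x1"] by simp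
  then show ?thesis unfolding unit_normal_def norm_cross_eq_area[OF assms] by simp
qed

text \<open>A vector orthogonal to both sides is parallel to their cross product, so Cauchy-Schwarz
  is an equality. This serves both to compute \<open>h4\<close> and to show that a vector is
  zero.\<close>

lemma norm_eq_abs_inner_unit_normal:
  fixes v a b :: "real^3"
  assumes "v \<bullet> a = 0" "v \<bullet> b = 0" "cross3 a b \<noteq> 0"
  shows "norm v = \<bar>v \<bullet> (cross3 a b /\<^sub>R norm (cross3 a b))\<bar>"
proof -
  have "cross3 v (cross3 a b) = 0" using assms by (simp add: Lagrange)
  then have "(v \<bullet> cross3 a b)\<^sup>2 = (norm v * norm (cross3 a b))\<^sup>2"
    using norm_cross_dot[of v "cross3 a b"] by simp
  then have "\<bar>v \<bullet> cross3 a b\<bar> = norm v * norm (cross3 a b)"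
    by (metis abs_mult abs_norm_cancel real_sqrt_abs)
  then show ?thesis using assms(3) by (simp add: abs_mult)
qed

lemma affine_hull_triangle: "affine hull {a, b, c} = (+) a ` span {b - a, c - a}"
  using affine_hull_insert_span_gen[of a "{b, c}"] by simp

text \<open>Translates of a plane share their direction space: one inclusion comes from differences
  of points, the other from the dimension.\<close>

lemma affine_parallel_triangles_span:
  fixes x1 x2 x3 y1 y2 y3 :: "real^3"
  assumes "\<not> collinear {y1, y2, y3}"
    and par: "affine_parallel (affine hull {x1, x2, x3}) (affine hull {y1, y2, y3})"
  shows "span {y2 - y1, y3 - y1} = span {x2 - x1, x3 - x1}"
proof -
  obtain t where t: "affine hull {y1, y2, y3} = (+) t ` (+) x1 ` span {x2 - x1, x3 - x1}"
    using par unfolding affine_parallel_def affine_hull_triangle[of x1 x2 x3] by blast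
  have "y1 \<in> affine hull {y1, y2, y3}" "y2 \<in> affine hull {y1, y2, y3}" "y3 \<in> affine hull {y1, y2, y3}"
    by (auto intro: hull_inc)
  then obtain w1 w2 w3 where w: "y1 = t + (x1 + w1)" "y2 = t + (x1 + w2)" "y3 = t + (x1 + w3)"
    and W: "w1 \<in> span {x2 - x1, x3 - x1}" "w2 \<in> span {x2 - x1, x3 - x1}" "w3 \<in> span {x2 - x1, x3 - x1}"
    unfolding t by blast
  have d: "y2 - y1 \<in> span {x2 - x1, x3 - x1}" "y3 - y1 \<in> span {x2 - x1, x3 - x1}"
    using span_diff[OF W(2,1)] span_diff[OF W(3,1)] by (simp_all add: w)
  then have "span {x2 - x1, x3 - x1} \<subseteq> span {y2 - y1, y3 - y1}"
    using not_in_span_of_cross3[OF cross3_nonzero[OF assms(1)]] by (intro span_insert_subset_2dim)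
  moreover have "span {y2 - y1, y3 - y1} \<subseteq> span {x2 - x1, x3 - x1}"
    using d by (intro span_minimal) auto
  ultimately show ?thesis by blast
qed

text \<open>Otherwise both planes would be the same translate of the direction space.\<close>

lemma affine_parallel_triangles_offset:
  fixes x1 x2 x3 y1 y2 y3 :: "real^3"
  assumes "\<not> collinear {y1, y2, y3}"
    and par: "affine_parallel (affine hull {x1, x2, x3}) (affine hull {y1, y2, y3})"
    and ne: "affine hull {x1, x2, x3} \<noteq> affine hull {y1, y2, y3}"
  shows "x1 - y1 \<notin> span {x2 - x1, x3 - x1}"
proof
  assume e: "x1 - y1 \<in> span {x2 - x1, x3 - x1}"
  have "affine hull {y1, y2, y3} = (+) y1 ` span {x2 - x1, x3 - x1}"
    unfolding affine_hull_triangle[of y1] affine_parallel_triangles_span[OF assms(1,2)] ..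
  also have "\<dots> = (+) x1 ` span {x2 - x1, x3 - x1}"
  proof (intro equalityI subsetI)
    fix p assume "p \<in> (+) y1 ` span {x2 - x1, x3 - x1}"
    then obtain w where "w \<in> span {x2 - x1, x3 - x1}" "p = y1 + w" by blast
    then show "p \<in> (+) x1 ` span {x2 - x1, x3 - x1}"
      using span_diff[OF _ e] by (intro image_eqI[of _ _ "w - (x1 - y1)"]) auto
  next
    fix p assume "p \<in> (+) x1 ` span {x2 - x1, x3 - x1}"
    then obtain w where "w \<in> span {x2 - x1, x3 - x1}" "p = x1 + w" by blast
    then show "p \<in> (+) y1 ` span {x2 - x1, x3 - x1}"
      using span_add[OF _ e] by (intro image_eqI[of _ _ "w + (x1 - y1)"]) auto
  qed
  finally show False using ne affine_hull_triangle[of x1] by simp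
qed

text \<open>The edge length in the formula for \<open>L'\<close> cancels the normalisation of the
  conormal, so only \<open>cross3 l n\<close> enters the computation.\<close>

lemma scaleR_conormal: "(k * norm l) *\<^sub>R conormal l n = k *\<^sub>R cross3 l n"
  by (cases "l = 0") (simp_all add: conormal_def)

text \<open>For \<open>x\<close> and \<open>y\<close> in the two planes \<open>norm (x - y) \<ge> \<bar>\<delta>\<bar>\<close>; the truncation makes the kernels continuous
  on the whole space.\<close>

definition trunc_dist :: "real \<Rightarrow> real^3 \<Rightarrow> real^3 \<Rightarrow> real" where
  "trunc_dist \<delta> x y = max (norm (x - y)) \<bar>\<delta>\<bar>"

lemma trunc_dist_pos: "\<delta> \<noteq> 0 \<Longrightarrow> trunc_dist \<delta> x y \<noteq> 0"
  by (auto simp: trunc_dist_def max_def)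

lemma continuous_on_trunc_dist [continuous_intros]:
  "continuous_on S f \<Longrightarrow> continuous_on S g \<Longrightarrow> continuous_on S (\<lambda>q. trunc_dist \<delta> (f q) (g q))"
  unfolding trunc_dist_def by (intro continuous_intros)

text \<open>The two planes are parametrised by \<open>x\<^sub>1 + u a\<^sub>1 + v a\<^sub>2\<close> and \<open>y\<^sub>1 - w a\<^sub>3 - z a\<^sub>4\<close>, so that differences of
  points run through \<open>e + u a\<^sub>1 + v a\<^sub>2 + w a\<^sub>3 + z a\<^sub>4\<close>.\<close>

locale parallel_triangles =
  fixes x1 x2 x3 y1 y2 y3 :: "real^3"
  assumes ncx: "\<not> collinear {x1, x2, x3}" and ncy: "\<not> collinear {y1, y2, y3}"
    and parallel: "affine_parallel (affine hull {x1, x2, x3}) (affine hull {y1, y2, y3})"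
    and distinct: "affine hull {x1, x2, x3} \<noteq> affine hull {y1, y2, y3}"
begin

definition "a1 = x2 - x1"
definition "a2 = x3 - x1"
definition "a3 = - (y2 - y1)"
definition "a4 = - (y3 - y1)"
definition "e = x1 - y1"
definition "n = unit_normal x1 x2 x3"
definition "\<delta> = n \<bullet> (y1 - x1)"
definition "Ax = surface_area (convex hull {x1, x2, x3})"
definition "Ay = surface_area (convex hull {y1, y2, y3})"
definition "d u v w z = e + u *\<^sub>R a1 + v *\<^sub>R a2 + w *\<^sub>R a3 + z *\<^sub>R a4"
definition "e' = e_par [a1, a2, a3, a4] e"

lemma cross_a: "cross3 a1 a2 \<noteq> 0" and cross_y: "cross3 (y2 - y1) (y3 - y1) \<noteq> 0"
  unfolding a1_def a2_def by (rule cross3_nonzero[OF ncx] cross3_nonzero[OF ncy])+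

lemma a_span: "a1 \<notin> span {a2}" "a2 \<noteq> 0" "a3 \<notin> span {a4}" "a4 \<noteq> 0"
proof -
  show "a1 \<notin> span {a2}" "a2 \<noteq> 0" by (rule not_in_span_of_cross3[OF cross_a])+
  have "cross3 a3 a4 \<noteq> 0" using cross_y unfolding a3_def a4_def cross_minus_left cross_minus_right by simp
  then show "a3 \<notin> span {a4}" "a4 \<noteq> 0" by (rule not_in_span_of_cross3)+
qed

lemma span_neg2: "span {- p, - q} = span {p, q}" for p q :: "real^3"
proof (rule equalityI; rule span_minimal; (rule subspace_span)?)
  have "- p \<in> span {p, q}" "- q \<in> span {p, q}"
    by (rule span_neg, rule span_base, blast)+
  then show "{- p, - q} \<subseteq> span {p, q}" by blast
  have "- (- p) \<in> span {- p, - q}" "- (- q) \<in> span {- p, - q}"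
    by (rule span_neg, rule span_base, blast)+
  then show "{p, q} \<subseteq> span {- p, - q}" unfolding minus_minus by blast
qed

lemma span_a34: "span {a3, a4} = span {a1, a2}"
  unfolding a3_def a4_def a1_def a2_def span_neg2 by (rule affine_parallel_triangles_span[OF ncy parallel])

lemma a_in: "a1 \<in> span {a1, a2}" "a2 \<in> span {a1, a2}" "a3 \<in> span {a1, a2}" "a4 \<in> span {a1, a2}"
  using span_base[of a3 "{a3, a4}"] span_base[of a4 "{a3, a4}"] unfolding span_a34 by (auto intro: span_base)

lemma n_eq: "n = cross3 a1 a2 /\<^sub>R norm (cross3 a1 a2)"
  unfolding n_def a1_def a2_def by (rule unit_normal_eq[OF ncx])

lemma norm_cross_a: "norm (cross3 a1 a2) = 2 * Ax"
  unfolding a1_def a2_def Ax_def by (rule norm_cross_eq_area[OF ncx])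

lemma norm_cross_y: "norm (cross3 (y2 - y1) (y3 - y1)) = 2 * Ay"
  unfolding Ay_def by (rule norm_cross_eq_area[OF ncy])

lemma n_unit: "n \<bullet> n = 1"
  using cross_a unfolding n_eq by (simp add: dot_square_norm power2_eq_square)

lemma cross_a_eq: "cross3 a1 a2 = (2 * Ax) *\<^sub>R n"
  unfolding norm_cross_a[symmetric] n_eq using cross_a by simp

lemma n_orth: "w \<in> span {a1, a2} \<Longrightarrow> n \<bullet> w = 0"
proof -
  assume "w \<in> span {a1, a2}"
  moreover have "\<forall>x \<in> {a1, a2}. orthogonal n x" unfolding n_eq by (auto simp: orthogonal_def dot_cross_self)
  ultimately show "n \<bullet> w = 0" using orthogonal_to_span[of w "{a1, a2}" n] by (auto simp: orthogonal_def)
qed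

lemma norm_of_orth: "v \<bullet> a1 = 0 \<Longrightarrow> v \<bullet> a2 = 0 \<Longrightarrow> norm v = \<bar>v \<bullet> n\<bar>"
  unfolding n_eq by (rule norm_eq_abs_inner_unit_normal[OF _ _ cross_a])

lemma span_a1234: "span (set [a1, a2, a3, a4]) = span {a1, a2}"
proof (rule equalityI)
  show "span (set [a1, a2, a3, a4]) \<subseteq> span {a1, a2}" using a_in by (intro span_minimal) auto
  show "span {a1, a2} \<subseteq> span (set [a1, a2, a3, a4])" by (rule span_mono) auto
qed

lemma n_e: "n \<bullet> e = - \<delta>"
  by (simp add: \<delta>_def e_def inner_diff_right)

lemma e'_in: "e' \<in> span {a1, a2}"
  using e_par(1)[of "[a1, a2, a3, a4]" e] span_a1234 unfolding e'_def by simp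

text \<open>The orthogonal part of \<open>e\<close> is normal to the planes, so its length is the
  size of its component along \<open>n\<close>, which is that of \<open>e\<close>.\<close>

lemma h_perp_eq: "h_perp [a1, a2, a3, a4] e = \<bar>\<delta>\<bar>"
proof -
  have o: "(e - e') \<bullet> w = 0" if "w \<in> span {a1, a2}" for w
    using e_par(2)[of "[a1, a2, a3, a4]" e] that span_a1234 unfolding e'_def by (auto simp: orthogonal_def)
  have "norm (e - e') = \<bar>(e - e') \<bullet> n\<bar>" using o a_in by (intro norm_of_orth) auto
  also have "(e - e') \<bullet> n = - \<delta>" using n_orth[OF e'_in] n_e by (simp add: inner_commute[of _ n] inner_diff_right)
  finally show ?thesis by (simp add: h_perp_def e'_def)
qed

lemma \<delta>_nonzero: "\<delta> \<noteq> 0"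
proof
  assume "\<delta> = 0"
  then have "h_perp [a1, a2, a3, a4] e = 0" using h_perp_eq by simp
  then have "e \<in> span {a1, a2}" unfolding h_perp_eq_0_iff span_a1234 .
  then show False
    using affine_parallel_triangles_offset[OF ncy parallel distinct] unfolding a1_def a2_def e_def by simp
qed

lemma normal_diff:
  assumes "x \<in> affine hull {x1, x2, x3}" "y \<in> affine hull {y1, y2, y3}"
  shows "n \<bullet> (y - x) = \<delta>"
proof -
  obtain w where w: "x = x1 + w" "w \<in> span {a1, a2}"
    using assms(1) unfolding affine_hull_triangle a1_def a2_def by blast
  obtain w' where w': "y = y1 + w'" "w' \<in> span {a1, a2}"
    using assms(2) unfolding affine_hull_triangle affine_parallel_triangles_span[OF ncy parallel] a1_def a2_def by blast
  show ?thesis using n_orth[OF w(2)] n_orth[OF w'(2)] by (simp add: w w' \<delta>_def inner_diff_right inner_add_right)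
qed

lemma normal_diff_in_plane:
  assumes "x \<in> affine hull {x1, x2, x3}"
  shows "n \<bullet> (x - x1) = 0"
proof -
  have "y1 \<in> affine hull {y1, y2, y3}" by (auto intro: hull_inc)
  from normal_diff[OF assms this] show ?thesis by (simp add: \<delta>_def inner_diff_right)
qed

lemma trunc_dist_eq:
  assumes "x \<in> affine hull {x1, x2, x3}" "y \<in> affine hull {y1, y2, y3}"
  shows "trunc_dist \<delta> x y = norm (x - y)" "x \<noteq> y"
proof -
  have "norm n = 1" using n_unit by (simp add: norm_eq_1)
  then have "\<bar>\<delta>\<bar> \<le> norm (x - y)"
    using Cauchy_Schwarz_ineq2[of n "y - x"] normal_diff[OF assms] by (simp add: norm_minus_commute)
  then show "trunc_dist \<delta> x y = norm (x - y)" "x \<noteq> y" using \<delta>_nonzero by (auto simp: trunc_dist_def)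
qed

lemma diff_param:
  "(x1 + u *\<^sub>R (x2 - x1) + v *\<^sub>R (x3 - x1)) - (y1 + w *\<^sub>R (y2 - y1) + z *\<^sub>R (y3 - y1)) = d u v w z"
  by (simp add: d_def e_def a1_def a2_def a3_def a4_def algebra_simps)

lemma d_inner_n: "d u v w z \<bullet> n = - \<delta>"
  unfolding d_def using n_e n_orth a_in by (simp add: inner_commute[of _ n] inner_add_right)

lemma d_nonzero: "d u v w z \<noteq> 0"
  using d_inner_n[of u v w z] \<delta>_nonzero by auto

lemma continuous_on_d [continuous_intros]:
  "continuous_on S f \<Longrightarrow> continuous_on S g \<Longrightarrow> continuous_on S h \<Longrightarrow> continuous_on S k \<Longrightarrow>
    continuous_on S (\<lambda>q. d (f q) (g q) (h q) (k q))"
  unfolding d_def by (intro continuous_intros)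

lemma norm_d_sq: "(norm (d u v w z))\<^sup>2 = (norm (e' + u *\<^sub>R a1 + v *\<^sub>R a2 + w *\<^sub>R a3 + z *\<^sub>R a4))\<^sup>2 + \<bar>\<delta>\<bar>\<^sup>2"
proof -
  have "u *\<^sub>R a1 + v *\<^sub>R a2 + w *\<^sub>R a3 + z *\<^sub>R a4 \<in> span (set [a1, a2, a3, a4])"
    unfolding span_a1234 by (intro span_add span_scale a_in)
  from norm_e_par_add[OF this, of e] show ?thesis unfolding h_perp_eq d_def e'_def by (simp add: add.assoc)
qed

text \<open>Up to the factor \<open>4 * Ax * Ay\<close> this is \<open>L'\<close>, as the gradient
  of \<open>G\<close> in \<open>y\<close> is the difference of the points over the cube of its
  length. The scalar \<open>Z0\<close> gives \<open>M\<close> after the same factor and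
  \<open>\<delta>\<close>.\<close>

definition "Z = tri_int (\<lambda>w z. tri_int (\<lambda>u v. d u v w z /\<^sub>R norm (d u v w z) ^ 3))"
definition "Z0 = tri_int (\<lambda>w z. tri_int (\<lambda>u v. 1 / norm (d u v w z) ^ 3))"

section \<open>The layer integrals in parameters\<close>

lemma double_layer_integral:
  "(LINT y:convex hull {y1, y2, y3}|surface_measure (convex hull {y1, y2, y3}).
     LINT x:convex hull {x1, x2, x3}|surface_measure (convex hull {x1, x2, x3}). n \<bullet> gradient (\<lambda>x. G x y) x)
   = 4 * Ax * Ay * \<delta> * Z0" (is "(LINT y:?Sy|_. LINT x:?Sx|_. _) = _")
proof -
  have Sx: "x \<in> ?Sx \<Longrightarrow> x \<in> affine hull {x1, x2, x3}" and Sy: "y \<in> ?Sy \<Longrightarrow> y \<in> affine hull {y1, y2, y3}" for x y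
    using convex_hull_subset_affine_hull by blast+
  let ?k = "\<lambda>x y. \<delta> / trunc_dist \<delta> x y ^ 3"
  let ?X = "\<lambda>u v. x1 + u *\<^sub>R (x2 - x1) + v *\<^sub>R (x3 - x1)" and ?Y = "\<lambda>w z. y1 + w *\<^sub>R (y2 - y1) + z *\<^sub>R (y3 - y1)"
  have k: "n \<bullet> gradient (\<lambda>x. G x y) x = ?k x y" if "x \<in> ?Sx" "y \<in> ?Sy" for x y
  proof -
    have "n \<bullet> (x - y) = - \<delta>" using normal_diff[OF Sx[OF that(1)] Sy[OF that(2)]] by (simp add: inner_diff_right)
    then show ?thesis
      using trunc_dist_eq[OF Sx[OF that(1)] Sy[OF that(2)]] gradient_eqI[OF GDERIV_G(1), of x y] by (simp add: divide_inverse)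
  qed
  have inner: "(LINT x:?Sx|surface_measure ?Sx. ?k x y) = 2 * Ax * tri_int (\<lambda>u v. ?k (?X u v) y)" for y
    unfolding norm_cross_a[symmetric] a1_def a2_def
    by (rule surface_integral_triangle[OF ncx]) (use \<delta>_nonzero trunc_dist_pos in \<open>auto intro!: continuous_intros\<close>)
  have c: "continuous_on UNIV (\<lambda>y. 2 * Ax * tri_int (\<lambda>u v. ?k (?X u v) y))"
    by (intro continuous_intros continuous_on_tri_int) (use \<delta>_nonzero trunc_dist_pos in auto)
  have "(LINT y:?Sy|surface_measure ?Sy. LINT x:?Sx|surface_measure ?Sx. n \<bullet> gradient (\<lambda>x. G x y) x)
    = (LINT y:?Sy|surface_measure ?Sy. 2 * Ax * tri_int (\<lambda>u v. ?k (?X u v) y))"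
    unfolding inner[symmetric] by (intro set_integral_cong_on k)
  also have "\<dots> = 2 * Ay * tri_int (\<lambda>w z. 2 * Ax * tri_int (\<lambda>u v. ?k (?X u v) (?Y w z)))"
    unfolding norm_cross_y[symmetric]
    by (rule surface_integral_triangle[OF ncy continuous_on_subset[OF c subset_UNIV]])
  also have "(\<lambda>w z. 2 * Ax * tri_int (\<lambda>u v. ?k (?X u v) (?Y w z))) = (\<lambda>w z. 2 * Ax * (\<delta> * tri_int (\<lambda>u v. 1 / norm (d u v w z) ^ 3)))"
    unfolding trunc_dist_eq[OF affine_hull_param_mem affine_hull_param_mem] diff_param
    by (subst tri_int_cmult[symmetric]) simp
  finally show ?thesis unfolding tri_int_cmult Z0_def by simp
qed

lemma gradient_single_layer:
  assumes y: "y \<in> affine hull {y1, y2, y3}"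
  shows "gradient (\<lambda>y. LINT x:convex hull {x1, x2, x3}|surface_measure (convex hull {x1, x2, x3}). G x y) y
    = (2 * Ax) *\<^sub>R tri_int (\<lambda>u v. (x1 + u *\<^sub>R (x2 - x1) + v *\<^sub>R (x3 - x1) - y) /\<^sub>R
        norm (x1 + u *\<^sub>R (x2 - x1) + v *\<^sub>R (x3 - x1) - y) ^ 3)"
proof -
  let ?X = "\<lambda>u v. x1 + u *\<^sub>R (x2 - x1) + v *\<^sub>R (x3 - x1)" and ?Sx = "convex hull {x1, x2, x3}"
  \<comment> \<open>The open half-space on that side of the \<open>x\<close>-plane which contains
    \<open>y\<close>; the factor \<open>\<delta>\<close> selects the side whatever its sign. It is
    convex and stays away from the singularity, as differentiation under the integral
    requires.\<close>
  define U where "U = {z. (\<delta> *\<^sub>R n) \<bullet> z > (\<delta> *\<^sub>R n) \<bullet> x1}"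
  have U: "open U" "convex U" unfolding U_def by (rule open_halfspace_gt convex_halfspace_gt)+
  have "x1 \<in> affine hull {x1, x2, x3}" by (auto intro: hull_inc)
  from normal_diff[OF this y] have "(\<delta> *\<^sub>R n) \<bullet> y - (\<delta> *\<^sub>R n) \<bullet> x1 = \<delta> * \<delta>"
    by (simp flip: inner_diff_right right_diff_distrib)
  moreover have "\<delta> * \<delta> > 0" using \<delta>_nonzero not_real_square_gt_zero by blast
  ultimately have yU: "y \<in> U" unfolding U_def mem_Collect_eq by linarith
  have ne: "x \<noteq> z" if "x \<in> affine hull {x1, x2, x3}" "z \<in> U" for x z
    using normal_diff_in_plane[OF that(1)] that(2) by (auto simp: U_def inner_diff_right)
  have ne': "?X u v \<noteq> z" if "z \<in> U" for u v z
    using ne[OF affine_hull_param_mem that] .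
  have "(LINT x:?Sx|surface_measure ?Sx. G x z) = 2 * Ax * tri_int (\<lambda>u v. G (?X u v) z)" if z: "z \<in> U" for z
    unfolding norm_cross_a[symmetric] a1_def a2_def
    by (rule surface_integral_triangle[OF ncx]) (use ne z in \<open>auto simp: G_def intro!: continuous_intros\<close>)
  moreover have "GDERIV (\<lambda>z. 2 * Ax * tri_int (\<lambda>u v. G (?X u v) z)) y :>
      (2 * Ax) *\<^sub>R tri_int (\<lambda>u v. (?X u v - y) /\<^sub>R norm (?X u v - y) ^ 3)"
  proof (rule GDERIV_cmult, rule GDERIV_tri_int[OF U yU])
    show "GDERIV (G (?X u v)) z :> (?X u v - z) /\<^sub>R norm (?X u v - z) ^ 3" if "z \<in> U" for u v z
      by (rule GDERIV_G(2)[OF ne'[OF that]])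
    show "continuous_on UNIV (\<lambda>p. G (?X (fst p) (snd p)) z)" if "z \<in> U" for z
      unfolding G_def using ne'[OF that] by (auto intro!: continuous_intros)
    show "continuous_on (U \<times> UNIV) (\<lambda>q. (?X (fst (snd q)) (snd (snd q)) - fst q) /\<^sub>R norm (?X (fst (snd q)) (snd (snd q)) - fst q) ^ 3)"
      using ne' by (auto intro!: continuous_intros)
  qed
  ultimately show ?thesis
    by (intro gradient_eqI) (rule GDERIV_cong_open[OF U(1) yU])
qed

lemma single_layer_gradient_integral:
  "(LINT y:convex hull {y1, y2, y3}|surface_measure (convex hull {y1, y2, y3}).
     gradient (\<lambda>y. LINT x:convex hull {x1, x2, x3}|surface_measure (convex hull {x1, x2, x3}). G x y) y)
   = (4 * Ax * Ay) *\<^sub>R Z" (is "(LINT y:?Sy|_. ?g y) = _")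
proof -
  have Sy: "y \<in> ?Sy \<Longrightarrow> y \<in> affine hull {y1, y2, y3}" for y
    using convex_hull_subset_affine_hull by blast
  let ?k = "\<lambda>x y. (x - y) /\<^sub>R trunc_dist \<delta> x y ^ 3"
  let ?X = "\<lambda>u v. x1 + u *\<^sub>R (x2 - x1) + v *\<^sub>R (x3 - x1)" and ?Y = "\<lambda>w z. y1 + w *\<^sub>R (y2 - y1) + z *\<^sub>R (y3 - y1)"
  have ck: "continuous_on UNIV (\<lambda>q. ?k (?X (fst (snd q)) (snd (snd q))) (fst q))"
    using trunc_dist_pos[OF \<delta>_nonzero] by (auto intro!: continuous_intros)
  have c: "continuous_on UNIV (\<lambda>y. (2 * Ax) *\<^sub>R tri_int (\<lambda>u v. ?k (?X u v) y))"
    by (intro continuous_intros continuous_on_tri_int ck)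
  have "(LINT y:?Sy|surface_measure ?Sy. ?g y) = (LINT y:?Sy|surface_measure ?Sy. (2 * Ax) *\<^sub>R tri_int (\<lambda>u v. ?k (?X u v) y))"
    using Sy by (intro set_integral_cong_on) (simp add: gradient_single_layer trunc_dist_eq[OF affine_hull_param_mem])
  also have "\<dots> = (2 * Ay) *\<^sub>R tri_int (\<lambda>w z. (2 * Ax) *\<^sub>R tri_int (\<lambda>u v. ?k (?X u v) (?Y w z)))"
    unfolding norm_cross_y[symmetric]
    by (rule surface_integral_triangle_vec(1)[OF ncy continuous_on_subset[OF c subset_UNIV]])
  also have "(\<lambda>w z. (2 * Ax) *\<^sub>R tri_int (\<lambda>u v. ?k (?X u v) (?Y w z))) = (\<lambda>w z. (2 * Ax) *\<^sub>R tri_int (\<lambda>u v. d u v w z /\<^sub>R norm (d u v w z) ^ 3))"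
    unfolding trunc_dist_eq[OF affine_hull_param_mem affine_hull_param_mem] diff_param ..
  also have "tri_int \<dots> = (2 * Ax) *\<^sub>R Z"
    unfolding Z_def
    by (rule tri_int_linear[OF bounded_linear.linear[OF bounded_linear_scaleR_right], symmetric])
      (intro continuous_on_tri_int continuous_intros, simp add: d_nonzero)
  finally show ?thesis by simp
qed

section \<open>Identification with the recursion\<close>

lemma rec_I4_eq_Z0:
  assumes "coefficient_choice s"
  shows "rec_I4 F1' s a1 a2 a3 a4 e = Z0"
proof -
  let ?\<psi> = "\<lambda>x. 1 / (sqrt x) ^ 3"
  have "rec_I4 F1' s a1 a2 a3 a4 e = duoprism_int ?\<psi> a1 a2 a3 a4 e"
  proof (rule rec_I4_eq[OF assms])
    show "C1_above (\<delta>\<^sup>2) (\<lambda>x. ?\<psi> (x + (h_perp [a1, a2, a3, a4] e)\<^sup>2)) (\<lambda>x. - ((3::nat) / 2) / (sqrt (x + \<bar>\<delta>\<bar>\<^sup>2)) ^ (3 + 2))"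
      unfolding h_perp_eq using C1_above_inverse_power_sqrt[of "\<bar>\<delta>\<bar>" 3] by simp
    show "0 < \<delta>\<^sup>2" using \<delta>_nonzero by simp
  next
    fix h1 h2 P :: real
    assume "0 \<le> h1" "0 \<le> h2" "0 < P" "0 < h1 \<and> h2 = 0 \<or> h1 = 0 \<and> 0 < h2"
    then show "F1' h1 h2 0 (h_perp [a1, a2, a3, a4] e) P = radial_mean 1 (\<lambda>x. radial_mean 2 (\<lambda>x.
        radial_mean 3 (radial_mean 4 (\<lambda>x. ?\<psi> (x + (h_perp [a1, a2, a3, a4] e)\<^sup>2))) (x + h2\<^sup>2)) (x + h1\<^sup>2)) (P\<^sup>2)"
      unfolding h_perp_eq using \<delta>_nonzero by (intro F1'_eq_radial_mean) auto
  qed (use a_span span_a34 in auto)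
  also have "\<dots> = tri_int (\<lambda>u v. tri_int (\<lambda>w z. 1 / norm (d u v w z) ^ 3))"
    unfolding duoprism_int_def simplex_int_def d_def by simp
  \<comment> \<open>\<open>duoprism_int\<close> has the parameters of the \<open>x\<close>-triangle
    outside, \<open>Z0\<close> those of the \<open>y\<close>-triangle.\<close>
  also have "\<dots> = Z0"
    unfolding Z0_def by (rule tri_int_swap) (auto intro!: continuous_intros simp: d_nonzero)
  finally show ?thesis .
qed

lemma rec_I3_eq_prism_int:
  assumes "coefficient_choice s" and "q \<in> span {a1, a2}" "b \<in> span {a1, a2}" "b \<noteq> 0"
  shows "rec_I3 F1_tilde s \<bar>\<delta>\<bar> a3 a4 b q = prism_int (\<lambda>x. 1 / sqrt (x + \<bar>\<delta>\<bar>\<^sup>2)) a3 a4 b q"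
proof (rule rec_I3_eq[OF assms(1)])
  show "C1_above (\<delta>\<^sup>2) (\<lambda>x. 1 / sqrt (x + \<bar>\<delta>\<bar>\<^sup>2)) (\<lambda>x. - ((1::nat) / 2) / (sqrt (x + \<bar>\<delta>\<bar>\<^sup>2)) ^ (1 + 2))"
    using C1_above_inverse_power_sqrt[of "\<bar>\<delta>\<bar>" 1] by simp
  show "0 < \<delta>\<^sup>2" using \<delta>_nonzero by simp
  fix h1 h2 P :: real
  assume "0 \<le> h1" "0 \<le> h2" "0 < P" "0 < h1 \<and> h2 = 0 \<or> h1 = 0 \<and> 0 < h2"
  then show "F1_tilde h1 h2 0 \<bar>\<delta>\<bar> P = radial_mean 1 (\<lambda>x. radial_mean 2 (\<lambda>x.
        radial_mean 3 (\<lambda>x. 1 / sqrt (x + \<bar>\<delta>\<bar>\<^sup>2)) (x + h2\<^sup>2)) (x + h1\<^sup>2)) (P\<^sup>2)"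
    using \<delta>_nonzero by (intro F1_tilde_eq_radial_mean) auto
qed (use assms a_span span_a34 in auto)

lemma Z_inner:
  "Z \<bullet> p = tri_int (\<lambda>w z. tri_int (\<lambda>u v. (d u v w z \<bullet> p) / norm (d u v w z) ^ 3))"
proof -
  have bl: "linear (\<lambda>x. x \<bullet> p)" by (rule bounded_linear.linear[OF bounded_linear_inner_left])
  have "Z \<bullet> p = tri_int (\<lambda>w z. tri_int (\<lambda>u v. d u v w z /\<^sub>R norm (d u v w z) ^ 3) \<bullet> p)"
    unfolding Z_def by (rule tri_int_linear[OF bl]) (intro continuous_on_tri_int continuous_intros, simp add: d_nonzero)
  also have "(\<lambda>w z. tri_int (\<lambda>u v. d u v w z /\<^sub>R norm (d u v w z) ^ 3) \<bullet> p)
    = (\<lambda>w z. tri_int (\<lambda>u v. (d u v w z /\<^sub>R norm (d u v w z) ^ 3) \<bullet> p))"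
    by (intro ext tri_int_linear[OF bl]) (intro continuous_intros, simp add: d_nonzero)
  finally show ?thesis by (simp add: divide_inverse mult.commute)
qed

lemma Z_inner_n: "Z \<bullet> n = - \<delta> * Z0"
proof -
  have "(\<lambda>w z. tri_int (\<lambda>u v. (d u v w z \<bullet> n) / norm (d u v w z) ^ 3)) = (\<lambda>w z. (- \<delta>) * tri_int (\<lambda>u v. 1 / norm (d u v w z) ^ 3))"
    unfolding d_inner_n by (subst tri_int_cmult[symmetric]) simp
  then show ?thesis unfolding Z_inner Z0_def by (simp only: tri_int_cmult)
qed

text \<open>In a tangential direction \<open>b\<close> the integrand is minus the derivative of the
  reciprocal distance along \<open>b\<close>, so the inner integral reduces to two edges. The offset
  can be projected to \<open>e'\<close>: the normal part is orthogonal to \<open>b\<close> and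
  enters the distance only through \<open>\<delta>\<close>.\<close>

lemma Z_inner_a:
  fixes \<psi>
  defines "\<psi> \<equiv> \<lambda>x. 1 / sqrt (x + \<bar>\<delta>\<bar>\<^sup>2)"
  shows "Z \<bullet> a1 = prism_int \<psi> a3 a4 a2 e' - prism_int \<psi> a3 a4 (a2 - a1) (e' + a1)"
    and "Z \<bullet> a2 = prism_int \<psi> a3 a4 a1 e' - prism_int \<psi> a3 a4 (a2 - a1) (e' + a1)"
proof -
  have C: "C1_above (\<delta>\<^sup>2) \<psi> (\<lambda>x. - (1 / 2) / (sqrt (x + \<bar>\<delta>\<bar>\<^sup>2)) ^ 3)"
    unfolding \<psi>_def using C1_above_inverse_power_sqrt[of "\<bar>\<delta>\<bar>" 1] by (simp add: numeral_3_eq_3)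
  have c: "0 < \<delta>\<^sup>2" using \<delta>_nonzero by simp
  define f where "f w z = e' + w *\<^sub>R a3 + z *\<^sub>R a4" for w z
  have X: "f w z + u *\<^sub>R a1 + v *\<^sub>R a2 = e' + u *\<^sub>R a1 + v *\<^sub>R a2 + w *\<^sub>R a3 + z *\<^sub>R a4" for u v w z
    by (simp add: f_def algebra_simps)
  have nd: "sqrt ((norm (f w z + u *\<^sub>R a1 + v *\<^sub>R a2))\<^sup>2 + \<bar>\<delta>\<bar>\<^sup>2) = norm (d u v w z)" for u v w z
    unfolding X norm_d_sq[symmetric] by simp
  have inn: "d u v w z \<bullet> b = b \<bullet> (f w z + u *\<^sub>R a1 + v *\<^sub>R a2)" if "b \<in> span {a1, a2}" for u v w z b
  proof -
    have "(e - e') \<bullet> b = 0"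
      using e_par(2)[of "[a1, a2, a3, a4]" e] that span_a1234 unfolding e'_def by (auto simp: orthogonal_def)
    then show ?thesis unfolding d_def f_def by (simp add: inner_add_left inner_add_right inner_diff_left inner_commute[of b])
  qed
  have t: "tri_int (\<lambda>u v. (d u v w z \<bullet> b) / norm (d u v w z) ^ 3)
     = - tri_int (\<lambda>u v. 2 * (b \<bullet> (f w z + u *\<^sub>R a1 + v *\<^sub>R a2)) * (- (1 / 2) / (sqrt ((norm (f w z + u *\<^sub>R a1 + v *\<^sub>R a2))\<^sup>2 + \<bar>\<delta>\<bar>\<^sup>2)) ^ 3))"
    if "b \<in> span {a1, a2}" for w z b
    unfolding nd inn[OF that] using tri_int_cmult[of "-1" "\<lambda>u v. - ((b \<bullet> (f w z + u *\<^sub>R a1 + v *\<^sub>R a2)) / norm (d u v w z) ^ 3)"] by simp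
  have diff: "tri_int (\<lambda>w z. line_int \<psi> b (e' + w *\<^sub>R a3 + z *\<^sub>R a4) + (-1) * line_int \<psi> b' (e' + a1 + w *\<^sub>R a3 + z *\<^sub>R a4))
    = prism_int \<psi> a3 a4 b e' + (-1) * prism_int \<psi> a3 a4 b' (e' + a1)" for b b'
    unfolding prism_int_def
    by (subst tri_int_add; (intro continuous_intros continuous_on_line_int[OF C1_above_continuous[OF C] c])?)
      (simp only: tri_int_cmult)
  have g: "tri_int (\<lambda>u v. (d u v w z \<bullet> a1) / norm (d u v w z) ^ 3)
      = line_int \<psi> a2 (e' + w *\<^sub>R a3 + z *\<^sub>R a4) + (-1) * line_int \<psi> (a2 - a1) (e' + a1 + w *\<^sub>R a3 + z *\<^sub>R a4)"
    "tri_int (\<lambda>u v. (d u v w z \<bullet> a2) / norm (d u v w z) ^ 3)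
      = line_int \<psi> a1 (e' + w *\<^sub>R a3 + z *\<^sub>R a4) + (-1) * line_int \<psi> (a2 - a1) (e' + a1 + w *\<^sub>R a3 + z *\<^sub>R a4)" for w z
    unfolding t[OF a_in(1)] t[OF a_in(2)] simplex_gradient[OF C c] by (simp_all add: f_def ac_simps)
  show "Z \<bullet> a1 = prism_int \<psi> a3 a4 a2 e' - prism_int \<psi> a3 a4 (a2 - a1) (e' + a1)"
    "Z \<bullet> a2 = prism_int \<psi> a3 a4 a1 e' - prism_int \<psi> a3 a4 (a2 - a1) (e' + a1)"
    unfolding Z_inner g diff by simp_all
qed

text \<open>Both sides have the same inner products with \<open>a1\<close>, \<open>a2\<close> and
  \<open>n\<close>. A conormal is orthogonal to its own edge, which is why
  \<open>Z \<bullet> a1\<close> involves only the other two edges. The third edge is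
  \<open>x1 - x3\<close>, hence \<open>- a2\<close>.\<close>

lemma Z_eq:
  fixes \<psi>
  defines "\<psi> \<equiv> \<lambda>x. 1 / sqrt (x + \<bar>\<delta>\<bar>\<^sup>2)"
  shows "(2 * Ax) *\<^sub>R Z = - (prism_int \<psi> a3 a4 a1 e' *\<^sub>R cross3 a1 n
      + prism_int \<psi> a3 a4 (a2 - a1) (e' + a1) *\<^sub>R cross3 (a2 - a1) n + prism_int \<psi> a3 a4 a2 e' *\<^sub>R cross3 (- a2) n)
    - (2 * Ax * \<delta> * Z0) *\<^sub>R n" (is "?L = ?R")
proof -
  have "n \<bullet> cross3 a1 a2 = 2 * Ax" unfolding cross_a_eq by (simp add: n_unit)
  then have *: "cross3 a1 n \<bullet> a1 = 0" "cross3 a2 n \<bullet> a2 = 0" "cross3 a1 n \<bullet> a2 = - (2 * Ax)" "cross3 a2 n \<bullet> a1 = 2 * Ax"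
    "cross3 a1 n \<bullet> n = 0" "cross3 a2 n \<bullet> n = 0" "n \<bullet> a1 = 0" "n \<bullet> a2 = 0"
    using cross_triple[of n a1 a2] cross_triple[of a1 a2 n] cross_triple[of a2 n a1] cross_triple[of a1 n a2]
      cross_skew[of a2 a1] cross_skew[of n a1] n_orth a_in
    by (simp_all add: dot_cross_self inner_commute)
  have cd: "cross3 (a2 - a1) n = cross3 a2 n - cross3 a1 n" by (rule Cross3.left_diff_distrib)
  have "norm (?L - ?R) = \<bar>(?L - ?R) \<bullet> n\<bar>"
  proof (rule norm_of_orth)
    show "(?L - ?R) \<bullet> a1 = 0" "(?L - ?R) \<bullet> a2 = 0"
      using * unfolding \<psi>_def cd
      by (simp_all add: Z_inner_a inner_diff_left inner_add_left algebra_simps)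
  qed
  also have "(?L - ?R) \<bullet> n = 0"
    using * Z_inner_n n_unit unfolding cd by (simp add: inner_diff_left inner_add_left algebra_simps)
  finally show ?thesis by simp
qed

lemma double_layer_representation:
  assumes "coefficient_choice s"
  shows "(LINT y:convex hull {y1, y2, y3}|surface_measure (convex hull {y1, y2, y3}).
     LINT x:convex hull {x1, x2, x3}|surface_measure (convex hull {x1, x2, x3}). n \<bullet> gradient (\<lambda>x. G x y) x)
   = 4 * Ax * Ay * \<delta> * rec_I4 F1' s a1 a2 a3 a4 e"
  unfolding double_layer_integral rec_I4_eq_Z0[OF assms] ..

text \<open>The normal coefficient is kept in terms of \<open>Z0\<close>, to be recognised as
  \<open>M\<close> through \<open>double_layer_integral\<close>.\<close>

lemma single_layer_gradient_representation:
  assumes s: "coefficient_choice s"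
  shows "(LINT y:convex hull {y1, y2, y3}|surface_measure (convex hull {y1, y2, y3}).
     gradient (\<lambda>y. LINT x:convex hull {x1, x2, x3}|surface_measure (convex hull {x1, x2, x3}). G x y) y)
   = - ((2 * norm (x2 - x1) * Ay * rec_I3 F1_tilde s \<bar>\<delta>\<bar> a3 a4 a1 e') *\<^sub>R conormal (x2 - x1) n
        + (2 * norm (x3 - x2) * Ay * rec_I3 F1_tilde s \<bar>\<delta>\<bar> a3 a4 (a2 - a1) (e' + a1)) *\<^sub>R conormal (x3 - x2) n
        + (2 * norm (x1 - x3) * Ay * rec_I3 F1_tilde s \<bar>\<delta>\<bar> a3 a4 a2 e') *\<^sub>R conormal (x1 - x3) n)
     - (4 * Ax * Ay * \<delta> * Z0) *\<^sub>R n"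
proof -
  have l: "x2 - x1 = a1" "x3 - x2 = a2 - a1" "x1 - x3 = - a2" by (simp_all add: a1_def a2_def)
  have k: "(2 * norm l * Ay * r) *\<^sub>R conormal l n = (2 * Ay) *\<^sub>R (r *\<^sub>R cross3 l n)" for l r
    using scaleR_conormal[of "2 * Ay * r" l n] by (simp add: mult_ac)
  have nz: "a1 \<noteq> 0" "a2 - a1 \<noteq> 0" "a2 \<noteq> 0" using a_span span_zero[of "{a2}"] span_base[of a2 "{a2}"] by auto
  have I: "rec_I3 F1_tilde s \<bar>\<delta>\<bar> a3 a4 a1 e' = prism_int (\<lambda>x. 1 / sqrt (x + \<bar>\<delta>\<bar>\<^sup>2)) a3 a4 a1 e'"
    "rec_I3 F1_tilde s \<bar>\<delta>\<bar> a3 a4 (a2 - a1) (e' + a1) = prism_int (\<lambda>x. 1 / sqrt (x + \<bar>\<delta>\<bar>\<^sup>2)) a3 a4 (a2 - a1) (e' + a1)"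
    "rec_I3 F1_tilde s \<bar>\<delta>\<bar> a3 a4 a2 e' = prism_int (\<lambda>x. 1 / sqrt (x + \<bar>\<delta>\<bar>\<^sup>2)) a3 a4 a2 e'"
    by (intro rec_I3_eq_prism_int[OF s] span_add span_diff e'_in a_in nz)+
  have "(4 * Ax * Ay) *\<^sub>R Z = (2 * Ay) *\<^sub>R ((2 * Ax) *\<^sub>R Z)" by simp
  also have "\<dots> = - ((2 * Ay) *\<^sub>R (prism_int (\<lambda>x. 1 / sqrt (x + \<bar>\<delta>\<bar>\<^sup>2)) a3 a4 a1 e' *\<^sub>R cross3 a1 n)
      + (2 * Ay) *\<^sub>R (prism_int (\<lambda>x. 1 / sqrt (x + \<bar>\<delta>\<bar>\<^sup>2)) a3 a4 (a2 - a1) (e' + a1) *\<^sub>R cross3 (a2 - a1) n)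
      + (2 * Ay) *\<^sub>R (prism_int (\<lambda>x. 1 / sqrt (x + \<bar>\<delta>\<bar>\<^sup>2)) a3 a4 a2 e' *\<^sub>R cross3 (- a2) n))
    - (2 * Ay) *\<^sub>R ((2 * Ax * \<delta> * Z0) *\<^sub>R n)"
    unfolding Z_eq by (simp only: scaleR_diff_right scaleR_minus_right scaleR_add_right)
  also have "(2 * Ay) *\<^sub>R ((2 * Ax * \<delta> * Z0) *\<^sub>R n) = (4 * Ax * Ay * \<delta> * Z0) *\<^sub>R n" by (simp add: mult_ac)
  finally show ?thesis unfolding single_layer_gradient_integral l k I .
qed

end

theorem mainTheorem3:
  fixes x1 x2 x3 y1 y2 y3 :: "real^3"
    and x0 y0 :: "real^3"
    and s :: "(real^3) list \<Rightarrow> real^3 \<Rightarrow> nat \<Rightarrow> real"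
  defines "Sx \<equiv> convex hull {x1, x2, x3}"
    and "Sy \<equiv> convex hull {y1, y2, y3}"
  defines "Ax \<equiv> surface_area Sx"
    and "Ay \<equiv> surface_area Sy"
    and "lx1 \<equiv> x2 - x1" and "lx2 \<equiv> x3 - x2" and "lx3 \<equiv> x1 - x3"
    and "nx \<equiv> unit_normal x1 x2 x3"
    and "a1 \<equiv> x2 - x1" and "a2 \<equiv> x3 - x1"
    and "a3 \<equiv> - (y2 - y1)" and "a4 \<equiv> - (y3 - y1)"
    and "e \<equiv> x1 - y1"
  defines "e' \<equiv> e_par [a1, a2, a3, a4] e"
    and "\<delta> \<equiv> nx \<bullet> (y0 - x0)"
    and "M \<equiv> (LINT y:Sy|surface_measure Sy. LINT x:Sx|surface_measure Sx.
                nx \<bullet> gradient (\<lambda>x. G x y) x)"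
    and "L' \<equiv> (LINT y:Sy|surface_measure Sy.
                gradient (\<lambda>y. LINT x:Sx|surface_measure Sx. G x y) y)"
  defines "I31 \<equiv> rec_I3 F1_tilde s \<bar>\<delta>\<bar> a3 a4 a1 e'"
    and "I32 \<equiv> rec_I3 F1_tilde s \<bar>\<delta>\<bar> a3 a4 (a2 - a1) (e' + a1)"
    and "I33 \<equiv> rec_I3 F1_tilde s \<bar>\<delta>\<bar> a3 a4 a2 e'"
  assumes "\<not> collinear {x1, x2, x3}" and "\<not> collinear {y1, y2, y3}"
    and "affine_parallel (affine hull Sx) (affine hull Sy)"
    and "affine hull Sx \<noteq> affine hull Sy"
    and "x0 \<in> Sx" and "y0 \<in> Sy"
    and "coefficient_choice s"
  shows "M = 4 * Ax * Ay * \<delta> * rec_I4 F1' s a1 a2 a3 a4 e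
    \<and> L' = - ((2 * norm lx1 * Ay * I31) *\<^sub>R conormal lx1 nx
              + (2 * norm lx2 * Ay * I32) *\<^sub>R conormal lx2 nx
              + (2 * norm lx3 * Ay * I33) *\<^sub>R conormal lx3 nx)
           - M *\<^sub>R nx"
proof -
  have loc: "parallel_triangles x1 x2 x3 y1 y2 y3"
    using assms(21-24) by unfold_locales (simp_all add: Sx_def Sy_def)
  note defs = parallel_triangles.a1_def[OF loc] parallel_triangles.a2_def[OF loc] parallel_triangles.a3_def[OF loc]
    parallel_triangles.a4_def[OF loc] parallel_triangles.e_def[OF loc] parallel_triangles.e'_def[OF loc]
    parallel_triangles.n_def[OF loc] parallel_triangles.Ax_def[OF loc] parallel_triangles.Ay_def[OF loc]
  have "x0 \<in> affine hull {x1, x2, x3}" "y0 \<in> affine hull {y1, y2, y3}"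
    using assms(25,26) convex_hull_subset_affine_hull unfolding Sx_def Sy_def by blast+
  \<comment> \<open>The signed distance is the same for every pair of points of the two planes, so
    \<open>x0\<close>, \<open>y0\<close> may replace the vertices \<open>x1\<close>,
    \<open>y1\<close>.\<close>
  from parallel_triangles.normal_diff[OF loc this]
  have \<delta>: "parallel_triangles.\<delta> x1 x2 x3 y1 = \<delta>"
    unfolding \<delta>_def nx_def parallel_triangles.n_def[OF loc] ..
  have M: "M = 4 * Ax * Ay * \<delta> * rec_I4 F1' s a1 a2 a3 a4 e"
    using parallel_triangles.double_layer_representation[OF loc assms(27), unfolded defs \<delta>]
    unfolding M_def nx_def Ax_def Ay_def Sx_def Sy_def a1_def a2_def a3_def a4_def e_def .
  have Z0: "M = 4 * Ax * Ay * \<delta> * parallel_triangles.Z0 x1 x2 x3 y1 y2 y3"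
    using parallel_triangles.double_layer_integral[OF loc, unfolded defs \<delta>]
    unfolding M_def nx_def Ax_def Ay_def Sx_def Sy_def .
  have "L' = - ((2 * norm lx1 * Ay * I31) *\<^sub>R conormal lx1 nx
              + (2 * norm lx2 * Ay * I32) *\<^sub>R conormal lx2 nx
              + (2 * norm lx3 * Ay * I33) *\<^sub>R conormal lx3 nx)
           - M *\<^sub>R nx"
    using parallel_triangles.single_layer_gradient_representation[OF loc assms(27), unfolded defs \<delta>]
    unfolding Z0 L'_def I31_def I32_def I33_def lx1_def lx2_def lx3_def nx_def Ax_def Ay_def Sx_def Sy_def
      a1_def a2_def a3_def a4_def e'_def e_def .
  with M show ?thesis ..
qed

end
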